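(* Let $\phi$ be an inner function on $\mathbb{D}^2$ that depends on both $z_1$ and $z_2$, and let $\alpha\in\mathbb{T}$. Assume that $J_\alpha\colon K_\phi\to L^2(\sigma_\alpha)$ is surjective, that $\vartheta^1_\alpha$ is bounded on $\mathbb{D}^2$, that $\frac{1}{1-\bar\alpha\phi(0,z_2)}\in H^2_2$, and that $\phi(0,z_2)\not\equiv0$. Then the projection $P_\phi$ is needed in the formula $$U^1_\alpha=S^1_\phi+P_\phi P_{H^2_2}M_{\overline{\vartheta^1_\alpha}};$$ that is, there exists $f\in K_\phi$ such that $P_{H^2_2}M_{\overline{\vartheta^1_\alpha}}f\notin K_\phi$.
   Context: $\mathbb{D}$ is the open unit disk, $\mathbb{T}$ the unit circle. $H^2(\mathbb{D}^2)$ is the Hardy space of holomorphic $f=\sum_{k,l\ge0}a_{k,l}z_1^kz_2^l$ on $\mathbb{D}^2$ with $\|f\|^2=\sum|a_{k,l}|^2<\infty$, identified via boundary values with a closed subspace of $L^2=L^2(\mathbb{T}^2)$ (normalized Lebesgue measure). A function $\phi$ is inner on $\mathbb{D}^2$ if it is bounded and holomorphic on $\mathbb{D}^2$ with non-tangential boundary values of modulus $1$ a.e. on $\mathbb{T}^2$. The model space is $K_\phi=H^2(\mathbb{D}^2)\ominus\phi H^2(\mathbb{D}^2)$; $P_\phi\colon H^2(\mathbb{D}^2)\to K_\phi$ is the orthogonal projection, and $S^1_\phi f=P_\phi(z_1f)$ for $f\in K_\phi$ is the compressed shift. $k_w(z)=\frac{1}{(1-z_1\bar w_1)(1-z_2\bar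 w_2)}$, and $k_w^\phi(z)=\frac{1-\phi(z)\overline{\phi(w)}}{(1-z_1\bar w_1)(1-z_2\bar w_2)}$ is the reproducing kernel of $K_\phi$. Clark measure: for $\alpha\in\mathbb{T}$, $\sigma_\alpha$ is the positive Borel measure on $\mathbb{T}^2$ with $\frac{1-|\phi(z)|^2}{|\alpha-\phi(z)|^2}=\int_{\mathbb{T}^2}P_{z_1}(\zeta_1)P_{z_2}(\zeta_2)\,d\sigma_\alpha(\zeta)$ for all $z\in\mathbb{D}^2$, where $P_{z_j}(\zeta_j)=\frac{1-|z_j|^2}{|\zeta_j-z_j|^2}$. Clark embedding: $J_\alpha\colon K_\phi\to L^2(\sigma_\alpha)$ is the linear isometry (known to exist, not necessarily surjective) determined by $J_\alpha k_w^\phi=(1-\alpha\overline{\phi(w)})\,k_w$ for all $w\in\mathbb{D}^2$. With $(B_1f)(z)=\frac{f(z)-f(0,z_2)}{z_1}$, the holomorphic function $\vartheta^1_\alpha$ on $\mathbb{D}^2$ is $\vartheta^1_\alpha(z)=\bar\alpha\,\frac{(B_1\phi)(z)}{1-\bar\alpha\phi(0,z_2)}$. When it is bounded, $M_{\overline{\vartheta^1_\alpha}}$ is multiplication on $L^2(\mathbb{T}^2)$ by the complex conjugate of (the boundary values of) $\vartheta^1_\alpha$. $H^2_2\subset H^2(\mathbb{D}^2)$ is the one-variable Hardy space $H^2(\mathbb{D})$ in the variable $z_2$, and $P_{H^2_2}$ is the orthogonal projection of $L^2(\mathbb{T}^2)$ onto $H^2_2$. *)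

theory Defs
  imports "HOL-Analysis.Analysis"
begin

text \<open>
  Functions on the bidisc are total functions on \<open>\<complex> \<times> \<complex>\<close>; their values outside
  the bidisc are arbitrary, and no notion below depends on them.
\<close>

definition bidisc :: "(complex \<times> complex) set" where
  "bidisc = ball 0 1 \<times> ball 0 1"

definition torus :: "(complex \<times> complex) set" where
  "torus = sphere 0 1 \<times> sphere 0 1"

definition torus_measure :: "(complex \<times> complex) measure" where
  "torus_measure =
     distr (uniform_measure lborel ({0..<2 * pi} \<times> {0..<2 * pi}))
       (restrict_space borel torus) (\<lambda>(s, t). (cis s, cis t))"


subsection \<open>Square-integrable functions\<close>

text \<open>Elements of \<open>L\<^sup>2\<close> are represented by functions; equality is equality almost everywhere.\<close>

definition L2 :: "'a measure \<Rightarrow> ('a \<Rightarrow> complex) set" where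
  "L2 M = {F \<in> borel_measurable M. integrable M (\<lambda>x. (cmod (F x))\<^sup>2)}"

definition L2_inner :: "'a measure \<Rightarrow> ('a \<Rightarrow> complex) \<Rightarrow> ('a \<Rightarrow> complex) \<Rightarrow> complex" where
  "L2_inner M F G = (\<integral>x. F x * cnj (G x) \<partial>M)"

definition L2_norm :: "'a measure \<Rightarrow> ('a \<Rightarrow> complex) \<Rightarrow> real" where
  "L2_norm M F = sqrt (\<integral>x. (cmod (F x))\<^sup>2 \<partial>M)"


subsection \<open>Hardy spaces\<close>

definition hardy_coeffs :: "(complex \<times> complex \<Rightarrow> complex) \<Rightarrow> (nat \<times> nat \<Rightarrow> complex) \<Rightarrow> bool" where
  "hardy_coeffs f a \<longleftrightarrow>
     (\<lambda>i. (cmod (a i))\<^sup>2) summable_on UNIV \<and>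
     (\<forall>z\<in>bidisc. ((\<lambda>(k, l). a (k, l) * fst z ^ k * snd z ^ l) has_sum f z) UNIV)"

definition hardy_space :: "(complex \<times> complex \<Rightarrow> complex) set" where
  "hardy_space = {f. \<exists>a. hardy_coeffs f a}"

definition taylor_coeffs :: "(complex \<times> complex \<Rightarrow> complex) \<Rightarrow> nat \<times> nat \<Rightarrow> complex" where
  "taylor_coeffs f = (THE a. hardy_coeffs f a)"

definition hardy_inner ::
    "(complex \<times> complex \<Rightarrow> complex) \<Rightarrow> (complex \<times> complex \<Rightarrow> complex) \<Rightarrow> complex" where
  "hardy_inner f g = (\<Sum>\<^sub>\<infinity>i. taylor_coeffs f i * cnj (taylor_coeffs g i))"

definition hardy_norm :: "(complex \<times> complex \<Rightarrow> complex) \<Rightarrow> real" where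
  "hardy_norm f = sqrt (\<Sum>\<^sub>\<infinity>i. (cmod (taylor_coeffs f i))\<^sup>2)"

text \<open>
  The identification of the Hardy space with a closed subspace of \<open>L\<^sup>2(\<T>\<^sup>2)\<close>: the boundary
  function is the limit in \<open>L\<^sup>2(\<T>\<^sup>2)\<close> of the dilations \<open>\<zeta> \<mapsto> f(r\<zeta>)\<close> as \<open>r\<close> increases to \<open>1\<close>.
  For functions in the Hardy space it exists, is unique up to null sets, and agrees almost
  everywhere with the non-tangential limit of \<open>f\<close>.
\<close>

definition boundary_function ::
    "(complex \<times> complex \<Rightarrow> complex) \<Rightarrow> (complex \<times> complex \<Rightarrow> complex) \<Rightarrow> bool" where
  "boundary_function f F \<longleftrightarrow>
     F \<in> L2 torus_measure \<and>
     ((\<lambda>r. L2_norm torus_measure (\<lambda>\<zeta>. f (r *\<^sub>R \<zeta>) - F \<zeta>)) \<longlongrightarrow> 0) (at_left 1)"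

definition boundary_values ::
    "(complex \<times> complex \<Rightarrow> complex) \<Rightarrow> complex \<times> complex \<Rightarrow> complex" where
  "boundary_values f = (SOME F. boundary_function f F)"

definition hardy_disc :: "(complex \<Rightarrow> complex) set" where
  "hardy_disc =
     {g. \<exists>b. summable (\<lambda>l. (cmod (b l))\<^sup>2) \<and> (\<forall>w\<in>ball 0 1. (\<lambda>l. b l * w ^ l) sums g w)}"

definition hardy_z2 :: "(complex \<times> complex \<Rightarrow> complex) set" where
  "hardy_z2 = {f. \<exists>g\<in>hardy_disc. \<forall>z\<in>bidisc. f z = g (snd z)}"

text \<open>
  Orthogonal projection of \<open>L\<^sup>2(\<T>\<^sup>2)\<close> onto the Hardy space in the variable \<open>z\<^sub>2\<close>.
  The value is determined as a function on the bidisc.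
\<close>

definition proj_hardy_z2 ::
    "(complex \<times> complex \<Rightarrow> complex) \<Rightarrow> complex \<times> complex \<Rightarrow> complex" where
  "proj_hardy_z2 G =
     (SOME g. g \<in> hardy_z2 \<and>
        (\<forall>h\<in>hardy_z2.
           L2_inner torus_measure (\<lambda>\<zeta>. G \<zeta> - boundary_values g \<zeta>) (boundary_values h) = 0))"


subsection \<open>Inner functions and model spaces\<close>

definition holomorphic_bidisc :: "(complex \<times> complex \<Rightarrow> complex) \<Rightarrow> bool" where
  "holomorphic_bidisc f \<longleftrightarrow>
     (\<forall>z\<in>bidisc. \<exists>c d. (f has_derivative (\<lambda>h. c * fst h + d * snd h)) (at z))"

definition stolz_region :: "real \<Rightarrow> complex \<Rightarrow> complex set" where
  "stolz_region c \<zeta> = {z \<in> ball 0 1. cmod (\<zeta> - z) < c * (1 - cmod z)}"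

definition nontangential_limit ::
    "(complex \<times> complex \<Rightarrow> complex) \<Rightarrow> complex \<times> complex \<Rightarrow> complex \<Rightarrow> bool" where
  "nontangential_limit f \<zeta> L \<longleftrightarrow>
     (\<forall>c>1. (f \<longlongrightarrow> L) (at \<zeta> within stolz_region c (fst \<zeta>) \<times> stolz_region c (snd \<zeta>)))"

definition inner_function :: "(complex \<times> complex \<Rightarrow> complex) \<Rightarrow> bool" where
  "inner_function \<phi> \<longleftrightarrow>
     bounded (\<phi> ` bidisc) \<and> holomorphic_bidisc \<phi> \<and>
     (AE \<zeta> in torus_measure. \<exists>L. nontangential_limit \<phi> \<zeta> L \<and> cmod L = 1)"

definition depends_on_z1 :: "(complex \<times> complex \<Rightarrow> complex) \<Rightarrow> bool" where
  "depends_on_z1 f \<longleftrightarrow> (\<exists>z1\<in>ball 0 1. \<exists>z1'\<in>ball 0 1. \<exists>z2\<in>ball 0 1. f (z1, z2) \<noteq> f (z1', z2))"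

definition depends_on_z2 :: "(complex \<times> complex \<Rightarrow> complex) \<Rightarrow> bool" where
  "depends_on_z2 f \<longleftrightarrow> (\<exists>z1\<in>ball 0 1. \<exists>z2\<in>ball 0 1. \<exists>z2'\<in>ball 0 1. f (z1, z2) \<noteq> f (z1, z2'))"

definition model_space ::
    "(complex \<times> complex \<Rightarrow> complex) \<Rightarrow> (complex \<times> complex \<Rightarrow> complex) set" where
  "model_space \<phi> =
     {f \<in> hardy_space. \<forall>h\<in>hardy_space. hardy_inner f (\<lambda>z. \<phi> z * h z) = 0}"

definition szego_kernel :: "complex \<times> complex \<Rightarrow> complex \<times> complex \<Rightarrow> complex" where
  "szego_kernel w z = 1 / ((1 - fst z * cnj (fst w)) * (1 - snd z * cnj (snd w)))"

definition model_kernel ::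
    "(complex \<times> complex \<Rightarrow> complex) \<Rightarrow> complex \<times> complex \<Rightarrow> complex \<times> complex \<Rightarrow> complex" where
  "model_kernel \<phi> w z =
     (1 - \<phi> z * cnj (\<phi> w)) / ((1 - fst z * cnj (fst w)) * (1 - snd z * cnj (snd w)))"


subsection \<open>Clark measures and Clark embeddings\<close>

definition poisson_kernel :: "complex \<Rightarrow> complex \<Rightarrow> real" where
  "poisson_kernel z \<zeta> = (1 - (cmod z)\<^sup>2) / (cmod (\<zeta> - z))\<^sup>2"

definition clark_measure ::
    "(complex \<times> complex \<Rightarrow> complex) \<Rightarrow> complex \<Rightarrow> (complex \<times> complex) measure \<Rightarrow> bool" where
  "clark_measure \<phi> \<alpha> \<sigma> \<longleftrightarrow>
     sets \<sigma> = sets (restrict_space borel torus) \<and>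
     (\<forall>z\<in>bidisc.
        has_bochner_integral \<sigma>
          (\<lambda>\<zeta>. poisson_kernel (fst z) (fst \<zeta>) * poisson_kernel (snd z) (snd \<zeta>))
          ((1 - (cmod (\<phi> z))\<^sup>2) / (cmod (\<alpha> - \<phi> z))\<^sup>2))"

definition clark_embedding ::
    "(complex \<times> complex \<Rightarrow> complex) \<Rightarrow> complex \<Rightarrow> (complex \<times> complex) measure \<Rightarrow>
     ((complex \<times> complex \<Rightarrow> complex) \<Rightarrow> complex \<times> complex \<Rightarrow> complex) \<Rightarrow> bool" where
  "clark_embedding \<phi> \<alpha> \<sigma> J \<longleftrightarrow>
     (\<forall>f\<in>model_space \<phi>. J f \<in> L2 \<sigma>) \<and>
     (\<forall>f\<in>model_space \<phi>. \<forall>g\<in>model_space \<phi>. \<forall>a b.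
        AE \<zeta> in \<sigma>. J (\<lambda>z. a * f z + b * g z) \<zeta> = a * J f \<zeta> + b * J g \<zeta>) \<and>
     (\<forall>f\<in>model_space \<phi>. L2_norm \<sigma> (J f) = hardy_norm f) \<and>
     (\<forall>w\<in>bidisc.
        AE \<zeta> in \<sigma>. J (model_kernel \<phi> w) \<zeta> = (1 - \<alpha> * cnj (\<phi> w)) * szego_kernel w \<zeta>)"

definition surjective_onto_L2 ::
    "(complex \<times> complex \<Rightarrow> complex) \<Rightarrow> (complex \<times> complex) measure \<Rightarrow>
     ((complex \<times> complex \<Rightarrow> complex) \<Rightarrow> complex \<times> complex \<Rightarrow> complex) \<Rightarrow> bool" where
  "surjective_onto_L2 \<phi> \<sigma> J \<longleftrightarrow>
     (\<forall>G\<in>L2 \<sigma>. \<exists>f\<in>model_space \<phi>. AE \<zeta> in \<sigma>. J f \<zeta> = G \<zeta>)"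


subsection \<open>The multiplier\<close>

text \<open>At \<open>z\<^sub>1 = 0\<close> the difference quotient takes its holomorphic (limiting) value.\<close>

definition backward_shift1 ::
    "(complex \<times> complex \<Rightarrow> complex) \<Rightarrow> complex \<times> complex \<Rightarrow> complex" where
  "backward_shift1 f z =
     (if fst z = 0 then deriv (\<lambda>w. f (w, snd z)) 0
      else (f z - f (0, snd z)) / fst z)"

definition clark_theta1 ::
    "(complex \<times> complex \<Rightarrow> complex) \<Rightarrow> complex \<Rightarrow> complex \<times> complex \<Rightarrow> complex" where
  "clark_theta1 \<phi> \<alpha> z = cnj \<alpha> * (backward_shift1 \<phi> z / (1 - cnj \<alpha> * \<phi> (0, snd z)))"

text \<open>Multiplication on \<open>L\<^sup>2(\<T>\<^sup>2)\<close> by the conjugate of the boundary values of \<open>\<theta>\<close>.\<close>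

definition mult_cnj_boundary ::
    "(complex \<times> complex \<Rightarrow> complex) \<Rightarrow> (complex \<times> complex \<Rightarrow> complex) \<Rightarrow>
     complex \<times> complex \<Rightarrow> complex" where
  "mult_cnj_boundary \<theta> F \<zeta> = cnj (boundary_values \<theta> \<zeta>) * F \<zeta>"

end

theory Submission
  imports Defs "HOL-Complex_Analysis.Complex_Analysis" "HOL-Probability.Probability_Measure"
begin

text \<open>
  Write \<open>c = \<phi>(0, z\<^sub>2)\<close>, regarded as a function on the bidisc, \<open>\<theta>\<close> for the multiplier, and suppose
  that \<open>P\<^bsub>H\<^sub>2\<^esub> (cnj \<theta> \<cdot> f)\<close> lies in \<open>K\<^sub>\<phi>\<close> for every \<open>f\<close> in \<open>K\<^sub>\<phi>\<close>. Pairing with \<open>\<phi>\<close>, whose projection to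
  the functions of \<open>z\<^sub>2\<close> is \<open>c\<close>, gives that \<open>\<theta> c\<close> is orthogonal to \<open>K\<^sub>\<phi>\<close>, so \<open>\<theta> c = \<phi> g\<close> with \<open>g\<close> in \<open>H\<^sup>2\<close>.
  Clearing denominators, \<open>(\<phi> - c) c = \<phi> u\<close> with \<open>u = \<alpha> z\<^sub>1 (1 - cnj \<alpha> c) g\<close>, that is \<open>\<phi> (c - u) = c\<^sup>2\<close>.
  Since \<open>\<phi>\<close> is inner and \<open>u\<close> is divisible by \<open>z\<^sub>1\<close>, comparing norms forces \<open>u = 0\<close>. Hence
  \<open>(\<phi> - c) c = 0\<close>, and as \<open>c\<close> does not vanish identically, \<open>\<phi> = c\<close> does not depend on \<open>z\<^sub>1\<close>.
\<close>


subsection \<open>Square-integrable functions\<close>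

text \<open>The assumption is an integral relation between boundary functions on the torus, whereas
  the factorisation is needed pointwise on the bidisc. Szego kernels are the bridge. Tested on the
  kernel of K_\<phi> at w, the relation becomes exactly \<theta>(w) c(w) - \<phi>(w) g(w) = 0, where
  g is the Szego integral of conj(\<phi>) \<theta> c; so each kernel gives the identity at its own
  point, and g is an explicit function rather than the outcome of a limiting argument. Two obstacles
  shape the preparation. Boundary functions are arbitrary choices of L2 limits of dilations, so that
  they respect products, and that those of \<phi> are unimodular, has to be shown almost everywhere.
  And an inner function is only assumed bounded, so |\<phi>| \<le> 1 inside, on which the norm
  comparison rests, must be recovered from the modulus on the torus. Both are reached through the
  dilations f(r \<zeta>) with r < 1, which are continuous on the torus and have uniformly convergent
  series there.\<close>

lemma L2_I: "F \<in> borel_measurable M \<Longrightarrow> integrable M (\<lambda>x. (cmod (F x))\<^sup>2) \<Longrightarrow> F \<in> L2 M"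
  by (simp add: L2_def)

lemma L2_D:
  assumes "F \<in> L2 M"
  shows "F \<in> borel_measurable M" "integrable M (\<lambda>x. (cmod (F x))\<^sup>2)"
  using assms by (simp_all add: L2_def)

lemma L2_norm_nonneg: "0 \<le> L2_norm M F"
  by (simp add: L2_norm_def)

lemma L2_norm_sq: "(L2_norm M F)\<^sup>2 = (\<integral>x. (cmod (F x))\<^sup>2 \<partial>M)"
  by (simp add: L2_norm_def)

lemma L2_abs_mult_integrable:
  assumes "F \<in> L2 M" "G \<in> L2 M"
  shows "integrable M (\<lambda>x. cmod (F x) * cmod (G x))"
proof (rule Bochner_Integration.integrable_bound)
  note [measurable] = L2_D(1)[OF assms(1)] L2_D(1)[OF assms(2)]
  show "integrable M (\<lambda>x. (cmod (F x))\<^sup>2 + (cmod (G x))\<^sup>2)"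
    using assms by (auto dest: L2_D)
  show "(\<lambda>x. cmod (F x) * cmod (G x)) \<in> borel_measurable M" by measurable
  have "a * b \<le> a\<^sup>2 + b\<^sup>2" if "a \<ge> 0" "b \<ge> 0" for a b :: real
    using sum_squares_bound[of a b] mult_nonneg_nonneg[OF that] by linarith
  then show "AE x in M. norm (cmod (F x) * cmod (G x)) \<le> norm ((cmod (F x))\<^sup>2 + (cmod (G x))\<^sup>2)"
    by simp
qed

lemma L2_mult_integrable:
  assumes "F \<in> L2 M" "G \<in> L2 M"
  shows "integrable M (\<lambda>x. F x * cnj (G x))"
proof -
  note [measurable] = L2_D(1)[OF assms(1)] L2_D(1)[OF assms(2)]
  show ?thesis
    by (rule Bochner_Integration.integrable_bound[OF L2_abs_mult_integrable[OF assms]])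
       (auto simp: norm_mult intro!: AE_I2 borel_measurable_times
          measurable_compose[OF L2_D(1)[OF assms(2)]] L2_D(1)[OF assms(1)] borel_measurable_continuous_onI continuous_intros)
qed

lemma L2_Cauchy_Schwarz:
  assumes "F \<in> L2 M" "G \<in> L2 M"
  shows "(\<integral>x. cmod (F x) * cmod (G x) \<partial>M) \<le> L2_norm M F * L2_norm M G"
proof -
  note [measurable] = L2_D(1)[OF assms(1)] L2_D(1)[OF assms(2)]
  have "(\<integral>\<^sup>+x. ennreal (cmod (F x)) * ennreal (cmod (G x)) \<partial>M)\<^sup>2
      \<le> (\<integral>\<^sup>+x. (ennreal (cmod (F x)))\<^sup>2 \<partial>M) * (\<integral>\<^sup>+x. (ennreal (cmod (G x)))\<^sup>2 \<partial>M)"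
    by (rule Cauchy_Schwarz_nn_integral) measurable
  moreover have "(\<integral>\<^sup>+x. ennreal (cmod (F x)) * ennreal (cmod (G x)) \<partial>M)
      = ennreal (\<integral>x. cmod (F x) * cmod (G x) \<partial>M)"
    by (subst nn_integral_eq_integral[symmetric])
       (auto simp: ennreal_mult intro: L2_abs_mult_integrable[OF assms])
  moreover have "(\<integral>\<^sup>+x. (ennreal (cmod (F x)))\<^sup>2 \<partial>M) = ennreal ((L2_norm M F)\<^sup>2)"
    by (subst L2_norm_sq, subst nn_integral_eq_integral[symmetric])
       (auto simp: ennreal_power intro: L2_D(2)[OF assms(1)])
  moreover have "(\<integral>\<^sup>+x. (ennreal (cmod (G x)))\<^sup>2 \<partial>M) = ennreal ((L2_norm M G)\<^sup>2)"
    by (subst L2_norm_sq, subst nn_integral_eq_integral[symmetric])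
       (auto simp: ennreal_power intro: L2_D(2)[OF assms(2)])
  ultimately have "ennreal ((\<integral>x. cmod (F x) * cmod (G x) \<partial>M)\<^sup>2)
      \<le> ennreal ((L2_norm M F * L2_norm M G)\<^sup>2)"
    by (simp add: ennreal_power ennreal_mult[symmetric] power_mult_distrib)
  then have "(\<integral>x. cmod (F x) * cmod (G x) \<partial>M)\<^sup>2 \<le> (L2_norm M F * L2_norm M G)\<^sup>2"
    by (simp add: ennreal_le_iff)
  then show ?thesis
    by (rule power2_le_imp_le) (simp add: L2_norm_nonneg)
qed

lemma L2_inner_bound:
  assumes "F \<in> L2 M" "G \<in> L2 M"
  shows "cmod (\<integral>x. F x * cnj (G x) \<partial>M) \<le> L2_norm M F * L2_norm M G"
proof -
  have "cmod (\<integral>x. F x * cnj (G x) \<partial>M) \<le> (\<integral>x. cmod (F x * cnj (G x)) \<partial>M)"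
    by (rule integral_norm_bound)
  with L2_Cauchy_Schwarz[OF assms] show ?thesis
    by (simp add: norm_mult)
qed

lemma L2_cmult: "F \<in> L2 M \<Longrightarrow> (\<lambda>x. c * F x) \<in> L2 M"
  by (auto simp: L2_def norm_mult power_mult_distrib)

lemma L2_add:
  assumes "F \<in> L2 M" "G \<in> L2 M"
  shows "(\<lambda>x. F x + G x) \<in> L2 M"
proof (rule L2_I)
  note [measurable] = L2_D(1)[OF assms(1)] L2_D(1)[OF assms(2)]
  show "(\<lambda>x. F x + G x) \<in> borel_measurable M" by measurable
  show "integrable M (\<lambda>x. (cmod (F x + G x))\<^sup>2)"
  proof (rule Bochner_Integration.integrable_bound)
    show "integrable M (\<lambda>x. 2 * (cmod (F x))\<^sup>2 + 2 * (cmod (G x))\<^sup>2)"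
      using L2_D(2)[OF assms(1)] L2_D(2)[OF assms(2)] by simp
    have "(cmod (a + b))\<^sup>2 \<le> 2 * (cmod a)\<^sup>2 + 2 * (cmod b)\<^sup>2" for a b
    proof -
      have "(cmod (a + b))\<^sup>2 \<le> (cmod a + cmod b)\<^sup>2"
        by (intro power_mono norm_triangle_ineq) simp
      with sum_squares_bound[of "cmod a" "cmod b"] show ?thesis
        by (simp add: power2_sum)
    qed
    then show "AE x in M. norm ((cmod (F x + G x))\<^sup>2) \<le> norm (2 * (cmod (F x))\<^sup>2 + 2 * (cmod (G x))\<^sup>2)"
      by simp
  qed simp
qed

lemma L2_diff: "F \<in> L2 M \<Longrightarrow> G \<in> L2 M \<Longrightarrow> (\<lambda>x. F x - G x) \<in> L2 M"
  using L2_add[of F M "\<lambda>x. (-1) * G x"] L2_cmult[of G M "-1"] by simp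

lemma L2_cnj: "F \<in> L2 M \<Longrightarrow> (\<lambda>x. cnj (F x)) \<in> L2 M"
  unfolding L2_def
  by (auto intro!: measurable_compose[of F M borel cnj borel] borel_measurable_continuous_onI continuous_intros)

lemma L2_norm_cmult: "L2_norm M (\<lambda>x. c * F x) = cmod c * L2_norm M F"
  by (simp add: L2_norm_def norm_mult power_mult_distrib real_sqrt_mult)

lemma L2_norm_triangle:
  assumes "F \<in> L2 M" "G \<in> L2 M"
  shows "L2_norm M (\<lambda>x. F x + G x) \<le> L2_norm M F + L2_norm M G"
proof (rule power2_le_imp_le)
  note i = L2_D(2)[OF assms(1)] L2_D(2)[OF assms(2)] L2_abs_mult_integrable[OF assms]
  have "(L2_norm M (\<lambda>x. F x + G x))\<^sup>2
      \<le> (\<integral>x. (cmod (F x))\<^sup>2 + (cmod (G x))\<^sup>2 + 2 * (cmod (F x) * cmod (G x)) \<partial>M)"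
    unfolding L2_norm_sq
  proof (rule integral_mono)
    show "(cmod (F x + G x))\<^sup>2 \<le> (cmod (F x))\<^sup>2 + (cmod (G x))\<^sup>2 + 2 * (cmod (F x) * cmod (G x))" for x
      using power_mono[OF norm_triangle_ineq[of "F x" "G x"], of 2] by (simp add: power2_sum)
    show "integrable M (\<lambda>x. (cmod (F x + G x))\<^sup>2)"
      by (rule L2_D(2)[OF L2_add[OF assms]])
  qed (use i in auto)
  also have "\<dots> = (L2_norm M F)\<^sup>2 + (L2_norm M G)\<^sup>2 + 2 * (\<integral>x. cmod (F x) * cmod (G x) \<partial>M)"
    using i by (simp add: L2_norm_sq)
  also have "\<dots> \<le> (L2_norm M F + L2_norm M G)\<^sup>2"
    using L2_Cauchy_Schwarz[OF assms] by (simp add: power2_sum)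
  finally show "(L2_norm M (\<lambda>x. F x + G x))\<^sup>2 \<le> (L2_norm M F + L2_norm M G)\<^sup>2" .
qed (simp add: L2_norm_nonneg)

lemma L2_norm_minus_commute: "L2_norm M (\<lambda>x. F x - G x) = L2_norm M (\<lambda>x. G x - F x)"
  by (simp add: L2_norm_def norm_minus_commute)

lemma L2_norm_diff_triangle:
  assumes "F \<in> L2 M" "G \<in> L2 M" "H \<in> L2 M"
  shows "L2_norm M (\<lambda>x. F x - H x) \<le> L2_norm M (\<lambda>x. F x - G x) + L2_norm M (\<lambda>x. G x - H x)"
  using L2_norm_triangle[OF L2_diff[OF assms(1,2)] L2_diff[OF assms(2,3)]] by simp

lemma L2_mult_bounded:
  assumes "F \<in> L2 M" and [measurable]: "b \<in> borel_measurable M" and "AE x in M. cmod (b x) \<le> B"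
  shows "(\<lambda>x. b x * F x) \<in> L2 M"
proof (rule L2_I)
  note [measurable] = L2_D(1)[OF assms(1)]
  show "(\<lambda>x. b x * F x) \<in> borel_measurable M" by measurable
  show "integrable M (\<lambda>x. (cmod (b x * F x))\<^sup>2)"
  proof (rule Bochner_Integration.integrable_bound)
    show "integrable M (\<lambda>x. B\<^sup>2 * (cmod (F x))\<^sup>2)" using L2_D(2)[OF assms(1)] by simp
    show "AE x in M. norm ((cmod (b x * F x))\<^sup>2) \<le> norm (B\<^sup>2 * (cmod (F x))\<^sup>2)"
      using assms(3) by eventually_elim
        (auto simp: norm_mult power_mult_distrib intro!: mult_right_mono power_mono)
  qed simp
qed

lemma (in prob_space) L1_le_L2_norm:
  assumes "F \<in> L2 M"
  shows "integrable M F" "(\<integral>x. cmod (F x) \<partial>M) \<le> L2_norm M F"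
proof -
  have one: "(\<lambda>x. 1) \<in> L2 M" "L2_norm M (\<lambda>x. 1) = 1"
    by (auto simp: L2_def L2_norm_def prob_space)
  show "integrable M F" using L2_mult_integrable[OF assms one(1)] by simp
  show "(\<integral>x. cmod (F x) \<partial>M) \<le> L2_norm M F"
    using L2_Cauchy_Schwarz[OF assms one(1)] one(2) by simp
qed

text \<open>On a probability space the L1 norm is at most the L2 norm. This is how pointwise
  information (sup bounds, radial limits) reaches boundary functions, which are defined by an L2
  limit.\<close>

lemma (in prob_space) L2_norm_tendsto_0_AE_subseq:
  assumes u: "\<And>n. u n \<in> L2 M" and lim: "(\<lambda>n. L2_norm M (u n)) \<longlonglongrightarrow> 0"
  shows "\<exists>r::nat\<Rightarrow>nat. strict_mono r \<and> (AE x in M. (\<lambda>n. u (r n) x) \<longlonglongrightarrow> 0)"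
proof (rule tendsto_L1_AE_subseq)
  show "integrable M (u n)" for n by (rule L1_le_L2_norm(1)[OF u])
  show "(\<lambda>n. \<integral>x. norm (u n x) \<partial>M) \<longlonglongrightarrow> 0"
    by (rule tendsto_sandwich[OF _ _ tendsto_const lim]) (auto simp: L1_le_L2_norm(2)[OF u])
qed

text \<open>Along a subsequence with summable increments the \<open>L\<^sup>1\<close> norms of the increments sum up, so it
  converges almost everywhere; Fatou's lemma identifies the limit.\<close>

lemma (in prob_space) L2_complete:
  fixes u :: "nat \<Rightarrow> 'a \<Rightarrow> complex"
  assumes u: "\<And>n. u n \<in> L2 M"
    and cauchy: "\<And>e. e > 0 \<Longrightarrow> \<exists>N. \<forall>m\<ge>N. \<forall>n\<ge>N. L2_norm M (\<lambda>x. u m x - u n x) < e"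
  obtains F where "F \<in> L2 M" "(\<lambda>n. L2_norm M (\<lambda>x. u n x - F x)) \<longlonglongrightarrow> 0"
proof -
  note [measurable] = L2_D(1)[OF u]
  have "\<forall>k. \<exists>N. \<forall>m\<ge>N. \<forall>n\<ge>N. L2_norm M (\<lambda>x. u m x - u n x) < (1/2)^k"
    using cauchy by simp
  then obtain N where N: "\<And>k m n. m \<ge> N k \<Longrightarrow> n \<ge> N k \<Longrightarrow> L2_norm M (\<lambda>x. u m x - u n x) < (1/2)^k"
    by metis
  \<comment> \<open>The sum dominates every threshold \<open>N i\<close> with \<open>i\<close> up to
    \<open>k\<close>, so both \<open>r k\<close> and \<open>r (Suc k)\<close> lie beyond
    \<open>N k\<close>; the summand \<open>k\<close> makes \<open>r j\<close> pass any fixed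
    threshold as \<open>j\<close> grows.\<close>
  define r where "r k = (\<Sum>i\<le>k. N i) + k" for k
  have rN: "r k \<ge> N k" and rSuc: "r (Suc k) \<ge> N k" and rk: "r k \<ge> k" for k
    using member_le_sum[of k "{..k}" N] by (auto simp: r_def)
  define d where "d k x = u (r (Suc k)) x - u (r k) x" for k x
  have dL2: "d k \<in> L2 M" for k unfolding d_def using u by (intro L2_diff)
  note [measurable] = L2_D(1)[OF dL2]
  have d1: "(\<integral>x. cmod (d k x) \<partial>M) \<le> (1/2)^k" for k
    using L1_le_L2_norm(2)[OF dL2[of k]] N[OF rSuc rN, of k] by (simp add: d_def[abs_def])
  have "(\<integral>\<^sup>+x. (\<Sum>k. ennreal (cmod (d k x))) \<partial>M) = (\<Sum>k. \<integral>\<^sup>+x. ennreal (cmod (d k x)) \<partial>M)"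
    by (rule nn_integral_suminf) measurable
  also have "\<dots> \<le> (\<Sum>k. ennreal ((1/2)^k))"
  proof (rule suminf_le)
    show "(\<integral>\<^sup>+x. ennreal (cmod (d k x)) \<partial>M) \<le> ennreal ((1/2)^k)" for k
      using d1[of k] L1_le_L2_norm(1)[OF dL2[of k]] by (subst nn_integral_eq_integral) (auto simp: ennreal_leI)
  qed auto
  also have "\<dots> < \<infinity>"
    by (subst suminf_ennreal2) (auto simp: summable_geometric)
  finally have "AE x in M. (\<Sum>k. ennreal (cmod (d k x))) \<noteq> \<infinity>"
    by (intro nn_integral_PInf_AE) auto
  then have conv: "AE x in M. convergent (\<lambda>k. u (r k) x)"
  proof eventually_elim
    case (elim x)
    have "summable (\<lambda>k. cmod (d k x))"
      using elim by (intro summable_suminf_not_top) auto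
    then have "summable (\<lambda>k. u (r (Suc k)) x - u (r k) x)"
      unfolding d_def by (rule summable_norm_cancel)
    then obtain L where "(\<lambda>n. u (r n) x - u (r 0) x) \<longlonglongrightarrow> L"
      unfolding summable_def sums_def sum_lessThan_telescope[of "\<lambda>n. u (r n) x"] by blast
    from tendsto_add[OF this tendsto_const[of "u (r 0) x"]] show ?case
      by (auto simp: convergent_def)
  qed
  define F where "F x = lim (\<lambda>k. u (r k) x)" for x
  have Fm[measurable]: "F \<in> borel_measurable M"
    unfolding F_def by (rule borel_measurable_lim_metric) measurable
  have Fat: "integrable M (\<lambda>x. (cmod (u m x - F x))\<^sup>2) \<and> L2_norm M (\<lambda>x. u m x - F x) \<le> (1/2)^k"
    if "m \<ge> N k" for m k
  proof -
    have "(\<integral>\<^sup>+x. ennreal ((cmod (u m x - F x))\<^sup>2) \<partial>M)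
       = (\<integral>\<^sup>+x. liminf (\<lambda>j. ennreal ((cmod (u m x - u (r j) x))\<^sup>2)) \<partial>M)"
    proof (rule nn_integral_cong_AE)
      show "AE x in M. ennreal ((cmod (u m x - F x))\<^sup>2) = liminf (\<lambda>j. ennreal ((cmod (u m x - u (r j) x))\<^sup>2))"
        using conv
      proof eventually_elim
        case (elim x)
        then have "(\<lambda>j. u (r j) x) \<longlonglongrightarrow> F x" by (simp add: F_def convergent_LIMSEQ_iff)
        then have "(\<lambda>j. ennreal ((cmod (u m x - u (r j) x))\<^sup>2)) \<longlonglongrightarrow> ennreal ((cmod (u m x - F x))\<^sup>2)"
          by (intro tendsto_intros)
        then show ?case by (metis lim_imp_Liminf sequentially_bot)
      qed
    qed
    also have "\<dots> \<le> liminf (\<lambda>j. \<integral>\<^sup>+x. ennreal ((cmod (u m x - u (r j) x))\<^sup>2) \<partial>M)"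
      by (rule nn_integral_liminf) measurable
    also have "\<dots> \<le> liminf (\<lambda>j. ennreal (((1/2)^k)\<^sup>2))"
    proof (rule Liminf_mono)
      show "\<forall>\<^sub>F j in sequentially. (\<integral>\<^sup>+x. ennreal ((cmod (u m x - u (r j) x))\<^sup>2) \<partial>M) \<le> ennreal (((1/2)^k)\<^sup>2)"
        using eventually_ge_at_top[of "N k"]
      proof eventually_elim
        case (elim j)
        have "L2_norm M (\<lambda>x. u m x - u (r j) x) < (1/2)^k"
          using N[of k m "r j"] that elim rk[of j] by simp
        then have "(L2_norm M (\<lambda>x. u m x - u (r j) x))\<^sup>2 \<le> ((1/2)^k)\<^sup>2"
          by (intro power_mono) (auto simp: L2_norm_nonneg)
        then show ?case
          using L2_D(2)[OF L2_diff[OF u u]] by (subst nn_integral_eq_integral) (auto simp: L2_norm_sq intro: ennreal_leI)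
      qed
    qed
    also have "\<dots> = ennreal (((1/2)^k)\<^sup>2)" by (simp add: Liminf_const)
    finally have le: "(\<integral>\<^sup>+x. ennreal ((cmod (u m x - F x))\<^sup>2) \<partial>M) \<le> ennreal (((1/2)^k)\<^sup>2)" .
    then have int: "integrable M (\<lambda>x. (cmod (u m x - F x))\<^sup>2)"
      by (intro integrableI_bounded) (auto intro: le_less_trans)
    have "ennreal ((L2_norm M (\<lambda>x. u m x - F x))\<^sup>2) \<le> ennreal (((1/2)^k)\<^sup>2)"
      using le int by (subst (asm) nn_integral_eq_integral) (auto simp: L2_norm_sq)
    then have "(L2_norm M (\<lambda>x. u m x - F x))\<^sup>2 \<le> ((1/2)^k)\<^sup>2"
      by (subst (asm) ennreal_le_iff) auto
    then have "L2_norm M (\<lambda>x. u m x - F x) \<le> (1/2)^k"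
      by (rule power2_le_imp_le) simp
    with int show ?thesis by simp
  qed
  show thesis
  proof
    have "(\<lambda>x. u (N 0) x - F x) \<in> L2 M" using Fat[of 0 "N 0"] by (intro L2_I) auto
    from L2_diff[OF u[of "N 0"] this] show "F \<in> L2 M" by simp
    show "(\<lambda>n. L2_norm M (\<lambda>x. u n x - F x)) \<longlonglongrightarrow> 0"
    proof (rule LIMSEQ_I)
      fix e :: real assume "e > 0"
      then obtain k where "(1/2::real)^k < e" using real_arch_pow_inv[of e "1/2"] by auto
      then show "\<exists>no. \<forall>n\<ge>no. norm (L2_norm M (\<lambda>x. u n x - F x) - 0) < e"
        using Fat[of k] by (intro exI[of _ "N k"]) (auto simp: L2_norm_nonneg dest!: spec intro: le_less_trans)
    qed
  qed
qed

lemma L2_norm_eq_0D: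
  assumes "F \<in> L2 M" "L2_norm M F = 0"
  shows "AE x in M. F x = 0"
proof -
  have "(\<integral>x. (cmod (F x))\<^sup>2 \<partial>M) = 0" using assms(2) L2_norm_sq[of M F] by simp
  then have "AE x in M. (cmod (F x))\<^sup>2 = 0"
    using integral_nonneg_eq_0_iff_AE[OF L2_D(2)[OF assms(1)]] by simp
  then show ?thesis by simp
qed


subsection \<open>The torus\<close>

abbreviation "square2pi \<equiv> {0..<2 * pi} \<times> {0..<2 * pi::real}"

lemma space_torus_measure [simp]: "space torus_measure = torus"
  and sets_torus_measure [measurable_cong, simp]: "sets torus_measure = sets (restrict_space borel torus)"
  by (simp_all add: torus_measure_def space_restrict_space)

lemma borel_measurable_torus_continuous:
  fixes F :: "complex \<times> complex \<Rightarrow> 'b::topological_space"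
  assumes "continuous_on torus F"
  shows "F \<in> borel_measurable torus_measure"
  using borel_measurable_continuous_on_restrict[OF assms]
  by (simp cong: measurable_cong_sets)

lemma cis_pair_measurable [measurable]:
  "(\<lambda>(s, t). (cis s, cis t)) \<in> lborel \<rightarrow>\<^sub>M restrict_space borel torus"
proof (rule measurable_restrict_space2)
  have "continuous_on UNIV (\<lambda>x. (cis (fst x), cis (snd x)))"
    by (intro continuous_intros)
  then show "(\<lambda>(s, t). (cis s, cis t)) \<in> borel_measurable lborel"
    by (simp add: case_prod_beta' borel_measurable_continuous_onI)
qed (auto simp: torus_def)

lemma emeasure_square2pi: "emeasure lborel square2pi = ennreal (4 * pi\<^sup>2)"
proof -
  have "emeasure (lborel \<Otimes>\<^sub>M lborel) square2pi = ennreal (2 * pi) * ennreal (2 * pi)"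
    by (subst lborel.emeasure_pair_measure_Times) auto
  also have "\<dots> = ennreal (4 * pi\<^sup>2)"
    by (simp add: ennreal_mult[symmetric] power2_eq_square)
  finally show ?thesis by (simp add: lborel_prod)
qed

lemma square2pi_sets [measurable, simp]: "square2pi \<in> sets borel"
  by (rule borel_Times) auto

interpretation torus: prob_space torus_measure
proof -
  have "prob_space (uniform_measure lborel square2pi)"
    by (rule prob_space_uniform_measure) (auto simp: emeasure_square2pi)
  then show "prob_space torus_measure"
    unfolding torus_measure_def by (rule prob_space.prob_space_distr) simp
qed

text \<open>The measure is a push-forward from the half-open square of area 4 pi^2, while the
  one-variable Cauchy and orthogonality integrals run over closed intervals. Passing to the closed
  square makes the iterated integral of a continuous function available.\<close>

lemma integral_torus_measure:
  fixes F :: "complex \<times> complex \<Rightarrow> complex"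
  assumes F: "continuous_on torus F"
  shows "(\<integral>\<zeta>. F \<zeta> \<partial>torus_measure) =
    integral {0..2*pi} (\<lambda>s. integral {0..2*pi} (\<lambda>t. F (cis s, cis t))) / (4 * pi\<^sup>2)"
proof -
  define H where "H = (\<lambda>(s, t). F (cis s, cis t))"
  have contH: "continuous_on A H" for A
    unfolding H_def case_prod_beta'
    by (rule continuous_on_compose2[OF F]) (auto intro!: continuous_intros simp: torus_def)
  have H[measurable]: "H \<in> borel_measurable borel"
    by (rule borel_measurable_continuous_onI[OF contH])
  have Fm: "F \<in> borel_measurable (restrict_space borel torus)"
    by (rule borel_measurable_continuous_on_restrict[OF F])
  have "(\<integral>\<zeta>. F \<zeta> \<partial>torus_measure) = (\<integral>x. H x \<partial>uniform_measure lborel square2pi)"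
  proof -
    have "(\<lambda>(s, t). (cis s, cis t)) \<in> uniform_measure lborel square2pi \<rightarrow>\<^sub>M restrict_space borel torus"
      using cis_pair_measurable by (simp cong: measurable_cong_sets)
    from integral_distr[OF this Fm] show ?thesis
      by (simp add: torus_measure_def H_def case_prod_beta')
  qed
  also have "uniform_measure lborel square2pi = density lborel (\<lambda>x. ennreal (indicator square2pi x / (4 * pi\<^sup>2)))"
    unfolding uniform_measure_def emeasure_square2pi
    by (intro arg_cong2[where f=density] refl ext)
       (auto simp: indicator_def divide_ennreal[symmetric])
  also have "(\<integral>x. H x \<partial>\<dots>) = (\<integral>x. (indicator square2pi x / (4 * pi\<^sup>2)) *\<^sub>R H x \<partial>lborel)"
    by (rule integral_density) auto
  also have "\<dots> = (\<integral>x. (1 / (4 * pi\<^sup>2)) *\<^sub>R (indicator square2pi x *\<^sub>R H x) \<partial>lborel)"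
    by simp
  also have "\<dots> = (1 / (4 * pi\<^sup>2)) *\<^sub>R (\<integral>x. indicator square2pi x *\<^sub>R H x \<partial>lborel)"
    by (rule integral_scaleR_right)
  also have "(\<integral>x. indicator square2pi x *\<^sub>R H x \<partial>lborel) = integral (cbox (0,0) (2*pi,2*pi)) H"
  proof -
    have sub: "square2pi \<subseteq> cbox (0,0) (2*pi,2*pi)"
      by (auto simp: cbox_Pair_eq)
    have "integrable lborel (\<lambda>x. indicator square2pi x *\<^sub>R (indicator (cbox (0,0) (2*pi,2*pi)) x *\<^sub>R H x))"
      by (intro integrable_mult_indicator borel_integrable_compact contH) auto
    also have "(\<lambda>x. indicator square2pi x *\<^sub>R (indicator (cbox (0,0) (2*pi,2*pi)) x *\<^sub>R H x))
       = (\<lambda>x. indicator square2pi x *\<^sub>R H x)"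
      using sub by (auto simp: indicator_def fun_eq_iff)
    finally have int: "integrable lborel (\<lambda>x. indicator square2pi x *\<^sub>R H x)" .
    have "(\<integral>x. indicator square2pi x *\<^sub>R H x \<partial>lborel) = integral UNIV (\<lambda>x. if x \<in> square2pi then H x else 0)"
      using integral_lborel[OF int] by (simp add: indicator_scaleR_eq_if)
    also have "\<dots> = integral square2pi H" by (rule integral_restrict_UNIV)
    also have "\<dots> = integral (cbox (0,0) (2*pi,2*pi)) H"
    proof (rule integral_spike_set)
      show "negligible {x \<in> square2pi - cbox (0, 0) (2 * pi, 2 * pi). H x \<noteq> 0}"
        using sub by (auto intro: negligible_subset[OF negligible_empty])
      \<comment> \<open>The closed square exceeds the half-open one only on the two lines where a
        coordinate equals 2 pi.\<close>
      have "negligible ({x::real\<times>real. x \<bullet> (1,0) = 2*pi} \<union> {x. x \<bullet> (0,1) = 2*pi})"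
        by (intro negligible_Un negligible_standard_hyperplane) (auto simp: Basis_prod_def)
      then show "negligible {x \<in> cbox (0, 0) (2 * pi, 2 * pi) - square2pi. H x \<noteq> 0}"
        by (rule negligible_subset) (auto simp: cbox_Pair_eq)
    qed
    finally show ?thesis .
  qed
  also have "\<dots> = integral (cbox 0 (2*pi)) (\<lambda>s. integral (cbox 0 (2*pi)) (\<lambda>t. H (s, t)))"
    by (rule integral_prod_continuous[OF contH])
  finally show ?thesis
    by (simp add: H_def scaleR_conv_of_real)
qed

section \<open>Monomials and their orthonormality on the torus\<close>

definition monom2 :: "nat \<times> nat \<Rightarrow> complex \<times> complex \<Rightarrow> complex" where
  "monom2 n z = fst z ^ fst n * snd z ^ snd n"

definition deg :: "nat \<times> nat \<Rightarrow> nat" where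
  "deg n = fst n + snd n"

lemma monom2_scaleR: "monom2 n (r *\<^sub>R z) = of_real r ^ deg n * monom2 n z"
  by (simp add: monom2_def deg_def scaleR_conv_of_real power_mult_distrib power_add)

lemma continuous_on_monom2 [continuous_intros]: "continuous_on A (monom2 n)"
  unfolding monom2_def by (intro continuous_intros)

lemma norm_monom2: "cmod (monom2 n z) = cmod (fst z) ^ fst n * cmod (snd z) ^ snd n"
  by (simp add: monom2_def norm_mult norm_power)

lemma norm_monom2_torus: "\<zeta> \<in> torus \<Longrightarrow> cmod (monom2 n \<zeta>) = 1"
  by (auto simp: norm_monom2 torus_def)

lemma integral_cis_mult:
  fixes k l :: nat
  shows "((\<lambda>t. cis t ^ k * cnj (cis t ^ l)) has_integral (if k = l then 2 * pi else 0)) {0..2*pi}"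
proof (cases "k = l")
  case True
  have "cis t ^ l * cnj (cis t ^ l) = 1" for t
    by (subst complex_norm_square[symmetric]) (simp add: norm_power)
  with True has_integral_const_real[of "1::complex" 0 "2*pi"] show ?thesis
    by (simp add: scaleR_conv_of_real)
next
  case False
  \<comment> \<open>The difference is formed in the reals because \<open>k\<close> may be smaller
    than \<open>l\<close>; it is still an integer, which gives the period 2 pi below.\<close>
  define j where "j = real k - real l"
  have j: "j \<noteq> 0" using False by (simp add: j_def)
  have eq: "cis t ^ k * cnj (cis t ^ l) = cis (j * t)" for t
  proof -
    have "cis t ^ k * cnj (cis t ^ l) = cis (real k * t) * cnj (cis (real l * t))"
      by (simp only: Complex.DeMoivre)
    then show ?thesis by (simp add: j_def cis_cnj cis_mult algebra_simps)
  qed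
  have "((\<lambda>t. cis (j * t)) has_integral (cis (j * (2*pi)) / (\<i> * j) - cis (j * 0) / (\<i> * j))) {0..2*pi}"
  proof (rule fundamental_theorem_of_calculus)
    fix t :: real
    have "((\<lambda>z. exp (\<i> * j * z) / (\<i> * j)) has_field_derivative exp (\<i> * j * of_real t)) (at (of_real t))"
      using j by (auto intro!: derivative_eq_intros)
    from has_vector_derivative_real_field[OF this]
    show "((\<lambda>t. cis (j * t) / (\<i> * j)) has_vector_derivative cis (j * t)) (at t within {0..2*pi})"
      by (simp add: cis_conv_exp mult.assoc)
  qed simp
  moreover have "cis (j * (2*pi)) = 1"
    using cis_multiple_2pi[of j] by (simp add: j_def mult.commute)
  ultimately show ?thesis using False unfolding eq by simp
qed

lemma integral_monom2_orthonormal: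
  "(\<integral>\<zeta>. monom2 m \<zeta> * cnj (monom2 n \<zeta>) \<partial>torus_measure) = (if m = n then 1 else 0)"
proof -
  have "continuous_on torus (\<lambda>\<zeta>. monom2 m \<zeta> * cnj (monom2 n \<zeta>))" by (intro continuous_intros)
  note integral_torus_measure[OF this]
  also have "integral {0..2*pi} (\<lambda>s. integral {0..2*pi} (\<lambda>t. monom2 m (cis s, cis t) * cnj (monom2 n (cis s, cis t))))
    = integral {0..2*pi} (\<lambda>s. (cis s ^ fst m * cnj (cis s ^ fst n)) *
         integral {0..2*pi} (\<lambda>t. cis t ^ snd m * cnj (cis t ^ snd n)))"
    by (simp add: monom2_def integral_mult_right[symmetric] ac_simps del: integral_mult_right cis_cnj)
  also have "\<dots> = (if fst m = fst n then 2 * pi else 0) * (if snd m = snd n then 2 * pi else 0)"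
    using integral_unique[OF integral_cis_mult[of "fst m" "fst n"]] integral_unique[OF integral_cis_mult[of "snd m" "snd n"]]
    by (simp add: integral_mult_left)
  finally show ?thesis
    by (auto simp: prod_eq_iff power2_eq_square)
qed


subsection \<open>Power series and the Cauchy formula on the bidisc\<close>

text \<open>The convergence half of \<open>hardy_coeffs\<close>. It is kept apart from square
  summability because dilations, slices and differences of series, and the uniqueness of
  coefficients, concern this half alone.\<close>

definition bidisc_series :: "(complex \<times> complex \<Rightarrow> complex) \<Rightarrow> (nat \<times> nat \<Rightarrow> complex) \<Rightarrow> bool" where
  "bidisc_series f a \<longleftrightarrow> (\<forall>z\<in>bidisc. ((\<lambda>n. a n * monom2 n z) has_sum f z) UNIV)"

lemma hardy_coeffs_iff:
  "hardy_coeffs f a \<longleftrightarrow> (\<lambda>n. (cmod (a n))\<^sup>2) summable_on UNIV \<and> bidisc_series f a"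
  by (simp add: hardy_coeffs_def bidisc_series_def monom2_def case_prod_beta' mult.assoc)

text \<open>Holomorphy in each variable together with joint continuity: what an iterated
  one-variable Cauchy formula consumes, and what products and powers inherit from one-variable
  rules. It turns out to be equivalent to having a power series on the bidisc.\<close>

definition hol2 :: "(complex \<times> complex \<Rightarrow> complex) \<Rightarrow> bool" where
  "hol2 f \<longleftrightarrow> continuous_on bidisc f \<and>
    (\<forall>w\<in>ball 0 1. (\<lambda>u. f (u, w)) holomorphic_on ball 0 1 \<and> (\<lambda>u. f (w, u)) holomorphic_on ball 0 1)"

lemma open_bidisc: "open bidisc"
  by (simp add: bidisc_def open_Times)

lemma bidisc_iff: "z \<in> bidisc \<longleftrightarrow> cmod (fst z) < 1 \<and> cmod (snd z) < 1"
  by (cases z) (simp add: bidisc_def)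

lemma torus_iff: "z \<in> torus \<longleftrightarrow> cmod (fst z) = 1 \<and> cmod (snd z) = 1"
  by (cases z) (simp add: torus_def)

lemma scaleR_torus_in_bidisc: "\<zeta> \<in> torus \<Longrightarrow> 0 \<le> r \<Longrightarrow> r < 1 \<Longrightarrow> r *\<^sub>R \<zeta> \<in> bidisc"
  by (simp add: bidisc_iff torus_iff)

text \<open>At the diagonal point (r, r) each monomial becomes r to the total degree, and
  unconditional summability of complex numbers is absolute. The result is the majorant for all
  M-tests on the polydisc of radius r.\<close>

lemma bidisc_series_abs_summable:
  assumes "bidisc_series f a" "0 \<le> r" "r < 1"
  shows "(\<lambda>n. cmod (a n) * r ^ deg n) summable_on UNIV"
proof -
  have "(of_real r, of_real r) \<in> bidisc" using assms by (simp add: bidisc_iff)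
  then have "(\<lambda>n. a n * monom2 n (of_real r, of_real r)) summable_on UNIV"
    using assms(1) by (auto simp: bidisc_series_def summable_on_def)
  then show ?thesis using \<open>0 \<le> r\<close>
    by (simp add: summable_on_iff_abs_summable_on_complex norm_mult norm_monom2 deg_def power_add)
qed

lemma norm_monom2_le:
  assumes "cmod (fst z) \<le> r" "cmod (snd z) \<le> r"
  shows "cmod (monom2 n z) \<le> r ^ deg n"
proof -
  have "0 \<le> r" using assms norm_ge_zero order_trans by blast
  then show ?thesis
    using assms by (auto simp: norm_monom2 deg_def power_add intro!: mult_mono power_mono)
qed

lemma bidisc_series_uniform_limit:
  assumes "bidisc_series f a" "0 \<le> r" "r < 1"
  shows "uniform_limit (cball 0 r \<times> cball 0 r) (\<lambda>X z. \<Sum>n\<in>X. a n * monom2 n z) f (finite_subsets_at_top UNIV)"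
proof (rule Weierstrass_m_test_general'[OF _ _ bidisc_series_abs_summable[OF assms]])
  show "norm (a n * monom2 n z) \<le> cmod (a n) * r ^ deg n" if "z \<in> cball 0 r \<times> cball 0 r" for n z
    using that by (auto simp: norm_mult intro!: mult_left_mono norm_monom2_le)
  show "((\<lambda>n. a n * monom2 n z) has_sum f z) UNIV" if "z \<in> cball 0 r \<times> cball 0 r" for z
    using that assms by (auto simp: bidisc_series_def bidisc_iff)
qed

lemma hol2_of_series:
  assumes "bidisc_series f a"
  shows "hol2 f"
proof -
  have c: "continuous_on (cball 0 r \<times> cball 0 r) f" if "0 \<le> r" "r < 1" for r
    by (rule uniform_limit_theorem[OF _ bidisc_series_uniform_limit[OF assms that]])
       (auto intro!: continuous_intros always_eventually)
  have "isCont f z" if "z \<in> bidisc" for z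
  proof -
    have "max (cmod (fst z)) (cmod (snd z)) < 1" using that by (simp add: bidisc_iff)
    then obtain r where r: "max (cmod (fst z)) (cmod (snd z)) < r" "r < 1"
      using dense by blast
    then have "0 \<le> r" using norm_ge_zero[of "fst z"] by linarith
    then have "continuous_on (ball 0 r \<times> ball 0 r) f"
      by (rule continuous_on_subset[OF c]) (use r in auto)
    moreover have "z \<in> ball 0 r \<times> ball 0 r" using r by (cases z) auto
    ultimately show ?thesis
      using continuous_on_eq_continuous_at[OF open_Times[OF open_ball open_ball]] by blast
  qed
  then have cont: "continuous_on bidisc f"
    by (simp add: continuous_at_imp_continuous_on)
  \<comment> \<open>\<open>p\<close> stands for either of the two coordinate slices, so that one
    argument serves both variables.\<close>
  have sl: "(\<lambda>u. f (p u)) holomorphic_on ball 0 1"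
    if p: "(\<forall>u. p u = (u, w)) \<or> (\<forall>u. p u = (w, u))" and w: "w \<in> ball 0 1" for p w
  proof -
    have "(\<lambda>u. f (p u)) holomorphic_on ball 0 r" if r: "cmod w \<le> r" "r < 1" for r
    proof (rule holomorphic_uniform_limit)
      have r0: "0 \<le> r" using r norm_ge_zero order_trans by blast
      show "uniform_limit (cball 0 r) (\<lambda>X u. \<Sum>n\<in>X. a n * monom2 n (p u)) (\<lambda>u. f (p u)) (finite_subsets_at_top UNIV)"
        using bidisc_series_uniform_limit[OF assms r0 r(2)]
        by (rule uniform_limit_compose') (use p r in auto)
      have mp: "(\<lambda>u. monom2 n (p u)) = (\<lambda>u. u ^ fst n * w ^ snd n) \<or> (\<lambda>u. monom2 n (p u)) = (\<lambda>u. w ^ fst n * u ^ snd n)" for n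
        using p by (auto simp: monom2_def)
      have "(\<lambda>u. monom2 n (p u)) holomorphic_on UNIV" for n
        using mp[of n] by (auto intro!: holomorphic_intros)
      then have hX: "(\<lambda>u. \<Sum>n\<in>X. a n * monom2 n (p u)) holomorphic_on UNIV" for X
        by (intro holomorphic_on_sum holomorphic_on_mult holomorphic_on_const)
      have "continuous_on S (\<lambda>u. \<Sum>n\<in>X. a n * monom2 n (p u))" for X S
        by (rule continuous_on_subset[OF holomorphic_on_imp_continuous_on[OF hX] subset_UNIV])
      moreover have "(\<lambda>u. \<Sum>n\<in>X. a n * monom2 n (p u)) holomorphic_on S" for X S
        by (rule holomorphic_on_subset[OF hX subset_UNIV])
      ultimately show "\<forall>\<^sub>F X in finite_subsets_at_top UNIV. continuous_on (cball 0 r) (\<lambda>u. \<Sum>n\<in>X. a n * monom2 n (p u))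
            \<and> (\<lambda>u. \<Sum>n\<in>X. a n * monom2 n (p u)) holomorphic_on ball 0 r"
        by (simp add: always_eventually)
    qed auto
    then have "(\<lambda>u. f (p u)) field_differentiable (at u)" if "u \<in> ball 0 1" for u
    proof -
      have "max (cmod u) (cmod w) < 1" using that w by simp
      then obtain r where r: "max (cmod u) (cmod w) < r" "r < 1"
        using dense by blast
      then show ?thesis
        using \<open>\<And>r. cmod w \<le> r \<Longrightarrow> r < 1 \<Longrightarrow> (\<lambda>u. f (p u)) holomorphic_on ball 0 r\<close>[of r]
        by (auto simp: holomorphic_on_open open_ball field_differentiable_def)
    qed
    then show ?thesis by (simp add: holomorphic_on_def field_differentiable_at_within)
  qed
  have "(\<lambda>u. f (u, w)) holomorphic_on ball 0 1" "(\<lambda>u. f (w, u)) holomorphic_on ball 0 1"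
    if "w \<in> ball 0 1" for w
    using sl[of "\<lambda>u. (u, w)" w] sl[of "\<lambda>u. (w, u)" w] that by simp_all
  with cont show ?thesis unfolding hol2_def by simp
qed

lemma hol2_continuous_dilation:
  assumes "hol2 f" "0 \<le> r" "r < 1"
  shows "continuous_on torus (\<lambda>\<zeta>. f (r *\<^sub>R \<zeta>))"
proof (rule continuous_on_compose2[of bidisc f])
  show "(\<lambda>\<zeta>. r *\<^sub>R \<zeta>) ` torus \<subseteq> bidisc"
    using scaleR_torus_in_bidisc assms by blast
qed (use assms in \<open>auto simp: hol2_def intro!: continuous_intros\<close>)

section \<open>Integration of series over the torus\<close>

lemma torus_integrable_continuous:
  fixes F :: "complex \<times> complex \<Rightarrow> 'b::{banach, second_countable_topology}"
  assumes "continuous_on torus F"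
  shows "integrable torus_measure F"
proof -
  have "compact torus" by (simp add: torus_def compact_Times)
  then have "bounded (F ` torus)" using assms compact_continuous_image compact_imp_bounded by blast
  then obtain B where B: "\<And>x. x \<in> torus \<Longrightarrow> norm (F x) \<le> B" by (auto simp: bounded_iff)
  show ?thesis
    by (rule torus.integrable_const_bound[of _ B]) (auto intro!: AE_I2 B borel_measurable_torus_continuous assms)
qed

lemma torus_integrable_mult_continuous:
  fixes E :: "complex \<times> complex \<Rightarrow> complex"
  assumes "integrable torus_measure E" "continuous_on torus F"
  shows "integrable torus_measure (\<lambda>\<zeta>. E \<zeta> * F \<zeta>)"
proof -
  have "compact torus" by (simp add: torus_def compact_Times)
  then have "bounded (F ` torus)" using assms compact_continuous_image compact_imp_bounded by blast
  then obtain B where B: "\<And>x. x \<in> torus \<Longrightarrow> norm (F x) \<le> B" by (auto simp: bounded_iff)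
  have [measurable]: "F \<in> borel_measurable torus_measure"
    by (rule borel_measurable_torus_continuous[OF assms(2)])
  have [measurable]: "E \<in> borel_measurable torus_measure" using assms(1) by auto
  show ?thesis
  proof (rule Bochner_Integration.integrable_bound)
    show "integrable torus_measure (\<lambda>\<zeta>. of_real B * E \<zeta>)" using assms(1) by simp
    show "AE \<zeta> in torus_measure. norm (E \<zeta> * F \<zeta>) \<le> norm (of_real B * E \<zeta>)"
    proof (rule AE_I2)
      fix \<zeta> assume "\<zeta> \<in> space torus_measure"
      then have "cmod (F \<zeta>) \<le> \<bar>B\<bar>" using B[of \<zeta>] by simp
      from mult_left_mono[OF this norm_ge_zero[of "E \<zeta>"]]
      show "norm (E \<zeta> * F \<zeta>) \<le> norm (of_real B * E \<zeta>)"
        by (simp add: norm_mult mult.commute)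
    qed
  qed measurable
qed

text \<open>The partial sums form a net over finite index sets, so sum and integral are interchanged
  through uniform convergence: the error is at most the uniform distance times the L1 norm of
  \<open>E\<close>.\<close>

lemma has_sum_torus_integral:
  fixes E :: "complex \<times> complex \<Rightarrow> complex"
  assumes E: "integrable torus_measure E"
    and u: "\<And>n. continuous_on torus (u n)"
    and M: "\<And>n \<zeta>. \<zeta> \<in> torus \<Longrightarrow> cmod (u n \<zeta>) \<le> M n" "M summable_on A"
    and U: "\<And>\<zeta>. \<zeta> \<in> torus \<Longrightarrow> ((\<lambda>n. u n \<zeta>) has_sum U \<zeta>) A"
  shows "((\<lambda>n. \<integral>\<zeta>. E \<zeta> * u n \<zeta> \<partial>torus_measure) has_sum (\<integral>\<zeta>. E \<zeta> * U \<zeta> \<partial>torus_measure)) A"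
proof -
  have ul: "uniform_limit torus (\<lambda>X \<zeta>. \<Sum>n\<in>X. u n \<zeta>) U (finite_subsets_at_top A)"
    by (rule Weierstrass_m_test_general'[OF _ U M(2)]) (use M(1) in auto)
  have Uc: "continuous_on torus U"
    by (rule uniform_limit_theorem[OF _ ul]) (auto intro!: continuous_intros u always_eventually)
  let ?K = "\<integral>\<zeta>. cmod (E \<zeta>) \<partial>torus_measure"
  have K: "?K \<ge> 0" by simp
  show ?thesis
    unfolding has_sum_def
  proof (rule tendstoI)
    fix e :: real assume "e > 0"
    \<comment> \<open>The added 1 keeps the quotient meaningful when \<open>E\<close> vanishes
      almost everywhere.\<close>
    then have e': "e / (?K + 1) > 0" using K by (intro divide_pos_pos add_nonneg_pos) auto
    show "\<forall>\<^sub>F X in finite_subsets_at_top A.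
        dist (\<Sum>n\<in>X. \<integral>\<zeta>. E \<zeta> * u n \<zeta> \<partial>torus_measure) (\<integral>\<zeta>. E \<zeta> * U \<zeta> \<partial>torus_measure) < e"
      using uniform_limitD[OF ul e']
    proof eventually_elim
      case (elim X)
      have "(\<Sum>n\<in>X. \<integral>\<zeta>. E \<zeta> * u n \<zeta> \<partial>torus_measure) = (\<integral>\<zeta>. E \<zeta> * (\<Sum>n\<in>X. u n \<zeta>) \<partial>torus_measure)"
        unfolding sum_distrib_left
        by (rule Bochner_Integration.integral_sum[symmetric]) (intro torus_integrable_mult_continuous E u)
      then have "dist (\<Sum>n\<in>X. \<integral>\<zeta>. E \<zeta> * u n \<zeta> \<partial>torus_measure) (\<integral>\<zeta>. E \<zeta> * U \<zeta> \<partial>torus_measure)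
          = cmod (\<integral>\<zeta>. E \<zeta> * ((\<Sum>n\<in>X. u n \<zeta>) - U \<zeta>) \<partial>torus_measure)"
        unfolding dist_norm right_diff_distrib
        by (subst Bochner_Integration.integral_diff)
           (auto intro!: torus_integrable_mult_continuous E Uc continuous_intros u)
      also have "\<dots> \<le> (\<integral>\<zeta>. cmod (E \<zeta> * ((\<Sum>n\<in>X. u n \<zeta>) - U \<zeta>)) \<partial>torus_measure)"
        by (rule integral_norm_bound)
      also have "\<dots> \<le> (\<integral>\<zeta>. e / (?K + 1) * cmod (E \<zeta>) \<partial>torus_measure)"
      proof (rule integral_mono)
        show "integrable torus_measure (\<lambda>\<zeta>. cmod (E \<zeta> * ((\<Sum>n\<in>X. u n \<zeta>) - U \<zeta>)))"
          by (intro integrable_norm torus_integrable_mult_continuous E Uc continuous_intros u)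
        show "integrable torus_measure (\<lambda>\<zeta>. e / (?K + 1) * cmod (E \<zeta>))" using E by simp
        fix \<zeta> assume "\<zeta> \<in> space torus_measure"
        then have "cmod ((\<Sum>n\<in>X. u n \<zeta>) - U \<zeta>) \<le> e / (?K + 1)"
          using elim by (auto simp: dist_norm less_imp_le)
        then show "cmod (E \<zeta> * ((\<Sum>n\<in>X. u n \<zeta>) - U \<zeta>)) \<le> e / (?K + 1) * cmod (E \<zeta>)"
          by (simp only: norm_mult mult.commute[of "cmod (E \<zeta>)"] mult_right_mono norm_ge_zero)
      qed
      also have "\<dots> = e / (?K + 1) * ?K" by simp
      also have "\<dots> < e"
      proof -
        have "e / (k + 1) * k < e" if "k \<ge> 0" for k :: real
          using that \<open>e > 0\<close> by (simp add: field_simps)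
        then show ?thesis using K by blast
      qed
      finally show ?case .
    qed
  qed
qed

lemma series_torus_integral:
  fixes E :: "complex \<times> complex \<Rightarrow> complex"
  assumes "integrable torus_measure E" "bidisc_series f a" "0 \<le> r" "r < 1"
  shows "((\<lambda>n. a n * of_real r ^ deg n * (\<integral>\<zeta>. E \<zeta> * monom2 n \<zeta> \<partial>torus_measure))
     has_sum (\<integral>\<zeta>. E \<zeta> * f (r *\<^sub>R \<zeta>) \<partial>torus_measure)) UNIV"
proof -
  have "((\<lambda>n. \<integral>\<zeta>. E \<zeta> * (a n * monom2 n (r *\<^sub>R \<zeta>)) \<partial>torus_measure)
     has_sum (\<integral>\<zeta>. E \<zeta> * f (r *\<^sub>R \<zeta>) \<partial>torus_measure)) UNIV"
  proof (rule has_sum_torus_integral[OF assms(1) _ _ bidisc_series_abs_summable[OF assms(2-4)]])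
    show "continuous_on torus (\<lambda>\<zeta>. a n * monom2 n (r *\<^sub>R \<zeta>))" for n
      unfolding monom2_scaleR by (intro continuous_intros)
    show "cmod (a n * monom2 n (r *\<^sub>R \<zeta>)) \<le> cmod (a n) * r ^ deg n" if "\<zeta> \<in> torus" for n \<zeta>
      using that assms(3) by (simp add: monom2_scaleR norm_mult norm_power norm_monom2_torus)
    show "((\<lambda>n. a n * monom2 n (r *\<^sub>R \<zeta>)) has_sum f (r *\<^sub>R \<zeta>)) UNIV" if "\<zeta> \<in> torus" for \<zeta>
      using assms scaleR_torus_in_bidisc[OF that assms(3,4)] by (simp add: bidisc_series_def)
  qed
  moreover have "(\<integral>\<zeta>. E \<zeta> * (a n * monom2 n (r *\<^sub>R \<zeta>)) \<partial>torus_measure)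
      = a n * of_real r ^ deg n * (\<integral>\<zeta>. E \<zeta> * monom2 n \<zeta> \<partial>torus_measure)" for n
    by (simp add: monom2_scaleR ac_simps flip: integral_mult_right_zero)
  ultimately show ?thesis by simp
qed

text \<open>Parametrisation turns d\<zeta>/(\<zeta> - z) into i \<zeta> dt/(\<zeta> - z), and
  \<zeta> conj(\<zeta>) = 1 rewrites \<zeta>/(\<zeta> - z) as 1/(1 - conj(\<zeta>) z), one factor of
  the conjugate Szego kernel.\<close>

lemma Cauchy_circle:
  fixes g :: "complex \<Rightarrow> complex"
  assumes g: "g holomorphic_on ball 0 R" and "1 < R" and z: "cmod z < 1"
  shows "integral {0..2*pi} (\<lambda>t. g (cis t) / (1 - cnj (cis t) * z)) = 2 * pi * g z"
proof -
  have "g holomorphic_on cball 0 1" by (rule holomorphic_on_subset[OF g]) (use \<open>1 < R\<close> in auto)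
  from Cauchy_integral_circlepath_simple[OF this, of z] z
  have "((\<lambda>u. g u / (u - z)) has_contour_integral 2 * of_real pi * \<i> * g z) (part_circlepath 0 1 0 (2*pi))"
    by (simp add: circlepath_def)
  then have "((\<lambda>t. g (cis t) / (cis t - z) * \<i> * cis t) has_integral 2 * of_real pi * \<i> * g z) {0..2*pi}"
    by (subst (asm) has_contour_integral_part_circlepath_iff) auto
  from has_integral_mult_right[OF this, of "-\<i>"]
  have "((\<lambda>t. - \<i> * (g (cis t) / (cis t - z) * \<i> * cis t)) has_integral 2 * pi * g z) {0..2*pi}"
    by (simp add: algebra_simps)
  moreover have "- \<i> * (g (cis t) / (cis t - z) * \<i> * cis t) = g (cis t) / (1 - cnj (cis t) * z)" for t
  proof -
    have "cis t \<noteq> z" using z by auto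
    then have "1 - cnj (cis t) * z \<noteq> 0"
      by (metis cis_cnj cis_mult cis_zero add.right_inverse eq_iff_diff_eq_0 mult.assoc mult.left_neutral mult.right_neutral)
    moreover have "cis t * cnj (cis t) = 1"
      by (simp add: cis_cnj cis_mult)
    ultimately show ?thesis using \<open>cis t \<noteq> z\<close>
      by (simp add: field_simps)
  qed
  ultimately have "((\<lambda>t. g (cis t) / (1 - cnj (cis t) * z)) has_integral 2 * pi * g z) {0..2*pi}"
    by simp
  then show ?thesis by (rule integral_unique)
qed

lemma szego_kernel_denominators_nonzero:
  assumes "w \<in> bidisc" "cmod (fst z) \<le> 1" "cmod (snd z) \<le> 1"
  shows "1 - fst z * cnj (fst w) \<noteq> 0" "1 - snd z * cnj (snd w) \<noteq> 0"
proof -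
  have "cmod (x * cnj y) < 1" if "cmod x \<le> 1" "cmod y < 1" for x y
    using mult_right_mono[OF that(1), of "cmod y"] that by (simp add: norm_mult)
  then show "1 - fst z * cnj (fst w) \<noteq> 0" "1 - snd z * cnj (snd w) \<noteq> 0"
    using assms by (metis bidisc_iff eq_iff_diff_eq_0 norm_one order_less_irrefl)+
qed

lemma continuous_on_szego_kernel: "w \<in> bidisc \<Longrightarrow> continuous_on torus (szego_kernel w)"
  unfolding szego_kernel_def
proof (intro continuous_intros ballI)
  fix z assume "w \<in> bidisc" "z \<in> torus"
  then show "(1 - fst z * cnj (fst w)) * (1 - snd z * cnj (snd w)) \<noteq> 0"
    using szego_kernel_denominators_nonzero[of w z] by (simp add: torus_iff)
qed

text \<open>After dilation by r < 1 each slice is holomorphic on a disc larger than the unit disc,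
  so the circle formula applies in the second variable and then in the first, whatever
  \<open>f\<close> does near the torus.\<close>

lemma Cauchy_torus:
  assumes f: "hol2 f" and r: "0 \<le> r" "r < 1" and z: "z \<in> bidisc"
  shows "(\<integral>\<zeta>. f (r *\<^sub>R \<zeta>) * cnj (szego_kernel z \<zeta>) \<partial>torus_measure) = f (r *\<^sub>R z)"
proof -
  \<comment> \<open>Any R > 1 with r R < 1 would serve; this choice also covers r = 0.\<close>
  define R where "R = 2 / (1 + r)"
  have R: "1 < R" and Rr: "r * R < 1" using r by (auto simp: R_def field_simps)
  have hol: "(\<lambda>u. f (r *\<^sub>R u, w)) holomorphic_on ball 0 R" "(\<lambda>u. f (w, r *\<^sub>R u)) holomorphic_on ball 0 R"
    if "w \<in> ball 0 1" for w
  proof -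
    have m: "r *\<^sub>R u \<in> ball 0 1" if "u \<in> ball 0 R" for u :: complex
      using mult_left_mono[of "cmod u" R r] that r Rr by simp
    have h: "(\<lambda>u. of_real r * u) holomorphic_on ball 0 R" by (intro holomorphic_intros)
    have "(\<lambda>u. f (u, w)) \<circ> (\<lambda>u. of_real r * u) holomorphic_on ball 0 R"
      using f that m by (intro holomorphic_on_compose_gen[OF h]) (auto simp: hol2_def scaleR_conv_of_real)
    then show "(\<lambda>u. f (r *\<^sub>R u, w)) holomorphic_on ball 0 R" by (simp add: o_def scaleR_conv_of_real)
    have "(\<lambda>u. f (w, u)) \<circ> (\<lambda>u. of_real r * u) holomorphic_on ball 0 R"
      using f that m by (intro holomorphic_on_compose_gen[OF h]) (auto simp: hol2_def scaleR_conv_of_real)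
    then show "(\<lambda>u. f (w, r *\<^sub>R u)) holomorphic_on ball 0 R" by (simp add: o_def scaleR_conv_of_real)
  qed
  have "continuous_on torus (\<lambda>\<zeta>. f (r *\<^sub>R \<zeta>) * cnj (szego_kernel z \<zeta>))"
    by (intro continuous_intros hol2_continuous_dilation f r continuous_on_szego_kernel z)
  note integral_torus_measure[OF this]
  also have "integral {0..2*pi} (\<lambda>s. integral {0..2*pi} (\<lambda>t. f (r *\<^sub>R (cis s, cis t)) * cnj (szego_kernel z (cis s, cis t))))
    = integral {0..2*pi} (\<lambda>s. 2 * pi * f (r *\<^sub>R cis s, r *\<^sub>R snd z) / (1 - cnj (cis s) * fst z))"
  proof (rule integral_cong)
    fix s
    have "integral {0..2*pi} (\<lambda>t. f (r *\<^sub>R (cis s, cis t)) * cnj (szego_kernel z (cis s, cis t)))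
       = integral {0..2*pi} (\<lambda>t. f (r *\<^sub>R cis s, r *\<^sub>R cis t) / (1 - cnj (cis t) * snd z) / (1 - cnj (cis s) * fst z))"
      by (simp add: szego_kernel_def field_simps)
    also have "\<dots> = integral {0..2*pi} (\<lambda>t. f (r *\<^sub>R cis s, r *\<^sub>R cis t) / (1 - cnj (cis t) * snd z)) / (1 - cnj (cis s) * fst z)"
      by (rule integral_divide)
    also have "integral {0..2*pi} (\<lambda>t. f (r *\<^sub>R cis s, r *\<^sub>R cis t) / (1 - cnj (cis t) * snd z))
         = 2 * pi * f (r *\<^sub>R cis s, r *\<^sub>R snd z)"
      using z r by (intro Cauchy_circle[OF hol(2) R]) (auto simp: bidisc_iff)
    finally show "integral {0..2*pi} (\<lambda>t. f (r *\<^sub>R (cis s, cis t)) * cnj (szego_kernel z (cis s, cis t)))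
       = 2 * pi * f (r *\<^sub>R cis s, r *\<^sub>R snd z) / (1 - cnj (cis s) * fst z)" by simp
  qed
  also have "\<dots> = 2 * pi * integral {0..2*pi} (\<lambda>s. f (r *\<^sub>R cis s, r *\<^sub>R snd z) / (1 - cnj (cis s) * fst z))"
    by (simp flip: integral_mult_right times_divide_eq_right)
  also have "integral {0..2*pi} (\<lambda>s. f (r *\<^sub>R cis s, r *\<^sub>R snd z) / (1 - cnj (cis s) * fst z)) = 2 * pi * f (r *\<^sub>R fst z, r *\<^sub>R snd z)"
    using z r mult_le_one[of r "cmod (snd z)"] 
    by (intro Cauchy_circle[OF hol(1) R]) (auto simp: bidisc_iff intro: le_less_trans[OF mult_right_le_one_le])
  finally show ?thesis
    by (simp add: power2_eq_square scaleR_prod_def)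
qed

section \<open>Szego kernel expansion and Taylor series on the bidisc\<close>

lemma has_sum_geometric_pair:
  fixes x y :: complex
  assumes x: "cmod x < 1" and y: "cmod y < 1"
  shows "((\<lambda>n. x ^ fst n * y ^ snd n) has_sum 1 / ((1 - x) * (1 - y))) UNIV"
proof -
  have geo: "((\<lambda>k. z ^ k) has_sum 1 / (1 - z)) UNIV" if "norm z < 1" for z :: "'a :: {real_normed_field, banach}"
    using that by (intro norm_summable_imp_has_sum geometric_sums) (simp add: norm_power summable_geometric)
  have "((\<lambda>(k, l). x ^ k * y ^ l) has_sum 1 / (1 - x) * (1 / (1 - y))) (UNIV \<times> UNIV)"
  proof (rule has_sum_SigmaI)
    show "((\<lambda>l. case (k, l) of (k, l) \<Rightarrow> x ^ k * y ^ l) has_sum x ^ k * (1 / (1 - y))) UNIV" for k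
      using has_sum_cmult_right[OF geo[OF y]] by simp
    show "((\<lambda>k. x ^ k * (1 / (1 - y))) has_sum 1 / (1 - x) * (1 / (1 - y))) UNIV"
      by (rule has_sum_cmult_left[OF geo[OF x]])
    have ny: "((\<lambda>l. cmod x ^ k * cmod y ^ l) has_sum cmod x ^ k * (1 / (1 - cmod y))) UNIV" for k
      using geo[of "cmod y"] y by (intro has_sum_cmult_right) simp
    have nx: "((\<lambda>k. cmod x ^ k * (1 / (1 - cmod y))) has_sum 1 / (1 - cmod x) * (1 / (1 - cmod y))) UNIV"
      using geo[of "cmod x"] x by (intro has_sum_cmult_left) simp
    have "(\<lambda>p. norm (case p of (k, l) \<Rightarrow> x ^ k * y ^ l)) summable_on (UNIV \<times> UNIV)"
      unfolding Infinite_Sum.abs_summable_on_Sigma_iff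
    proof (intro conjI ballI)
      show "(\<lambda>l. norm (case (k, l) of (k, l) \<Rightarrow> x ^ k * y ^ l)) summable_on UNIV" for k
        using ny[of k] by (auto simp: norm_mult norm_power summable_on_def)
      have "infsum (\<lambda>l. norm (case (k, l) of (k, l) \<Rightarrow> x ^ k * y ^ l)) UNIV = cmod x ^ k * (1 / (1 - cmod y))" for k
        using infsumI[OF ny[of k]] by (simp add: norm_mult norm_power)
      then show "(\<lambda>k. norm (infsum (\<lambda>l. norm (case (k, l) of (k, l) \<Rightarrow> x ^ k * y ^ l)) UNIV)) summable_on UNIV"
        using nx y by (auto simp: norm_mult norm_power summable_on_def)
    qed
    then show "(\<lambda>(k, l). x ^ k * y ^ l) summable_on (UNIV \<times> UNIV)"
      by (rule abs_summable_summable)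
  qed
  then show ?thesis by (simp add: case_prod_beta')
qed

text \<open>\<open>z\<close> ranges over the closed bidisc because the expansion is used in two
  ways: as a power series in the interior, and on the torus as a series to be integrated term by
  term.\<close>

lemma szego_kernel_has_sum:
  assumes "w \<in> bidisc" "cmod (fst z) \<le> 1" "cmod (snd z) \<le> 1"
  shows "((\<lambda>n. cnj (monom2 n w) * monom2 n z) has_sum szego_kernel w z) UNIV"
proof -
  have m: "cmod (x * cnj y) < 1" if "cmod x \<le> 1" "cmod y < 1" for x y
    using mult_right_mono[OF that(1), of "cmod y"] that by (simp add: norm_mult)
  have "((\<lambda>n. (fst z * cnj (fst w)) ^ fst n * (snd z * cnj (snd w)) ^ snd n) has_sum szego_kernel w z) UNIV"
    unfolding szego_kernel_def using assms
    by (intro has_sum_geometric_pair m) (auto simp: bidisc_iff)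
  then show ?thesis by (simp add: monom2_def power_mult_distrib ac_simps)
qed

lemma summable_norm_monom2:
  assumes "w \<in> bidisc"
  shows "(\<lambda>n. cmod (monom2 n w)) summable_on UNIV"
proof -
  have "(\<lambda>n. monom2 n w) summable_on UNIV"
    using has_sum_geometric_pair[of "fst w" "snd w"] assms
    by (auto simp: bidisc_iff monom2_def summable_on_def)
  then show ?thesis by (simp add: summable_on_iff_abs_summable_on_complex)
qed

text \<open>Orthonormality leaves a single term of the integrated series. A single radius r > 0
  therefore already determines all coefficients, which gives the uniqueness of power series
  below.\<close>

lemma dilation_Fourier_coeff:
  assumes "bidisc_series f a" "0 \<le> r" "r < 1"
  shows "(\<integral>\<zeta>. f (r *\<^sub>R \<zeta>) * cnj (monom2 n \<zeta>) \<partial>torus_measure) = a n * of_real r ^ deg n"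
proof -
  have "integrable torus_measure (\<lambda>\<zeta>. cnj (monom2 n \<zeta>))"
    by (intro torus_integrable_continuous continuous_intros)
  from series_torus_integral[OF this assms]
  have "((\<lambda>m. a m * of_real r ^ deg m * (\<integral>\<zeta>. monom2 m \<zeta> * cnj (monom2 n \<zeta>) \<partial>torus_measure))
     has_sum (\<integral>\<zeta>. f (r *\<^sub>R \<zeta>) * cnj (monom2 n \<zeta>) \<partial>torus_measure)) UNIV"
    by (simp add: mult.commute)
  moreover have "((\<lambda>m. a m * of_real r ^ deg m * (\<integral>\<zeta>. monom2 m \<zeta> * cnj (monom2 n \<zeta>) \<partial>torus_measure))
     has_sum a n * of_real r ^ deg n) UNIV"
    by (rule has_sum_finite_neutralI[where B = "{n}"]) (auto simp: integral_monom2_orthonormal)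
  ultimately show ?thesis by (rule has_sum_unique)
qed

lemma bidisc_series_unique:
  assumes "bidisc_series f a" "bidisc_series f b"
  shows "a = b"
  using dilation_Fourier_coeff[OF assms(1), of "1/2"] dilation_Fourier_coeff[OF assms(2), of "1/2"]
  by auto

lemma taylor_coeffs_eq: "hardy_coeffs f a \<Longrightarrow> taylor_coeffs f = a"
  unfolding taylor_coeffs_def
  by (rule the_equality) (auto simp: hardy_coeffs_iff intro: bidisc_series_unique)

text \<open>Expanding the Szego kernel in the Cauchy formula gives a series for each dilation f(r
  z), with coefficients \<open>b r\<close> that depend on r. Comparing two radii shows that
  \<open>b r n\<close> divided by r to the degree of n is the same for every r > 0; this common
  value is the Taylor coefficient, read off at radius 1/2.\<close>

lemma bidisc_series_exists:
  assumes f: "hol2 f"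
  obtains a where "bidisc_series f a"
proof -
  define b where "b r n = (\<integral>\<zeta>. f (r *\<^sub>R \<zeta>) * cnj (monom2 n \<zeta>) \<partial>torus_measure)" for r n
  have b: "bidisc_series (\<lambda>z. f (r *\<^sub>R z)) (b r)" if r: "0 \<le> r" "r < 1" for r
    unfolding bidisc_series_def
  proof
    fix z assume z: "z \<in> bidisc"
    have "((\<lambda>n. \<integral>\<zeta>. f (r *\<^sub>R \<zeta>) * (cnj (monom2 n \<zeta>) * monom2 n z) \<partial>torus_measure)
       has_sum (\<integral>\<zeta>. f (r *\<^sub>R \<zeta>) * cnj (szego_kernel z \<zeta>) \<partial>torus_measure)) UNIV"
    proof (rule has_sum_torus_integral[OF _ _ _ summable_norm_monom2[OF z]])
      show "integrable torus_measure (\<lambda>\<zeta>. f (r *\<^sub>R \<zeta>))"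
        by (intro torus_integrable_continuous hol2_continuous_dilation f r)
      show "continuous_on torus (\<lambda>\<zeta>. cnj (monom2 n \<zeta>) * monom2 n z)" for n
        by (intro continuous_intros)
      fix \<zeta> assume \<zeta>: "\<zeta> \<in> torus"
      then show "cmod (cnj (monom2 n \<zeta>) * monom2 n z) \<le> cmod (monom2 n z)" for n
        by (simp add: norm_mult norm_monom2_torus)
      have "((\<lambda>n. cnj (cnj (monom2 n z) * monom2 n \<zeta>)) has_sum cnj (szego_kernel z \<zeta>)) UNIV"
        using \<zeta> by (intro has_sum_bounded_linear[OF bounded_linear_cnj] szego_kernel_has_sum z) (auto simp: torus_iff)
      then show "((\<lambda>n. cnj (monom2 n \<zeta>) * monom2 n z) has_sum cnj (szego_kernel z \<zeta>)) UNIV"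
        by (simp add: mult.commute)
    qed
    moreover have "(\<integral>\<zeta>. f (r *\<^sub>R \<zeta>) * (cnj (monom2 n \<zeta>) * monom2 n z) \<partial>torus_measure) = b r n * monom2 n z" for n
      by (simp add: b_def flip: mult.assoc)
    ultimately show "((\<lambda>n. b r n * monom2 n z) has_sum f (r *\<^sub>R z)) UNIV"
      using Cauchy_torus[OF f r z] by simp
  qed
  have bs: "b s n = b r n * of_real (s / r) ^ deg n" if "0 \<le> s" "s < r" "r < 1" for s r n
    using dilation_Fourier_coeff[OF b[of r], of "s / r" n] that by (simp add: b_def)
  define a where "a n = b (1/2) n * 2 ^ deg n" for n
  have "bidisc_series f a"
    unfolding bidisc_series_def
  proof
    fix z assume z: "z \<in> bidisc"
    \<comment> \<open>The radius exceeds both |z_j|, so that z/r stays in the bidisc, and also 1/2,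
      so that \<open>bs\<close> relates it to the radius at which \<open>a\<close> was read
      off.\<close>
    have "max (1/2) (max (cmod (fst z)) (cmod (snd z))) < 1" using z by (simp add: bidisc_iff)
    then obtain r where r: "max (1/2) (max (cmod (fst z)) (cmod (snd z))) < r" "r < 1"
      using dense by blast
    have "inverse r *\<^sub>R z \<in> bidisc" using r by (auto simp: bidisc_iff field_simps)
    then have "((\<lambda>n. b r n * monom2 n (inverse r *\<^sub>R z)) has_sum f (r *\<^sub>R (inverse r *\<^sub>R z))) UNIV"
      using b[of r] r by (auto simp: bidisc_series_def)
    moreover have "b r n * monom2 n (inverse r *\<^sub>R z) = a n * monom2 n z" for n
      using bs[of "1/2" r n] r unfolding a_def monom2_scaleR
      by (simp add: power_divide power_mult_distrib field_simps)
    ultimately show "((\<lambda>n. a n * monom2 n z) has_sum f z) UNIV" using r by simp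
  qed
  then show thesis by (rule that)
qed

section \<open>Hardy norms as limits of means over smaller tori\<close>

lemma dilation_norm_has_sum:
  assumes "bidisc_series f a" "0 \<le> r" "r < 1"
  shows "((\<lambda>n. (cmod (a n))\<^sup>2 * (r ^ deg n)\<^sup>2) has_sum (\<integral>\<zeta>. (cmod (f (r *\<^sub>R \<zeta>)))\<^sup>2 \<partial>torus_measure)) UNIV"
proof -
  have cont: "continuous_on torus (\<lambda>\<zeta>. f (r *\<^sub>R \<zeta>))"
    by (intro hol2_continuous_dilation hol2_of_series[OF assms(1)] assms)
  \<comment> \<open>Taking the conjugate of the dilation itself as the weight turns the termwise
    integral into the sum of squared moduli.\<close>
  then have "integrable torus_measure (\<lambda>\<zeta>. cnj (f (r *\<^sub>R \<zeta>)))"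
    by (intro torus_integrable_continuous continuous_intros)
  note series_torus_integral[OF this assms]
  also have "(\<integral>\<zeta>. cnj (f (r *\<^sub>R \<zeta>)) * f (r *\<^sub>R \<zeta>) \<partial>torus_measure)
      = (\<integral>\<zeta>. of_real ((cmod (f (r *\<^sub>R \<zeta>)))\<^sup>2) \<partial>torus_measure)"
    unfolding complex_norm_square by (simp add: mult.commute)
  also have "\<dots> = of_real (\<integral>\<zeta>. (cmod (f (r *\<^sub>R \<zeta>)))\<^sup>2 \<partial>torus_measure)"
    by (rule integral_complex_of_real)
  also have "(\<lambda>n. a n * of_real r ^ deg n * (\<integral>\<zeta>. cnj (f (r *\<^sub>R \<zeta>)) * monom2 n \<zeta> \<partial>torus_measure))
      = (\<lambda>n. of_real ((cmod (a n))\<^sup>2 * (r ^ deg n)\<^sup>2))"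
  proof
    fix n
    have "(\<integral>\<zeta>. cnj (f (r *\<^sub>R \<zeta>)) * monom2 n \<zeta> \<partial>torus_measure)
        = cnj (\<integral>\<zeta>. f (r *\<^sub>R \<zeta>) * cnj (monom2 n \<zeta>) \<partial>torus_measure)"
      using Bochner_Integration.integral_cnj[of torus_measure "\<lambda>\<zeta>. f (r *\<^sub>R \<zeta>) * cnj (monom2 n \<zeta>)"] by simp
    then show "a n * of_real r ^ deg n * (\<integral>\<zeta>. cnj (f (r *\<^sub>R \<zeta>)) * monom2 n \<zeta> \<partial>torus_measure)
        = of_real ((cmod (a n))\<^sup>2 * (r ^ deg n)\<^sup>2)"
      unfolding dilation_Fourier_coeff[OF assms] of_real_mult complex_norm_square
      by (simp add: power2_eq_square ac_simps)
  qed
  finally show ?thesis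
    using has_sum_of_real_iff by blast
qed

text \<open>The means bound every finite weighted sum of squares; in a finite sum r can tend to 1
  term by term. The second conclusion keeps the constant \<open>K\<close> itself, so that it can
  serve as a norm inequality.\<close>

lemma hardy_coeffsI:
  assumes f: "bidisc_series f a"
    and K: "\<And>r. 0 \<le> r \<Longrightarrow> r < 1 \<Longrightarrow> (\<integral>\<zeta>. (cmod (f (r *\<^sub>R \<zeta>)))\<^sup>2 \<partial>torus_measure) \<le> K"
  shows "hardy_coeffs f a" "(\<Sum>\<^sub>\<infinity>n. (cmod (a n))\<^sup>2) \<le> K"
proof -
  have fin: "(\<Sum>n\<in>X. (cmod (a n))\<^sup>2) \<le> K" if X: "finite X" for X
  proof (rule tendsto_upperbound)
    have "((\<lambda>r. \<Sum>n\<in>X. (cmod (a n))\<^sup>2 * (r ^ deg n)\<^sup>2) \<longlongrightarrow> (\<Sum>n\<in>X. (cmod (a n))\<^sup>2 * (1 ^ deg n)\<^sup>2)) (at_left (1::real))"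
      by (intro tendsto_intros)
    then show "((\<lambda>r. \<Sum>n\<in>X. (cmod (a n))\<^sup>2 * (r ^ deg n)\<^sup>2) \<longlongrightarrow> (\<Sum>n\<in>X. (cmod (a n))\<^sup>2)) (at_left (1::real))"
      by simp
    have "\<forall>\<^sub>F r in at_left (1::real). r \<in> {0<..<1}" by (rule eventually_at_left_real) simp
    then show "\<forall>\<^sub>F r in at_left (1::real). (\<Sum>n\<in>X. (cmod (a n))\<^sup>2 * (r ^ deg n)\<^sup>2) \<le> K"
    proof eventually_elim
      case (elim r)
      then have r: "0 \<le> r" "r < 1" by auto
      from finite_sum_le_has_sum[OF dilation_norm_has_sum[OF f r] X] K[OF r]
      show ?case by fastforce
    qed
  qed simp
  have s: "(\<lambda>n. (cmod (a n))\<^sup>2) summable_on UNIV"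
    by (rule nonneg_bdd_above_summable_on) (auto intro!: bdd_aboveI[of _ K] fin)
  then show "hardy_coeffs f a" using f by (simp add: hardy_coeffs_iff)
  show "(\<Sum>\<^sub>\<infinity>n. (cmod (a n))\<^sup>2) \<le> K" by (rule infsum_le_finite_sums[OF s]) (use fin in auto)
qed

lemma hardy_coeffs_hol2: "hardy_coeffs f a \<Longrightarrow> hol2 f"
  by (auto simp: hardy_coeffs_iff intro: hol2_of_series)

lemma hardy_coeffs_taylor: "f \<in> hardy_space \<Longrightarrow> hardy_coeffs f (taylor_coeffs f)"
  unfolding hardy_space_def using taylor_coeffs_eq by blast

lemma hardy_space_hol2: "f \<in> hardy_space \<Longrightarrow> hol2 f"
  using hardy_coeffs_taylor hardy_coeffs_hol2 by blast

lemma hardy_dilation_norm_le: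
  assumes f: "hardy_coeffs f a" and r: "0 \<le> r" "r < 1"
  shows "(\<integral>\<zeta>. (cmod (f (r *\<^sub>R \<zeta>)))\<^sup>2 \<partial>torus_measure) \<le> (\<Sum>\<^sub>\<infinity>n. (cmod (a n))\<^sup>2)"
proof (rule has_sum_mono)
  show "((\<lambda>n. (cmod (a n))\<^sup>2 * (r ^ deg n)\<^sup>2) has_sum (\<integral>\<zeta>. (cmod (f (r *\<^sub>R \<zeta>)))\<^sup>2 \<partial>torus_measure)) UNIV"
    using f r by (intro dilation_norm_has_sum) (auto simp: hardy_coeffs_iff)
  show "((\<lambda>n. (cmod (a n))\<^sup>2) has_sum (\<Sum>\<^sub>\<infinity>n. (cmod (a n))\<^sup>2)) UNIV"
    using f by (simp add: hardy_coeffs_iff)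
  show "(cmod (a n))\<^sup>2 * (r ^ deg n)\<^sup>2 \<le> (cmod (a n))\<^sup>2" for n
    using r by (intro mult_left_le power_le_one) auto
qed

lemma hol2_mult: "hol2 f \<Longrightarrow> hol2 g \<Longrightarrow> hol2 (\<lambda>z. f z * g z)"
  by (auto simp: hol2_def intro!: continuous_intros holomorphic_intros)

lemma hol2_diff: "hol2 f \<Longrightarrow> hol2 g \<Longrightarrow> hol2 (\<lambda>z. f z - g z)"
  by (auto simp: hol2_def intro!: continuous_intros holomorphic_intros)

lemma hol2_const: "hol2 (\<lambda>z. c)"
  by (auto simp: hol2_def intro!: continuous_intros holomorphic_intros)

lemma hol2_fst: "hol2 fst"
  by (auto simp: hol2_def intro!: continuous_intros holomorphic_intros)

lemma hol2_power: "hol2 f \<Longrightarrow> hol2 (\<lambda>z. f z ^ n)"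
  by (auto simp: hol2_def intro!: continuous_intros holomorphic_intros)

text \<open>The coefficients of a product are convolutions and hard to estimate, but its means over
  the tori of radius r are at most \<open>B\<close> squared times those of \<open>f\<close>.\<close>

lemma hardy_space_bounded_mult:
  assumes q: "hol2 q" "\<And>z. z \<in> bidisc \<Longrightarrow> cmod (q z) \<le> B" and f: "f \<in> hardy_space"
  shows "(\<lambda>z. q z * f z) \<in> hardy_space"
proof -
  note fc = hardy_coeffs_taylor[OF f]
  have hol: "hol2 (\<lambda>z. q z * f z)" by (intro hol2_mult q hardy_space_hol2 f)
  then obtain a where a: "bidisc_series (\<lambda>z. q z * f z) a" by (rule bidisc_series_exists)
  have "hardy_coeffs (\<lambda>z. q z * f z) a"
  proof (rule hardy_coeffsI(1)[OF a])
    fix r :: real assume r: "0 \<le> r" "r < 1"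
    have "(\<integral>\<zeta>. (cmod (q (r *\<^sub>R \<zeta>) * f (r *\<^sub>R \<zeta>)))\<^sup>2 \<partial>torus_measure)
        \<le> (\<integral>\<zeta>. B\<^sup>2 * (cmod (f (r *\<^sub>R \<zeta>)))\<^sup>2 \<partial>torus_measure)"
    proof (rule integral_mono)
      show "integrable torus_measure (\<lambda>\<zeta>. (cmod (q (r *\<^sub>R \<zeta>) * f (r *\<^sub>R \<zeta>)))\<^sup>2)"
        by (intro torus_integrable_continuous continuous_intros hol2_continuous_dilation q hardy_space_hol2 f r)
      show "integrable torus_measure (\<lambda>\<zeta>. B\<^sup>2 * (cmod (f (r *\<^sub>R \<zeta>)))\<^sup>2)"
        by (intro torus_integrable_continuous continuous_intros hol2_continuous_dilation hardy_space_hol2 f r)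
      fix \<zeta> assume "\<zeta> \<in> space torus_measure"
      then have "cmod (q (r *\<^sub>R \<zeta>)) \<le> B" by (intro q(2) scaleR_torus_in_bidisc r) simp
      then show "(cmod (q (r *\<^sub>R \<zeta>) * f (r *\<^sub>R \<zeta>)))\<^sup>2 \<le> B\<^sup>2 * (cmod (f (r *\<^sub>R \<zeta>)))\<^sup>2"
        by (auto simp: norm_mult power_mult_distrib intro!: mult_right_mono power_mono)
    qed
    also have "\<dots> = B\<^sup>2 * (\<integral>\<zeta>. (cmod (f (r *\<^sub>R \<zeta>)))\<^sup>2 \<partial>torus_measure)" by simp
    also have "\<dots> \<le> B\<^sup>2 * (\<Sum>\<^sub>\<infinity>n. (cmod (taylor_coeffs f n))\<^sup>2)"
      by (intro mult_left_mono hardy_dilation_norm_le[OF fc r]) simp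
    finally show "(\<integral>\<zeta>. (cmod (q (r *\<^sub>R \<zeta>) * f (r *\<^sub>R \<zeta>)))\<^sup>2 \<partial>torus_measure) \<le> \<dots>" .
  qed
  then show ?thesis by (auto simp: hardy_space_def)
qed

lemma hardy_space_one: "(\<lambda>z. 1) \<in> hardy_space"
proof -
  have "bidisc_series (\<lambda>z. 1) (\<lambda>n. if n = (0,0) then 1 else 0)"
    unfolding bidisc_series_def
    by (intro ballI has_sum_finite_neutralI[where B = "{(0,0)}"]) (auto simp: monom2_def)
  then have "hardy_coeffs (\<lambda>z. 1) (\<lambda>n. if n = (0,0) then 1 else 0)"
    by (rule hardy_coeffsI(1)[where K=1]) (simp add: torus.prob_space)
  then show ?thesis by (auto simp: hardy_space_def)
qed

lemma hardy_space_bounded: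
  assumes "hol2 q" "\<And>z. z \<in> bidisc \<Longrightarrow> cmod (q z) \<le> B"
  shows "q \<in> hardy_space"
  using hardy_space_bounded_mult[OF assms hardy_space_one] by simp


subsection \<open>Boundary values and Parseval\<close>

lemma continuous_on_infsum:
  fixes g :: "'i \<Rightarrow> 'a::topological_space \<Rightarrow> 'b::banach"
  assumes "\<And>n. continuous_on S (g n)" "\<And>n x. x \<in> S \<Longrightarrow> norm (g n x) \<le> M n" "M summable_on A"
  shows "continuous_on S (\<lambda>x. \<Sum>\<^sub>\<infinity>n\<in>A. g n x)"
  by (rule uniform_limit_theorem[OF _ Weierstrass_m_test_general[OF assms(2,3)]])
     (auto intro!: always_eventually continuous_intros assms(1))

lemma continuous_on_tendsto_at_left:
  fixes f :: "real \<Rightarrow> 'a::topological_space"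
  assumes "continuous_on {a..b} f" "a < b"
  shows "(f \<longlongrightarrow> f b) (at_left b)"
proof -
  have "(f \<longlongrightarrow> f b) (at b within {a..b})" using assms by (simp add: continuous_on_def)
  then show ?thesis by (simp add: at_within_Icc_at_left assms(2))
qed

lemma eventually_at_left_1: "\<forall>\<^sub>F r in at_left (1::real). 0 \<le> r \<and> r < 1"
  using eventually_at_left_real[of 0 "1::real"] by (auto elim: eventually_mono)

lemma dilation_L2:
  assumes "hol2 f" "0 \<le> r" "r < 1"
  shows "(\<lambda>\<zeta>. f (r *\<^sub>R \<zeta>)) \<in> L2 torus_measure"
  by (intro L2_I borel_measurable_torus_continuous torus_integrable_continuous continuous_intros
        hol2_continuous_dilation assms)

text \<open>A fixed sequence of radii in [0, 1) increasing to 1, for the arguments that need a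
  sequential limit: completeness, subsequences and dominated convergence.\<close>

definition radius_seq :: "nat \<Rightarrow> real" where
  "radius_seq n = 1 - inverse (real (Suc n))"

lemma radius_seq_bounds: "0 \<le> radius_seq n" "radius_seq n < 1"
  by (auto simp: radius_seq_def field_simps)

lemma radius_seq_mono: "m \<le> n \<Longrightarrow> radius_seq m \<le> radius_seq n"
  by (auto simp: radius_seq_def field_simps)

lemma radius_seq_tendsto: "radius_seq \<longlonglongrightarrow> 1"
  using tendsto_diff[OF tendsto_const LIMSEQ_inverse_real_of_nat, of 1] by (simp add: radius_seq_def[abs_def])

lemma radius_seq_at_left: "filterlim radius_seq (at_left 1) sequentially"
  using radius_seq_tendsto radius_seq_bounds(2)
  by (auto simp: filterlim_at less_imp_neq intro!: always_eventually)

lemma bidisc_series_diff: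
  assumes "bidisc_series f a" "bidisc_series g b"
  shows "bidisc_series (\<lambda>z. f z - g z) (\<lambda>n. a n - b n)"
  unfolding bidisc_series_def
proof
  fix z assume "z \<in> bidisc"
  then have "((\<lambda>n. a n * monom2 n z + (-1) * (b n * monom2 n z)) has_sum f z + (-1) * g z) UNIV"
    using assms by (intro has_sum_add has_sum_cmult_right) (auto simp: bidisc_series_def)
  then show "((\<lambda>n. (a n - b n) * monom2 n z) has_sum f z - g z) UNIV"
    by (simp add: left_diff_distrib)
qed

lemma bidisc_series_dilation:
  assumes "bidisc_series f a" "0 \<le> r" "r < 1"
  shows "bidisc_series (\<lambda>z. f (r *\<^sub>R z)) (\<lambda>n. a n * of_real r ^ deg n)"
  unfolding bidisc_series_def
proof
  fix z assume "z \<in> bidisc"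
  then have "r *\<^sub>R z \<in> bidisc"
    using assms mult_le_one[of r] by (auto simp: bidisc_iff intro: le_less_trans[OF mult_left_le_one_le])
  then show "((\<lambda>n. a n * of_real r ^ deg n * monom2 n z) has_sum f (r *\<^sub>R z)) UNIV"
    using assms(1) by (auto simp: bidisc_series_def monom2_scaleR mult.assoc)
qed

lemma dilation_diff_norm_has_sum:
  assumes f: "bidisc_series f a" and r: "0 \<le> r" "r < 1" and s: "0 \<le> s" "s < 1"
  shows "((\<lambda>n. (cmod (a n))\<^sup>2 * (r ^ deg n - s ^ deg n)\<^sup>2)
    has_sum (\<integral>\<zeta>. (cmod (f (r *\<^sub>R \<zeta>) - f (s *\<^sub>R \<zeta>)))\<^sup>2 \<partial>torus_measure)) UNIV"
proof -
  have "max r s < 1" using r s by simp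
  \<comment> \<open>The difference of two dilations is itself the dilation by t of a function with a
    series on the whole bidisc, because r/t and s/t are still below 1. Parseval at radius t then
    applies.\<close>
  then obtain t where t: "max r s < t" "t < 1" using dense by blast
  have "bidisc_series (\<lambda>z. f ((r / t) *\<^sub>R z) - f ((s / t) *\<^sub>R z))
      (\<lambda>n. a n * of_real (r / t) ^ deg n - a n * of_real (s / t) ^ deg n)"
    using r s t by (intro bidisc_series_diff bidisc_series_dilation f) auto
  from dilation_norm_has_sum[OF this, of t] r s t
  have "((\<lambda>n. (cmod (a n * of_real (r / t) ^ deg n - a n * of_real (s / t) ^ deg n))\<^sup>2 * (t ^ deg n)\<^sup>2)
    has_sum (\<integral>\<zeta>. (cmod (f (r *\<^sub>R \<zeta>) - f (s *\<^sub>R \<zeta>)))\<^sup>2 \<partial>torus_measure)) UNIV"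
    by simp
  also have "(\<lambda>n. (cmod (a n * of_real (r / t) ^ deg n - a n * of_real (s / t) ^ deg n))\<^sup>2 * (t ^ deg n)\<^sup>2)
     = (\<lambda>n. (cmod (a n))\<^sup>2 * (r ^ deg n - s ^ deg n)\<^sup>2)"
  proof
    fix n
    have "a n * of_real (r / t) ^ deg n - a n * of_real (s / t) ^ deg n
        = a n * of_real ((r / t) ^ deg n - (s / t) ^ deg n)" by (simp add: algebra_simps)
    then have "(cmod (a n * of_real (r / t) ^ deg n - a n * of_real (s / t) ^ deg n))\<^sup>2 * (t ^ deg n)\<^sup>2
        = (cmod (a n))\<^sup>2 * (((r / t) ^ deg n - (s / t) ^ deg n) * t ^ deg n)\<^sup>2"
      by (simp only: norm_mult norm_of_real power_mult_distrib power2_abs ac_simps)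
    also have "((r / t) ^ deg n - (s / t) ^ deg n) * t ^ deg n = r ^ deg n - s ^ deg n"
      using t r by (simp add: power_divide field_simps)
    finally show "(cmod (a n * of_real (r / t) ^ deg n - a n * of_real (s / t) ^ deg n))\<^sup>2 * (t ^ deg n)\<^sup>2
      = (cmod (a n))\<^sup>2 * (r ^ deg n - s ^ deg n)\<^sup>2" .
  qed
  finally show ?thesis .
qed

text \<open>For every s between r and 1, Parseval bounds the squared distance of the dilations at r
  and s by \<open>S r\<close>. The series \<open>S\<close> is dominated by the squared coefficients,
  hence continuous on [0, 1], and vanishes at 1; so the dilations are Cauchy as r tends to
  1.\<close>

lemma boundary_function_exists:
  assumes f: "hardy_coeffs f a"
  shows "\<exists>F. boundary_function f F"
proof -
  have fs: "bidisc_series f a" and sq: "(\<lambda>n. (cmod (a n))\<^sup>2) summable_on UNIV"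
    using f by (auto simp: hardy_coeffs_iff)
  define S where "S r = (\<Sum>\<^sub>\<infinity>n. (cmod (a n))\<^sup>2 * (1 - r ^ deg n)\<^sup>2)" for r :: real
  have bound: "(cmod (a n))\<^sup>2 * (1 - r ^ deg n)\<^sup>2 \<le> (cmod (a n))\<^sup>2" if "0 \<le> r" "r \<le> 1" for r n
    using that by (intro mult_left_le power_le_one) (auto simp: power_le_one)
  have "continuous_on {0..1} S"
    unfolding S_def by (rule continuous_on_infsum[OF _ _ sq]) (auto intro!: continuous_intros bound)
  from continuous_on_tendsto_at_left[OF this]
  have S0: "(S \<longlongrightarrow> 0) (at_left 1)" by (simp add: S_def)
  have NS: "L2_norm torus_measure (\<lambda>\<zeta>. f (r *\<^sub>R \<zeta>) - f (s *\<^sub>R \<zeta>)) \<le> sqrt (S r)"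
    if r: "0 \<le> r" "r \<le> s" "s < 1" for r s
  proof (rule real_le_rsqrt)
    have su: "(\<lambda>n. (cmod (a n))\<^sup>2 * (1 - r ^ deg n)\<^sup>2) summable_on UNIV"
      by (rule summable_on_comparison_test[OF sq]) (use r bound in auto)
    show "(L2_norm torus_measure (\<lambda>\<zeta>. f (r *\<^sub>R \<zeta>) - f (s *\<^sub>R \<zeta>)))\<^sup>2 \<le> S r"
      unfolding L2_norm_sq S_def
    proof (rule has_sum_mono[OF dilation_diff_norm_has_sum[OF fs] has_sum_infsum[OF su]])
      fix n
      have "\<bar>r ^ deg n - s ^ deg n\<bar> \<le> 1 - r ^ deg n"
        using r power_mono[of r s "deg n"] power_le_one[of s "deg n"] by simp
      then have "(r ^ deg n - s ^ deg n)\<^sup>2 \<le> (1 - r ^ deg n)\<^sup>2"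
        by (metis abs_le_square_iff abs_of_nonneg abs_ge_zero order_trans)
      then show "(cmod (a n))\<^sup>2 * (r ^ deg n - s ^ deg n)\<^sup>2 \<le> (cmod (a n))\<^sup>2 * (1 - r ^ deg n)\<^sup>2"
        by (rule mult_left_mono) simp
    qed (use r in auto)
  qed
  have Sq0: "((\<lambda>r. sqrt (S r)) \<longlongrightarrow> 0) (at_left 1)"
    using tendsto_real_sqrt[OF S0] by simp
  note fL2 = dilation_L2[OF hardy_coeffs_hol2[OF f]]
  obtain F where F: "F \<in> L2 torus_measure" "(\<lambda>n. L2_norm torus_measure (\<lambda>\<zeta>. f (radius_seq n *\<^sub>R \<zeta>) - F \<zeta>)) \<longlonglongrightarrow> 0"
  proof (rule torus.L2_complete[of "\<lambda>n \<zeta>. f (radius_seq n *\<^sub>R \<zeta>)"])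
    fix e :: real assume "e > 0"
    have "(\<lambda>n. sqrt (S (radius_seq n))) \<longlonglongrightarrow> 0" by (rule filterlim_compose[OF Sq0 radius_seq_at_left])
    from order_tendstoD(2)[OF this \<open>e > 0\<close>]
    obtain N where N: "\<And>n. n \<ge> N \<Longrightarrow> sqrt (S (radius_seq n)) < e" by (auto simp: eventually_sequentially)
    have le: "L2_norm torus_measure (\<lambda>\<zeta>. f (radius_seq m *\<^sub>R \<zeta>) - f (radius_seq n *\<^sub>R \<zeta>)) < e" if "m \<ge> N" "m \<le> n" for m n
      using NS[of "radius_seq m" "radius_seq n"] N[OF that(1)] radius_seq_bounds radius_seq_mono[OF that(2)] by fastforce
    show "\<exists>N. \<forall>m\<ge>N. \<forall>n\<ge>N. L2_norm torus_measure (\<lambda>\<zeta>. f (radius_seq m *\<^sub>R \<zeta>) - f (radius_seq n *\<^sub>R \<zeta>)) < e"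
    proof (intro exI[of _ N] allI impI)
      fix m n assume "m \<ge> N" "n \<ge> N"
      then show "L2_norm torus_measure (\<lambda>\<zeta>. f (radius_seq m *\<^sub>R \<zeta>) - f (radius_seq n *\<^sub>R \<zeta>)) < e"
        using le[of m n] le[of n m] L2_norm_minus_commute[of torus_measure "\<lambda>\<zeta>. f (radius_seq m *\<^sub>R \<zeta>)"]
        by (cases "m \<le> n") auto
    qed
  qed (use fL2 radius_seq_bounds in auto)
  have "((\<lambda>r. L2_norm torus_measure (\<lambda>\<zeta>. f (r *\<^sub>R \<zeta>) - F \<zeta>)) \<longlongrightarrow> 0) (at_left 1)"
  proof (rule tendsto_sandwich[OF _ _ tendsto_const Sq0])
    show "\<forall>\<^sub>F r in at_left 1. L2_norm torus_measure (\<lambda>\<zeta>. f (r *\<^sub>R \<zeta>) - F \<zeta>) \<le> sqrt (S r)"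
      using eventually_at_left_1
    proof eventually_elim
      case (elim r)
      \<comment> \<open>With r fixed, n tends to infinity: the bound between dilations becomes a
        bound on the distance to \<open>F\<close>, valid for all r and not only along the chosen
        sequence.\<close>
      have "(\<lambda>n. sqrt (S r) + L2_norm torus_measure (\<lambda>\<zeta>. f (radius_seq n *\<^sub>R \<zeta>) - F \<zeta>)) \<longlonglongrightarrow> sqrt (S r) + 0"
        by (intro tendsto_intros F)
      moreover have "\<forall>\<^sub>F n in sequentially. L2_norm torus_measure (\<lambda>\<zeta>. f (r *\<^sub>R \<zeta>) - F \<zeta>)
          \<le> sqrt (S r) + L2_norm torus_measure (\<lambda>\<zeta>. f (radius_seq n *\<^sub>R \<zeta>) - F \<zeta>)"
      proof -
        have "\<forall>\<^sub>F n in sequentially. r < radius_seq n"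
          using order_tendstoD(1)[OF radius_seq_tendsto, of r] elim by simp
        then show ?thesis
        proof eventually_elim
          case (elim n)
          then show ?case
            using L2_norm_diff_triangle[OF fL2 fL2 F(1), of r "radius_seq n"] NS[of r "radius_seq n"] radius_seq_bounds[of n] \<open>0 \<le> r \<and> r < 1\<close>
            by fastforce
        qed
      qed
      ultimately show ?case
        using tendsto_lowerbound[of _ "sqrt (S r) + 0" sequentially] by fastforce
    qed
  qed (simp add: L2_norm_nonneg)
  with F(1) show ?thesis by (auto simp: boundary_function_def)
qed

lemma boundary_function_boundary_values:
  "f \<in> hardy_space \<Longrightarrow> boundary_function f (boundary_values f)"
  unfolding boundary_values_def using boundary_function_exists[OF hardy_coeffs_taylor] by (rule someI_ex)

lemma boundary_values_L2: "f \<in> hardy_space \<Longrightarrow> boundary_values f \<in> L2 torus_measure"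
  using boundary_function_boundary_values by (simp add: boundary_function_def)

lemma boundary_values_tendsto:
  "f \<in> hardy_space \<Longrightarrow>
    ((\<lambda>r. L2_norm torus_measure (\<lambda>\<zeta>. f (r *\<^sub>R \<zeta>) - boundary_values f \<zeta>)) \<longlongrightarrow> 0) (at_left 1)"
  using boundary_function_boundary_values by (simp add: boundary_function_def)

lemma boundary_function_unique:
  assumes f: "hol2 f" and F: "boundary_function f F" and G: "boundary_function f G"
  shows "AE \<zeta> in torus_measure. F \<zeta> = G \<zeta>"
proof -
  have FL: "F \<in> L2 torus_measure" and GL: "G \<in> L2 torus_measure"
    using F G by (auto simp: boundary_function_def)
  have "((\<lambda>r. L2_norm torus_measure (\<lambda>\<zeta>. f (r *\<^sub>R \<zeta>) - F \<zeta>) + L2_norm torus_measure (\<lambda>\<zeta>. f (r *\<^sub>R \<zeta>) - G \<zeta>)) \<longlongrightarrow> 0 + 0) (at_left 1)"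
    using F G by (intro tendsto_add) (auto simp: boundary_function_def)
  moreover have "\<forall>\<^sub>F r in at_left 1. L2_norm torus_measure (\<lambda>\<zeta>. F \<zeta> - G \<zeta>) \<le>
      L2_norm torus_measure (\<lambda>\<zeta>. f (r *\<^sub>R \<zeta>) - F \<zeta>) + L2_norm torus_measure (\<lambda>\<zeta>. f (r *\<^sub>R \<zeta>) - G \<zeta>)"
    using eventually_at_left_1
  proof eventually_elim
    case (elim r)
    then show ?case
      using L2_norm_diff_triangle[OF FL dilation_L2[OF f] GL, of r]
        L2_norm_minus_commute[of torus_measure F "\<lambda>\<zeta>. f (r *\<^sub>R \<zeta>)"] by simp
  qed
  ultimately have "L2_norm torus_measure (\<lambda>\<zeta>. F \<zeta> - G \<zeta>) \<le> 0 + 0"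
    by (rule tendsto_lowerbound) simp
  then have "L2_norm torus_measure (\<lambda>\<zeta>. F \<zeta> - G \<zeta>) = 0"
    using L2_norm_nonneg[of torus_measure "\<lambda>\<zeta>. F \<zeta> - G \<zeta>"] by simp
  from L2_norm_eq_0D[OF L2_diff[OF FL GL] this] show ?thesis by simp
qed

text \<open>Products of L2-convergent families converge in L1, so the two candidates are compared in
  the L1 norm. Their distance is bounded by a quantity that tends to 0 with r, hence is 0.\<close>

lemma boundary_values_mult:
  assumes f: "f \<in> hardy_space" and g: "g \<in> hardy_space" and fg: "(\<lambda>z. f z * g z) \<in> hardy_space"
  shows "AE \<zeta> in torus_measure. boundary_values (\<lambda>z. f z * g z) \<zeta> = boundary_values f \<zeta> * boundary_values g \<zeta>"
proof -
  let ?T = torus_measure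
  let ?F = "boundary_values f" and ?G = "boundary_values g" and ?H = "boundary_values (\<lambda>z. f z * g z)"
  note L = boundary_values_L2[OF f] boundary_values_L2[OF g] boundary_values_L2[OF fg]
  let ?f = "\<lambda>r. L2_norm ?T (\<lambda>\<zeta>. f (r *\<^sub>R \<zeta>) - ?F \<zeta>)"
  let ?g = "\<lambda>r. L2_norm ?T (\<lambda>\<zeta>. g (r *\<^sub>R \<zeta>) - ?G \<zeta>)"
  let ?h = "\<lambda>r. L2_norm ?T (\<lambda>\<zeta>. f (r *\<^sub>R \<zeta>) * g (r *\<^sub>R \<zeta>) - ?H \<zeta>)"
  have "((\<lambda>r. ?h r + (?f r + L2_norm ?T ?F) * ?g r + ?f r * L2_norm ?T ?G)
       \<longlongrightarrow> 0 + (0 + L2_norm ?T ?F) * 0 + 0 * L2_norm ?T ?G) (at_left 1)"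
    by (intro tendsto_intros boundary_values_tendsto f g fg)
  moreover have int: "integrable ?T (\<lambda>\<zeta>. ?H \<zeta> - ?F \<zeta> * ?G \<zeta>)"
    using torus.L1_le_L2_norm(1)[OF L(3)] L2_mult_integrable[OF L(1) L2_cnj[OF L(2)]]
    by simp
  moreover have "\<forall>\<^sub>F r in at_left 1. (\<integral>\<zeta>. cmod (?H \<zeta> - ?F \<zeta> * ?G \<zeta>) \<partial>?T)
      \<le> ?h r + (?f r + L2_norm ?T ?F) * ?g r + ?f r * L2_norm ?T ?G"
    using eventually_at_left_1
  proof eventually_elim
    case (elim r)
    then have r: "0 \<le> r" "r < 1" by auto
    note D = dilation_L2[OF hardy_space_hol2[OF f] r] dilation_L2[OF hardy_space_hol2[OF g] r]
      dilation_L2[OF hardy_space_hol2[OF fg] r]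
    note df = L2_diff[OF D(1) L(1)] and dg = L2_diff[OF D(2) L(2)] and dh = L2_diff[OF D(3) L(3)]
    have ints: "integrable ?T (\<lambda>\<zeta>. cmod (f (r *\<^sub>R \<zeta>) * g (r *\<^sub>R \<zeta>) - ?H \<zeta>))"
      "integrable ?T (\<lambda>\<zeta>. cmod (f (r *\<^sub>R \<zeta>)) * cmod (g (r *\<^sub>R \<zeta>) - ?G \<zeta>))"
      "integrable ?T (\<lambda>\<zeta>. cmod (f (r *\<^sub>R \<zeta>) - ?F \<zeta>) * cmod (?G \<zeta>))"
      using torus.L1_le_L2_norm(1)[OF dh] L2_abs_mult_integrable[OF D(1) dg] L2_abs_mult_integrable[OF df L(2)]
      by auto
    have "(\<integral>\<zeta>. cmod (?H \<zeta> - ?F \<zeta> * ?G \<zeta>) \<partial>?T)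
       \<le> (\<integral>\<zeta>. cmod (f (r *\<^sub>R \<zeta>) * g (r *\<^sub>R \<zeta>) - ?H \<zeta>) + cmod (f (r *\<^sub>R \<zeta>)) * cmod (g (r *\<^sub>R \<zeta>) - ?G \<zeta>)
            + cmod (f (r *\<^sub>R \<zeta>) - ?F \<zeta>) * cmod (?G \<zeta>) \<partial>?T)"
    proof (rule integral_mono)
      show "integrable ?T (\<lambda>\<zeta>. cmod (?H \<zeta> - ?F \<zeta> * ?G \<zeta>))" using int by simp
      show "integrable ?T (\<lambda>\<zeta>. cmod (f (r *\<^sub>R \<zeta>) * g (r *\<^sub>R \<zeta>) - ?H \<zeta>) + cmod (f (r *\<^sub>R \<zeta>)) * cmod (g (r *\<^sub>R \<zeta>) - ?G \<zeta>)
            + cmod (f (r *\<^sub>R \<zeta>) - ?F \<zeta>) * cmod (?G \<zeta>))"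
        using ints by simp
      have "cmod (h - x * y) \<le> cmod (u * v - h) + cmod u * cmod (v - y) + cmod (u - x) * cmod y" for h x y u v
      proof -
        \<comment> \<open>One factor is exchanged at a time, so that each remaining term is a
          product to which Cauchy-Schwarz applies.\<close>
        have "h - x * y = - (u * v - h) + u * (v - y) + (u - x) * y" by (simp add: algebra_simps)
        then show ?thesis
          by (metis (no_types, lifting) norm_minus_cancel norm_mult norm_triangle_mono norm_triangle_ineq order_refl)
      qed
      then show "cmod (?H \<zeta> - ?F \<zeta> * ?G \<zeta>) \<le> cmod (f (r *\<^sub>R \<zeta>) * g (r *\<^sub>R \<zeta>) - ?H \<zeta>) +
          cmod (f (r *\<^sub>R \<zeta>)) * cmod (g (r *\<^sub>R \<zeta>) - ?G \<zeta>) + cmod (f (r *\<^sub>R \<zeta>) - ?F \<zeta>) * cmod (?G \<zeta>)" for \<zeta> .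
    qed
    also have "\<dots> = (\<integral>\<zeta>. cmod (f (r *\<^sub>R \<zeta>) * g (r *\<^sub>R \<zeta>) - ?H \<zeta>) \<partial>?T) +
        (\<integral>\<zeta>. cmod (f (r *\<^sub>R \<zeta>)) * cmod (g (r *\<^sub>R \<zeta>) - ?G \<zeta>) \<partial>?T) +
        (\<integral>\<zeta>. cmod (f (r *\<^sub>R \<zeta>) - ?F \<zeta>) * cmod (?G \<zeta>) \<partial>?T)"
      using ints by simp
    also have "\<dots> \<le> ?h r + L2_norm ?T (\<lambda>\<zeta>. f (r *\<^sub>R \<zeta>)) * ?g r + ?f r * L2_norm ?T ?G"
      by (intro add_mono torus.L1_le_L2_norm L2_Cauchy_Schwarz dh D dg df L)
    also have "\<dots> \<le> ?h r + (?f r + L2_norm ?T ?F) * ?g r + ?f r * L2_norm ?T ?G"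
      using L2_norm_triangle[OF df L(1)] by (intro add_mono mult_right_mono order_refl) (auto simp: L2_norm_nonneg)
    finally show ?case .
  qed
  ultimately have "(\<integral>\<zeta>. cmod (?H \<zeta> - ?F \<zeta> * ?G \<zeta>) \<partial>?T) \<le> 0"
    using tendsto_lowerbound[of _ "0 + (0 + L2_norm ?T ?F) * 0 + 0 * L2_norm ?T ?G" "at_left (1::real)"] by fastforce
  then have "(\<integral>\<zeta>. cmod (?H \<zeta> - ?F \<zeta> * ?G \<zeta>) \<partial>?T) = 0"
    by (simp add: antisym)
  then have "AE \<zeta> in ?T. cmod (?H \<zeta> - ?F \<zeta> * ?G \<zeta>) = 0"
    using int by (subst (asm) integral_nonneg_eq_0_iff_AE) auto
  then show ?thesis by simp
qed

lemma boundary_values_one_minus: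
  assumes f: "f \<in> hardy_space"
  shows "AE \<zeta> in torus_measure. boundary_values (\<lambda>z. 1 - c * f z) \<zeta> = 1 - c * boundary_values f \<zeta>"
proof (rule boundary_function_unique)
  have hol: "hol2 (\<lambda>z. 1 - c * f z)" by (intro hol2_diff hol2_mult hol2_const hardy_space_hol2 f)
  then show "hol2 (\<lambda>z. 1 - c * f z)" .
  have one: "(\<lambda>x. 1) \<in> L2 torus_measure" by (simp add: L2_def)
  have "((\<lambda>r. cmod (- c) * L2_norm torus_measure (\<lambda>\<zeta>. f (r *\<^sub>R \<zeta>) - boundary_values f \<zeta>)) \<longlongrightarrow> cmod (- c) * 0) (at_left 1)"
    by (intro tendsto_intros boundary_values_tendsto f)
  then show bf: "boundary_function (\<lambda>z. 1 - c * f z) (\<lambda>\<zeta>. 1 - c * boundary_values f \<zeta>)"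
    unfolding boundary_function_def L2_norm_cmult[symmetric]
    by (auto simp: algebra_simps intro!: L2_diff[OF one L2_cmult] boundary_values_L2 f)
  then have "\<exists>F. boundary_function (\<lambda>z. 1 - c * f z) F" by blast
  then show "boundary_function (\<lambda>z. 1 - c * f z) (boundary_values (\<lambda>z. 1 - c * f z))"
    unfolding boundary_values_def[of "\<lambda>z. 1 - c * f z"] by (rule someI_ex)
qed

text \<open>The indices are pairs of naturals. For a general L2 function this is only the part of
  its Fourier series that the orthogonal projection onto the Hardy space keeps.\<close>

definition Fourier :: "(complex \<times> complex \<Rightarrow> complex) \<Rightarrow> nat \<times> nat \<Rightarrow> complex" where
  "Fourier E n = (\<integral>\<zeta>. E \<zeta> * cnj (monom2 n \<zeta>) \<partial>torus_measure)"

lemma monom2_L2: "monom2 n \<in> L2 torus_measure"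
  by (intro L2_I borel_measurable_torus_continuous torus_integrable_continuous continuous_intros)

text \<open>For the partial sum \<open>P\<close> the pairing of \<open>E\<close> with
  \<open>P\<close> equals the squared norm of \<open>P\<close>, and Cauchy-Schwarz then bounds the
  norm of \<open>P\<close> by that of \<open>E\<close>.\<close>

lemma Bessel:
  assumes E: "E \<in> L2 torus_measure" and X: "finite X"
  shows "(\<Sum>n\<in>X. (cmod (Fourier E n))\<^sup>2) \<le> (L2_norm torus_measure E)\<^sup>2"
proof -
  let ?T = torus_measure
  define P where "P \<zeta> = (\<Sum>n\<in>X. Fourier E n * monom2 n \<zeta>)" for \<zeta>
  let ?s = "\<Sum>n\<in>X. (cmod (Fourier E n))\<^sup>2"
  have Pc: "continuous_on torus P" unfolding P_def by (intro continuous_intros)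
  have PL: "P \<in> L2 ?T"
    by (intro L2_I borel_measurable_torus_continuous torus_integrable_continuous continuous_intros Pc)
  have expand: "(\<integral>\<zeta>. G \<zeta> * cnj (P \<zeta>) \<partial>?T) = (\<Sum>n\<in>X. cnj (Fourier E n) * Fourier G n)"
    if G: "G \<in> L2 ?T" for G
  proof -
    have "(\<integral>\<zeta>. G \<zeta> * cnj (P \<zeta>) \<partial>?T) = (\<integral>\<zeta>. (\<Sum>n\<in>X. cnj (Fourier E n) * (G \<zeta> * cnj (monom2 n \<zeta>))) \<partial>?T)"
      by (simp add: P_def sum_distrib_left ac_simps)
    also have "\<dots> = (\<Sum>n\<in>X. cnj (Fourier E n) * Fourier G n)"
      unfolding Fourier_def using L2_mult_integrable[OF G monom2_L2]
      by (subst Bochner_Integration.integral_sum) auto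
    finally show ?thesis .
  qed
  have FP: "Fourier P n = Fourier E n" if "n \<in> X" for n
  proof -
    have "Fourier P n = (\<integral>\<zeta>. (\<Sum>m\<in>X. Fourier E m * (monom2 m \<zeta> * cnj (monom2 n \<zeta>))) \<partial>?T)"
      unfolding Fourier_def[of P] by (simp add: P_def sum_distrib_right mult.assoc)
    also have "\<dots> = (\<Sum>m\<in>X. Fourier E m * (\<integral>\<zeta>. monom2 m \<zeta> * cnj (monom2 n \<zeta>) \<partial>?T))"
      using L2_mult_integrable[OF monom2_L2 monom2_L2]
      by (subst Bochner_Integration.integral_sum) auto
    also have "\<dots> = Fourier E n"
      using X that by (simp add: integral_monom2_orthonormal if_distrib[of "\<lambda>x. _ * x"] cong: if_cong)
    finally show ?thesis .
  qed
  have s: "(\<Sum>n\<in>X. cnj (Fourier E n) * Fourier E n) = of_real ?s"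
    by (simp add: complex_norm_square[symmetric] mult.commute[of "cnj _"] del: of_real_power)
  have "of_real ((L2_norm ?T P)\<^sup>2) = (\<integral>\<zeta>. P \<zeta> * cnj (P \<zeta>) \<partial>?T)"
    unfolding L2_norm_sq integral_complex_of_real[symmetric] complex_norm_square ..
  also have "\<dots> = of_real ?s" using expand[OF PL] FP s by simp
  finally have Ps: "(L2_norm ?T P)\<^sup>2 = ?s" using of_real_eq_iff by blast
  have "?s = cmod (\<integral>\<zeta>. E \<zeta> * cnj (P \<zeta>) \<partial>?T)"
    unfolding expand[OF E] s by (simp only: norm_of_real) (simp add: sum_nonneg)
  also have "\<dots> \<le> L2_norm ?T E * L2_norm ?T P" by (rule L2_inner_bound[OF E PL])
  finally have "L2_norm ?T P * L2_norm ?T P \<le> L2_norm ?T E * L2_norm ?T P"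
    using Ps by (simp add: power2_eq_square)
  then have "L2_norm ?T P \<le> L2_norm ?T E"
    using L2_norm_nonneg[of ?T P] L2_norm_nonneg[of ?T E] by (cases "L2_norm ?T P = 0") auto
  then have "(L2_norm ?T P)\<^sup>2 \<le> (L2_norm ?T E)\<^sup>2" by (intro power_mono L2_norm_nonneg)
  then show ?thesis using Ps by simp
qed

lemma Fourier_square_summable:
  assumes "E \<in> L2 torus_measure"
  shows "(\<lambda>n. (cmod (Fourier E n))\<^sup>2) summable_on UNIV"
  by (rule nonneg_bdd_above_summable_on)
     (auto intro!: bdd_aboveI[of _ "(L2_norm torus_measure E)\<^sup>2"] Bessel assms)

lemma square_summable_mult:
  fixes a b :: "'i \<Rightarrow> complex"
  assumes "(\<lambda>n. (cmod (a n))\<^sup>2) summable_on A" "(\<lambda>n. (cmod (b n))\<^sup>2) summable_on A"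
  shows "(\<lambda>n. cmod (a n) * cmod (b n)) summable_on A"
proof (rule summable_on_comparison_test[OF summable_on_add[OF assms]])
  show "cmod (a n) * cmod (b n) \<le> (cmod (a n))\<^sup>2 + (cmod (b n))\<^sup>2" for n
    using sum_squares_bound[of "cmod (a n)" "cmod (b n)"] mult_nonneg_nonneg[OF norm_ge_zero norm_ge_zero, of "a n" "b n"]
    by linarith
qed simp

lemma L2_inner_tendsto_boundary_values:
  assumes E: "E \<in> L2 torus_measure" and h: "h \<in> hardy_space"
  shows "((\<lambda>r. \<integral>\<zeta>. E \<zeta> * cnj (h (r *\<^sub>R \<zeta>)) \<partial>torus_measure)
    \<longlongrightarrow> (\<integral>\<zeta>. E \<zeta> * cnj (boundary_values h \<zeta>) \<partial>torus_measure)) (at_left 1)"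
proof -
  let ?T = torus_measure
  note hL = boundary_values_L2[OF h]
  have "((\<lambda>r. (\<integral>\<zeta>. E \<zeta> * cnj (h (r *\<^sub>R \<zeta>)) \<partial>?T) - (\<integral>\<zeta>. E \<zeta> * cnj (boundary_values h \<zeta>) \<partial>?T)) \<longlongrightarrow> 0) (at_left 1)"
  proof (rule Lim_null_comparison)
    have "((\<lambda>r. L2_norm ?T E * L2_norm ?T (\<lambda>\<zeta>. h (r *\<^sub>R \<zeta>) - boundary_values h \<zeta>)) \<longlongrightarrow> L2_norm ?T E * 0) (at_left 1)"
      by (intro tendsto_intros boundary_values_tendsto h)
    then show "((\<lambda>r. L2_norm ?T E * L2_norm ?T (\<lambda>\<zeta>. h (r *\<^sub>R \<zeta>) - boundary_values h \<zeta>)) \<longlongrightarrow> 0) (at_left 1)"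
      by simp
    show "\<forall>\<^sub>F r in at_left 1. norm ((\<integral>\<zeta>. E \<zeta> * cnj (h (r *\<^sub>R \<zeta>)) \<partial>?T) - (\<integral>\<zeta>. E \<zeta> * cnj (boundary_values h \<zeta>) \<partial>?T))
        \<le> L2_norm ?T E * L2_norm ?T (\<lambda>\<zeta>. h (r *\<^sub>R \<zeta>) - boundary_values h \<zeta>)"
      using eventually_at_left_1
    proof eventually_elim
      case (elim r)
      then have D: "(\<lambda>\<zeta>. h (r *\<^sub>R \<zeta>)) \<in> L2 ?T" by (intro dilation_L2 hardy_space_hol2 h) auto
      have "(\<integral>\<zeta>. E \<zeta> * cnj (h (r *\<^sub>R \<zeta>)) \<partial>?T) - (\<integral>\<zeta>. E \<zeta> * cnj (boundary_values h \<zeta>) \<partial>?T)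
          = (\<integral>\<zeta>. E \<zeta> * cnj (h (r *\<^sub>R \<zeta>) - boundary_values h \<zeta>) \<partial>?T)"
        using L2_mult_integrable[OF E D] L2_mult_integrable[OF E hL]
        by (subst Bochner_Integration.integral_diff[symmetric]) (auto simp: algebra_simps)
      then show ?case using L2_inner_bound[OF E L2_diff[OF D hL]] by simp
    qed
  qed
  then show ?thesis by (simp add: LIM_zero_iff)
qed

text \<open>Parseval between an arbitrary L2 function and a Hardy function. For r < 1 the identity
  is termwise integration; as r tends to 1 the series converges by its summable majorant, and the
  integral by L2 convergence of the dilations.\<close>

lemma L2_inner_boundary_values_has_sum:
  assumes E: "E \<in> L2 torus_measure" and h: "hardy_coeffs h b"
  shows "((\<lambda>n. Fourier E n * cnj (b n)) has_sum (\<integral>\<zeta>. E \<zeta> * cnj (boundary_values h \<zeta>) \<partial>torus_measure)) UNIV"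
proof -
  let ?T = torus_measure
  have hs: "bidisc_series h b" and sq: "(\<lambda>n. (cmod (b n))\<^sup>2) summable_on UNIV"
    using h by (auto simp: hardy_coeffs_iff)
  have hh: "h \<in> hardy_space" using h by (auto simp: hardy_space_def)
  note su = square_summable_mult[OF Fourier_square_summable[OF E] sq]
  define I where "I r = (\<Sum>\<^sub>\<infinity>n. Fourier E n * cnj (b n) * of_real r ^ deg n)" for r
  have "continuous_on {0..1} I"
    unfolding I_def
  proof (rule continuous_on_infsum[OF _ _ su])
    show "norm (Fourier E n * cnj (b n) * of_real r ^ deg n) \<le> cmod (Fourier E n) * cmod (b n)" if "r \<in> {0..1}" for n r
      using that by (auto simp: norm_mult norm_power power_le_one intro!: mult_left_le)
  qed (intro continuous_intros)
  from continuous_on_tendsto_at_left[OF this] have "(I \<longlongrightarrow> I 1) (at_left 1)" by simp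
  moreover have "\<forall>\<^sub>F r in at_left 1. I r = (\<integral>\<zeta>. E \<zeta> * cnj (h (r *\<^sub>R \<zeta>)) \<partial>?T)"
    using eventually_at_left_1
  proof eventually_elim
    case (elim r)
    have "integrable ?T (\<lambda>\<zeta>. cnj (E \<zeta>))" using torus.L1_le_L2_norm(1)[OF E] by simp
    from has_sum_bounded_linear[OF bounded_linear_cnj series_torus_integral[OF this hs]] elim
    have "((\<lambda>n. cnj (b n * of_real r ^ deg n * (\<integral>\<zeta>. cnj (E \<zeta>) * monom2 n \<zeta> \<partial>?T))) has_sum
       cnj (\<integral>\<zeta>. cnj (E \<zeta>) * h (r *\<^sub>R \<zeta>) \<partial>?T)) UNIV" by blast
    moreover have "cnj (b n * of_real r ^ deg n * (\<integral>\<zeta>. cnj (E \<zeta>) * monom2 n \<zeta> \<partial>?T))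
        = Fourier E n * cnj (b n) * of_real r ^ deg n" for n
      by (simp add: Fourier_def ac_simps flip: Bochner_Integration.integral_cnj)
    moreover have "cnj (\<integral>\<zeta>. cnj (E \<zeta>) * h (r *\<^sub>R \<zeta>) \<partial>?T) = (\<integral>\<zeta>. E \<zeta> * cnj (h (r *\<^sub>R \<zeta>)) \<partial>?T)"
      by (simp flip: Bochner_Integration.integral_cnj)
    ultimately show ?case unfolding I_def by (intro infsumI) (simp only:)
  qed
  ultimately have "((\<lambda>r. \<integral>\<zeta>. E \<zeta> * cnj (h (r *\<^sub>R \<zeta>)) \<partial>?T) \<longlongrightarrow> I 1) (at_left 1)"
    by (rule Lim_transform_eventually)
  with L2_inner_tendsto_boundary_values[OF E hh]
  have eq: "(\<integral>\<zeta>. E \<zeta> * cnj (boundary_values h \<zeta>) \<partial>?T) = I 1"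
    by (intro tendsto_unique[of "at_left (1::real)"]) auto
  have "(\<lambda>n. Fourier E n * cnj (b n)) summable_on UNIV"
    using su by (simp add: summable_on_iff_abs_summable_on_complex norm_mult)
  then show ?thesis unfolding eq I_def by simp
qed

lemma Fourier_boundary_values:
  assumes f: "hardy_coeffs f a"
  shows "Fourier (boundary_values f) n = a n"
proof -
  have fs: "bidisc_series f a" and fh: "f \<in> hardy_space"
    using f by (auto simp: hardy_coeffs_iff hardy_space_def)
  have "((\<lambda>r. a n * of_real r ^ deg n) \<longlongrightarrow> a n * of_real 1 ^ deg n) (at_left 1)"
    by (intro tendsto_intros)
  moreover have "\<forall>\<^sub>F r in at_left 1. a n * of_real r ^ deg n = cnj (\<integral>\<zeta>. monom2 n \<zeta> * cnj (f (r *\<^sub>R \<zeta>)) \<partial>torus_measure)"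
    using eventually_at_left_1
    by eventually_elim
       (simp add: dilation_Fourier_coeff[OF fs, symmetric] mult.commute flip: Bochner_Integration.integral_cnj)
  ultimately have "((\<lambda>r. cnj (\<integral>\<zeta>. monom2 n \<zeta> * cnj (f (r *\<^sub>R \<zeta>)) \<partial>torus_measure)) \<longlongrightarrow> a n) (at_left 1)"
    using Lim_transform_eventually by fastforce
  moreover have "((\<lambda>r. cnj (\<integral>\<zeta>. monom2 n \<zeta> * cnj (f (r *\<^sub>R \<zeta>)) \<partial>torus_measure)) \<longlongrightarrow>
       cnj (\<integral>\<zeta>. monom2 n \<zeta> * cnj (boundary_values f \<zeta>) \<partial>torus_measure)) (at_left 1)"
    by (intro tendsto_cnj L2_inner_tendsto_boundary_values monom2_L2 fh)
  ultimately have "a n = cnj (\<integral>\<zeta>. monom2 n \<zeta> * cnj (boundary_values f \<zeta>) \<partial>torus_measure)"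
    by (intro tendsto_unique[of "at_left (1::real)"]) auto
  then show ?thesis by (simp add: Fourier_def mult.commute flip: Bochner_Integration.integral_cnj)
qed

text \<open>Orthogonality in \<open>model_space\<close> is defined through Taylor coefficients; as
  an integral over the torus it can exploit the unimodularity of \<phi> there.\<close>

lemma hardy_inner_eq_integral:
  assumes f: "f \<in> hardy_space" and g: "g \<in> hardy_space"
  shows "hardy_inner f g = (\<integral>\<zeta>. boundary_values f \<zeta> * cnj (boundary_values g \<zeta>) \<partial>torus_measure)"
  using infsumI[OF L2_inner_boundary_values_has_sum[OF boundary_values_L2[OF f] hardy_coeffs_taylor[OF g]]]
  by (simp add: hardy_inner_def Fourier_boundary_values[OF hardy_coeffs_taylor[OF f]])

lemma hardy_coeffs_norm_has_sum:
  assumes f: "hardy_coeffs f a"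
  shows "((\<lambda>n. (cmod (a n))\<^sup>2) has_sum (L2_norm torus_measure (boundary_values f))\<^sup>2) UNIV"
proof -
  have fh: "f \<in> hardy_space" using f by (auto simp: hardy_space_def)
  have "((\<lambda>n. a n * cnj (a n)) has_sum (\<integral>\<zeta>. boundary_values f \<zeta> * cnj (boundary_values f \<zeta>) \<partial>torus_measure)) UNIV"
    using L2_inner_boundary_values_has_sum[OF boundary_values_L2[OF fh] f] by (simp add: Fourier_boundary_values[OF f])
  then have "((\<lambda>n. complex_of_real ((cmod (a n))\<^sup>2)) has_sum of_real ((L2_norm torus_measure (boundary_values f))\<^sup>2)) UNIV"
    unfolding L2_norm_sq integral_complex_of_real[symmetric] complex_norm_square .
  then show ?thesis using has_sum_of_real_iff by blast
qed

lemma hardy_coeffs_szego_kernel: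
  assumes "w \<in> bidisc"
  shows "hardy_coeffs (szego_kernel w) (\<lambda>n. cnj (monom2 n w))"
proof -
  have "bidisc_series (szego_kernel w) (\<lambda>n. cnj (monom2 n w))"
    using szego_kernel_has_sum[OF assms] by (simp add: bidisc_series_def bidisc_iff)
  moreover have "(\<lambda>n. (cmod (monom2 n w))\<^sup>2) summable_on UNIV"
  proof (rule summable_on_comparison_test[OF summable_norm_monom2[OF assms]])
    show "(cmod (monom2 n w))\<^sup>2 \<le> cmod (monom2 n w)" for n
      using assms norm_monom2_le[of w 1 n] by (simp add: power2_eq_square bidisc_iff mult_left_le)
  qed simp
  ultimately show ?thesis by (simp add: hardy_coeffs_iff)
qed

text \<open>Integration against Szego kernels realises the Riesz projection: it keeps the Fourier
  coefficients with nonnegative indices and sums them as a power series.\<close>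

lemma hardy_coeffs_Riesz:
  assumes E: "E \<in> L2 torus_measure"
  shows "hardy_coeffs (\<lambda>w. \<integral>\<zeta>. E \<zeta> * cnj (boundary_values (szego_kernel w) \<zeta>) \<partial>torus_measure) (Fourier E)"
  using L2_inner_boundary_values_has_sum[OF E hardy_coeffs_szego_kernel] Fourier_square_summable[OF E]
  by (simp add: hardy_coeffs_iff bidisc_series_def)

lemma Szego_reproducing:
  assumes f: "f \<in> hardy_space" and w: "w \<in> bidisc"
  shows "(\<integral>\<zeta>. boundary_values f \<zeta> * cnj (boundary_values (szego_kernel w) \<zeta>) \<partial>torus_measure) = f w"
proof -
  note fc = hardy_coeffs_taylor[OF f]
  have "((\<lambda>n. taylor_coeffs f n * monom2 n w) has_sum f w) UNIV"
    using fc w by (simp add: hardy_coeffs_iff bidisc_series_def)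
  moreover have "((\<lambda>n. taylor_coeffs f n * monom2 n w) has_sum
      (\<integral>\<zeta>. boundary_values f \<zeta> * cnj (boundary_values (szego_kernel w) \<zeta>) \<partial>torus_measure)) UNIV"
    using L2_inner_boundary_values_has_sum[OF boundary_values_L2[OF f] hardy_coeffs_szego_kernel[OF w]]
    by (simp add: Fourier_boundary_values[OF fc])
  ultimately show ?thesis by (metis has_sum_unique)
qed


subsection \<open>Inner functions and reproducing kernels\<close>

lemma hol2_cong: "(\<And>z. z \<in> bidisc \<Longrightarrow> f z = g z) \<Longrightarrow> hol2 f \<longleftrightarrow> hol2 g"
  unfolding hol2_def
  by (intro conj_cong continuous_on_cong ball_cong holomorphic_cong refl) (auto simp: bidisc_def)

lemma holomorphic_bidisc_hol2:
  assumes "holomorphic_bidisc f"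
  shows "hol2 f"
  unfolding hol2_def
proof (intro conjI ballI)
  show "continuous_on bidisc f"
    using assms unfolding holomorphic_bidisc_def
    by (meson continuous_at_imp_continuous_on has_derivative_continuous)
  fix w :: complex assume w: "w \<in> ball 0 1"
  have "(\<lambda>u. f (u, w)) field_differentiable (at u)" "(\<lambda>u. f (w, u)) field_differentiable (at u)"
    if u: "u \<in> ball 0 1" for u
  proof -
    have "(u, w) \<in> bidisc" "(w, u) \<in> bidisc" using u w by (auto simp: bidisc_def)
    then obtain c d c' d' where D: "(f has_derivative (\<lambda>h. c * fst h + d * snd h)) (at (u, w))"
        "(f has_derivative (\<lambda>h. c' * fst h + d' * snd h)) (at (w, u))"
      using assms unfolding holomorphic_bidisc_def by blast
    have "((\<lambda>u. (u, w)) has_derivative (\<lambda>h. (h, 0))) (at u)" "((\<lambda>u. (w, u)) has_derivative (\<lambda>h. (0, h))) (at u)"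
      by (auto intro!: derivative_eq_intros)
    from has_derivative_compose[OF this(1) D(1)] has_derivative_compose[OF this(2) D(2)]
    show "(\<lambda>u. f (u, w)) field_differentiable (at u)" "(\<lambda>u. f (w, u)) field_differentiable (at u)"
      unfolding field_differentiable_def has_field_derivative_def by auto
  qed
  then show "(\<lambda>u. f (u, w)) holomorphic_on ball 0 1" "(\<lambda>u. f (w, u)) holomorphic_on ball 0 1"
    by (auto simp: holomorphic_on_def field_differentiable_at_within)
qed

lemma inner_function_hol2: "inner_function \<phi> \<Longrightarrow> hol2 \<phi>"
  by (simp add: inner_function_def holomorphic_bidisc_hol2)

text \<open>On a radius the distance to \<zeta>_j is exactly 1 - r, so the radius lies in every
  Stolz region; aperture 2 is one choice. The limit is taken within a punctured neighbourhood, hence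
  the check that the points differ from \<zeta>.\<close>

lemma nontangential_limit_radial:
  assumes L: "nontangential_limit f \<zeta> L" and \<zeta>: "\<zeta> \<in> torus"
  shows "(\<lambda>n. f (radius_seq n *\<^sub>R \<zeta>)) \<longlonglongrightarrow> L"
proof -
  let ?S = "stolz_region 2 (fst \<zeta>) \<times> stolz_region 2 (snd \<zeta>)"
  have lim: "(f \<longlongrightarrow> L) (at \<zeta> within ?S)" using L by (simp add: nontangential_limit_def)
  have "(\<lambda>n. radius_seq n *\<^sub>R \<zeta>) \<longlonglongrightarrow> 1 *\<^sub>R \<zeta>" by (intro tendsto_intros radius_seq_tendsto)
  moreover have "radius_seq n *\<^sub>R \<zeta> \<noteq> \<zeta>" for n
  proof -
    have "cmod (fst (radius_seq n *\<^sub>R \<zeta>)) < cmod (fst \<zeta>)"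
      using radius_seq_bounds[of n] \<zeta> by (simp add: torus_iff)
    then show ?thesis by (metis less_irrefl)
  qed
  moreover have "r *\<^sub>R x \<in> stolz_region 2 x" if "0 \<le> r" "r < 1" "cmod x = 1" for r x
  proof -
    have "x - r *\<^sub>R x = (1 - r) *\<^sub>R x" by (simp add: algebra_simps)
    then have "cmod (x - r *\<^sub>R x) = 1 - r" using that by simp
    then show ?thesis using that by (simp add: stolz_region_def)
  qed
  then have "radius_seq n *\<^sub>R \<zeta> \<in> ?S" for n
    using radius_seq_bounds[of n] \<zeta> by (simp add: mem_Times_iff torus_iff)
  ultimately have "filterlim (\<lambda>n. radius_seq n *\<^sub>R \<zeta>) (at \<zeta> within ?S) sequentially"
    by (simp add: filterlim_at always_eventually)
  from filterlim_compose[OF lim this] show ?thesis .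
qed

lemma inner_function_radial_limit:
  assumes "inner_function \<phi>"
  shows "AE \<zeta> in torus_measure. \<exists>L. (\<lambda>n. \<phi> (radius_seq n *\<^sub>R \<zeta>)) \<longlonglongrightarrow> L \<and> cmod L = 1"
proof -
  have "AE \<zeta> in torus_measure. \<exists>L. nontangential_limit \<phi> \<zeta> L \<and> cmod L = 1"
    using assms by (simp add: inner_function_def)
  then show ?thesis
    using AE_space by eventually_elim (auto intro: nontangential_limit_radial)
qed

text \<open>Applying the Cauchy formula to \<open>\<phi> ^ n\<close> bounds \<open>\<bar>\<phi> z\<bar> ^ n\<close> by a constant that does not depend
  on \<open>n\<close>.\<close>

lemma inner_function_norm_le_1:
  assumes inner: "inner_function \<phi>" and z: "z \<in> bidisc"
  shows "cmod (\<phi> z) \<le> 1"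
proof -
  let ?T = torus_measure
  note hol = inner_function_hol2[OF inner]
  obtain B where B: "\<And>z. z \<in> bidisc \<Longrightarrow> cmod (\<phi> z) \<le> B"
    using inner by (auto simp: inner_function_def bounded_iff)
  have kc: "continuous_on torus (szego_kernel z)" by (rule continuous_on_szego_kernel[OF z])
  have "compact torus" by (simp add: torus_def compact_Times)
  with kc have "bounded (szego_kernel z ` torus)" using compact_continuous_image compact_imp_bounded by blast
  then obtain K where K: "\<And>\<zeta>. \<zeta> \<in> torus \<Longrightarrow> cmod (szego_kernel z \<zeta>) \<le> K" by (auto simp: bounded_iff)
  \<comment> \<open>Writing the limit with \<open>lim\<close> makes it measurable; the definition of
    an inner function only asserts, for almost every \<zeta>, that some limit exists.\<close>
  define L where "L \<zeta> = lim (\<lambda>i. \<phi> (radius_seq i *\<^sub>R \<zeta>))" for \<zeta>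
  have dil: "continuous_on torus (\<lambda>\<zeta>. \<phi> (radius_seq i *\<^sub>R \<zeta>))" for i
    by (rule hol2_continuous_dilation[OF hol radius_seq_bounds])
  note [measurable] = borel_measurable_torus_continuous[OF dil] borel_measurable_torus_continuous[OF kc]
  have [measurable]: "L \<in> borel_measurable ?T"
    unfolding L_def by (rule borel_measurable_lim_metric) measurable
  have AEL: "AE \<zeta> in ?T. (\<lambda>n. \<phi> (radius_seq n *\<^sub>R \<zeta>)) \<longlonglongrightarrow> L \<zeta> \<and> cmod (L \<zeta>) = 1"
    using inner_function_radial_limit[OF inner]
  proof eventually_elim
    case (elim \<zeta>)
    then show ?case unfolding L_def by (metis limI)
  qed
  have [measurable]: "(\<lambda>\<zeta>. cnj (szego_kernel z \<zeta>)) \<in> borel_measurable ?T"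
    by (intro borel_measurable_torus_continuous continuous_intros kc)
  have pow: "cmod (\<phi> z) ^ n \<le> K" for n
  proof -
    have "(\<lambda>i. \<integral>\<zeta>. \<phi> (radius_seq i *\<^sub>R \<zeta>) ^ n * cnj (szego_kernel z \<zeta>) \<partial>?T)
       \<longlonglongrightarrow> (\<integral>\<zeta>. L \<zeta> ^ n * cnj (szego_kernel z \<zeta>) \<partial>?T)"
    proof (rule integral_dominated_convergence[where w = "\<lambda>_. B ^ n * K"])
      show "AE \<zeta> in ?T. (\<lambda>i. \<phi> (radius_seq i *\<^sub>R \<zeta>) ^ n * cnj (szego_kernel z \<zeta>)) \<longlonglongrightarrow> L \<zeta> ^ n * cnj (szego_kernel z \<zeta>)"
        using AEL by eventually_elim (auto intro!: tendsto_intros)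
      show "AE \<zeta> in ?T. norm (\<phi> (radius_seq i *\<^sub>R \<zeta>) ^ n * cnj (szego_kernel z \<zeta>)) \<le> B ^ n * K" for i
      proof (rule AE_I2)
        fix \<zeta> assume "\<zeta> \<in> space ?T"
        then have \<zeta>: "\<zeta> \<in> torus" by simp
        have "cmod (\<phi> (radius_seq i *\<^sub>R \<zeta>)) \<le> B"
          by (intro B scaleR_torus_in_bidisc \<zeta> radius_seq_bounds)
        then show "norm (\<phi> (radius_seq i *\<^sub>R \<zeta>) ^ n * cnj (szego_kernel z \<zeta>)) \<le> B ^ n * K"
          using K[OF \<zeta>] order_trans[OF norm_ge_zero B[OF z]]
          by (auto simp: norm_mult norm_power intro!: mult_mono power_mono)
      qed
    qed auto
    moreover have "(\<integral>\<zeta>. \<phi> (radius_seq i *\<^sub>R \<zeta>) ^ n * cnj (szego_kernel z \<zeta>) \<partial>?T) = \<phi> (radius_seq i *\<^sub>R z) ^ n" for i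
      by (rule Cauchy_torus[OF hol2_power[OF hol] radius_seq_bounds z])
    moreover have "(\<lambda>i. \<phi> (radius_seq i *\<^sub>R z) ^ n) \<longlonglongrightarrow> \<phi> (1 *\<^sub>R z) ^ n"
    proof (intro tendsto_power isCont_tendsto_compose[of _ \<phi>] tendsto_scaleR radius_seq_tendsto tendsto_const)
      show "isCont \<phi> (1 *\<^sub>R z)"
        using hol z open_bidisc by (auto simp: hol2_def continuous_on_eq_continuous_at)
    qed
    ultimately have "\<phi> z ^ n = (\<integral>\<zeta>. L \<zeta> ^ n * cnj (szego_kernel z \<zeta>) \<partial>?T)"
      using LIMSEQ_unique by fastforce
    then have "cmod (\<phi> z) ^ n \<le> (\<integral>\<zeta>. cmod (L \<zeta> ^ n * cnj (szego_kernel z \<zeta>)) \<partial>?T)"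
      by (metis integral_norm_bound norm_power)
    also have "\<dots> \<le> K"
    proof (rule torus.integral_le_const)
      have AEK: "AE \<zeta> in ?T. cmod (L \<zeta> ^ n * cnj (szego_kernel z \<zeta>)) \<le> K"
        using AEL AE_space by eventually_elim (auto simp: norm_mult norm_power K)
      then show "AE \<zeta> in ?T. cmod (L \<zeta> ^ n * cnj (szego_kernel z \<zeta>)) \<le> K" .
      show "integrable ?T (\<lambda>\<zeta>. cmod (L \<zeta> ^ n * cnj (szego_kernel z \<zeta>)))"
        by (rule torus.integrable_const_bound[where B = K]) (use AEK in auto)
    qed
    finally show ?thesis .
  qed
  show ?thesis
  proof (rule ccontr)
    assume "\<not> cmod (\<phi> z) \<le> 1"
    then obtain n where "K < cmod (\<phi> z) ^ n" using real_arch_pow[of "cmod (\<phi> z)" K] by auto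
    with pow[of n] show False by simp
  qed
qed

lemma inner_function_hardy: "inner_function \<phi> \<Longrightarrow> \<phi> \<in> hardy_space"
  by (rule hardy_space_bounded[where B = 1]) (simp_all add: inner_function_hol2 inner_function_norm_le_1)

section \<open>Moduli of boundary functions\<close>

lemma boundary_values_AE_subseq:
  assumes f: "f \<in> hardy_space"
  obtains r :: "nat \<Rightarrow> nat" where "strict_mono r"
    "AE \<zeta> in torus_measure. (\<lambda>n. f (radius_seq (r n) *\<^sub>R \<zeta>)) \<longlonglongrightarrow> boundary_values f \<zeta>"
proof -
  have "\<exists>r::nat\<Rightarrow>nat. strict_mono r \<and>
      (AE \<zeta> in torus_measure. (\<lambda>n. f (radius_seq (r n) *\<^sub>R \<zeta>) - boundary_values f \<zeta>) \<longlonglongrightarrow> 0)"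
  proof (rule torus.L2_norm_tendsto_0_AE_subseq)
    show "(\<lambda>\<zeta>. f (radius_seq n *\<^sub>R \<zeta>) - boundary_values f \<zeta>) \<in> L2 torus_measure" for n
      by (intro L2_diff dilation_L2 hardy_space_hol2 boundary_values_L2 f radius_seq_bounds)
    show "(\<lambda>n. L2_norm torus_measure (\<lambda>\<zeta>. f (radius_seq n *\<^sub>R \<zeta>) - boundary_values f \<zeta>)) \<longlonglongrightarrow> 0"
      by (rule filterlim_compose[OF boundary_values_tendsto[OF f] radius_seq_at_left])
  qed
  then show thesis using that by (auto simp: LIM_zero_iff)
qed

lemma boundary_values_bounded:
  assumes f: "f \<in> hardy_space" and B: "\<And>z. z \<in> bidisc \<Longrightarrow> cmod (f z) \<le> B"
  shows "AE \<zeta> in torus_measure. cmod (boundary_values f \<zeta>) \<le> B"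
proof -
  obtain r where "AE \<zeta> in torus_measure. (\<lambda>n. f (radius_seq (r n) *\<^sub>R \<zeta>)) \<longlonglongrightarrow> boundary_values f \<zeta>"
    by (rule boundary_values_AE_subseq[OF f])
  then show ?thesis
    using AE_space
  proof eventually_elim
    case (elim \<zeta>)
    then have "\<zeta> \<in> torus" by simp
    then have "cmod (f (radius_seq (r n) *\<^sub>R \<zeta>)) \<le> B" for n
      by (intro B scaleR_torus_in_bidisc radius_seq_bounds)
    then show ?case using LIMSEQ_le_const2[OF tendsto_norm[OF elim(1)]] by blast
  qed
qed

text \<open>The boundary function is an L2 limit, the unimodular one a radial limit. They agree
  almost everywhere because the L2 limit is attained pointwise along a subsequence of the same
  radii.\<close>

lemma inner_function_boundary_values:
  assumes "inner_function \<phi>"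
  shows "AE \<zeta> in torus_measure. cmod (boundary_values \<phi> \<zeta>) = 1"
proof -
  obtain r where r: "strict_mono r"
    and "AE \<zeta> in torus_measure. (\<lambda>n. \<phi> (radius_seq (r n) *\<^sub>R \<zeta>)) \<longlonglongrightarrow> boundary_values \<phi> \<zeta>"
    by (rule boundary_values_AE_subseq[OF inner_function_hardy[OF assms]])
  from this(2) inner_function_radial_limit[OF assms] show ?thesis
  proof eventually_elim
    case (elim \<zeta>)
    then obtain L where "(\<lambda>n. \<phi> (radius_seq n *\<^sub>R \<zeta>)) \<longlonglongrightarrow> L" "cmod L = 1" by blast
    from LIMSEQ_subseq_LIMSEQ[OF this(1) r] this(2) elim(1) show ?case
      using LIMSEQ_unique by (fastforce simp: o_def)
  qed
qed

section \<open>Reproducing kernels of the model space\<close>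

lemma inner_mult_hardy:
  assumes "inner_function \<phi>" "h \<in> hardy_space"
  shows "(\<lambda>z. \<phi> z * h z) \<in> hardy_space"
  by (rule hardy_space_bounded_mult[where B = 1]) (simp_all add: inner_function_hol2 inner_function_norm_le_1 assms)

lemma szego_kernel_hardy: "w \<in> bidisc \<Longrightarrow> szego_kernel w \<in> hardy_space"
  unfolding hardy_space_def using hardy_coeffs_szego_kernel by blast

lemma model_kernel_eq: "model_kernel \<phi> w = (\<lambda>z. (1 - cnj (\<phi> w) * \<phi> z) * szego_kernel w z)"
  by (simp add: fun_eq_iff model_kernel_def szego_kernel_def mult.commute)

lemma one_minus_inner_bounded:
  assumes "inner_function \<phi>"
  shows "hol2 (\<lambda>z. 1 - c * \<phi> z)" "z \<in> bidisc \<Longrightarrow> cmod (1 - c * \<phi> z) \<le> 1 + cmod c"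
proof -
  show "hol2 (\<lambda>z. 1 - c * \<phi> z)"
    by (intro hol2_diff hol2_mult hol2_const inner_function_hol2 assms)
  show "cmod (1 - c * \<phi> z) \<le> 1 + cmod c" if "z \<in> bidisc"
    using norm_triangle_ineq4[of 1 "c * \<phi> z"] mult_left_le[OF inner_function_norm_le_1[OF assms that], of "cmod c"]
    by (simp add: norm_mult)
qed

lemma model_kernel_hardy:
  assumes "inner_function \<phi>" "w \<in> bidisc"
  shows "model_kernel \<phi> w \<in> hardy_space"
  unfolding model_kernel_eq
  by (rule hardy_space_bounded_mult[OF one_minus_inner_bounded[OF assms(1)] szego_kernel_hardy[OF assms(2)]])

lemma boundary_values_model_kernel:
  assumes \<phi>: "inner_function \<phi>" and w: "w \<in> bidisc"
  shows "AE \<zeta> in torus_measure. boundary_values (model_kernel \<phi> w) \<zeta>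
     = (1 - cnj (\<phi> w) * boundary_values \<phi> \<zeta>) * boundary_values (szego_kernel w) \<zeta>"
proof -
  have "(\<lambda>z. 1 - cnj (\<phi> w) * \<phi> z) \<in> hardy_space"
    by (rule hardy_space_bounded[OF one_minus_inner_bounded[OF \<phi>]])
  from boundary_values_mult[OF this szego_kernel_hardy[OF w]] model_kernel_hardy[OF \<phi> w]
  have "AE \<zeta> in torus_measure. boundary_values (model_kernel \<phi> w) \<zeta>
     = boundary_values (\<lambda>z. 1 - cnj (\<phi> w) * \<phi> z) \<zeta> * boundary_values (szego_kernel w) \<zeta>"
    by (simp add: model_kernel_eq)
  with boundary_values_one_minus[OF inner_function_hardy[OF \<phi>], of "cnj (\<phi> w)"]
  show ?thesis by eventually_elim simp
qed

text \<open>Since \<phi> conj(\<phi>) = 1 on the torus, pairing the kernel with \<phi> h gives the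
  pairing of k_w with \<phi> h minus conj(\<phi>(w)) times the pairing of k_w with h. By the
  reproducing property both terms are conj(\<phi>(w) h(w)).\<close>

lemma model_kernel_in_model_space:
  assumes \<phi>: "inner_function \<phi>" and w: "w \<in> bidisc"
  shows "model_kernel \<phi> w \<in> model_space \<phi>"
  unfolding model_space_def
proof (intro CollectI conjI ballI)
  show K: "model_kernel \<phi> w \<in> hardy_space" by (rule model_kernel_hardy[OF \<phi> w])
  fix h assume h: "h \<in> hardy_space"
  let ?T = torus_measure
  note ph = inner_mult_hardy[OF \<phi> h] and k = szego_kernel_hardy[OF w]
  have rep: "(\<integral>\<zeta>. boundary_values (szego_kernel w) \<zeta> * cnj (boundary_values f \<zeta>) \<partial>?T) = cnj (f w)"
    if "f \<in> hardy_space" for f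
    using Szego_reproducing[OF that w] Bochner_Integration.integral_cnj[of ?T "\<lambda>\<zeta>. boundary_values f \<zeta> * cnj (boundary_values (szego_kernel w) \<zeta>)"]
    by (simp add: mult.commute)
  have "hardy_inner (model_kernel \<phi> w) (\<lambda>z. \<phi> z * h z)
      = (\<integral>\<zeta>. boundary_values (model_kernel \<phi> w) \<zeta> * cnj (boundary_values (\<lambda>z. \<phi> z * h z) \<zeta>) \<partial>?T)"
    by (rule hardy_inner_eq_integral[OF K ph])
  also have "\<dots> = (\<integral>\<zeta>. boundary_values (szego_kernel w) \<zeta> * cnj (boundary_values (\<lambda>z. \<phi> z * h z) \<zeta>)
       - cnj (\<phi> w) * (boundary_values (szego_kernel w) \<zeta> * cnj (boundary_values h \<zeta>)) \<partial>?T)"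
  proof (rule integral_cong_AE)
    note [measurable] = L2_D(1)[OF boundary_values_L2[OF K]] L2_D(1)[OF L2_cnj[OF boundary_values_L2[OF ph]]]
      L2_D(1)[OF boundary_values_L2[OF k]] L2_D(1)[OF L2_cnj[OF boundary_values_L2[OF h]]]
    show "(\<lambda>\<zeta>. boundary_values (model_kernel \<phi> w) \<zeta> * cnj (boundary_values (\<lambda>z. \<phi> z * h z) \<zeta>)) \<in> borel_measurable ?T"
      by measurable
    show "(\<lambda>\<zeta>. boundary_values (szego_kernel w) \<zeta> * cnj (boundary_values (\<lambda>z. \<phi> z * h z) \<zeta>)
       - cnj (\<phi> w) * (boundary_values (szego_kernel w) \<zeta> * cnj (boundary_values h \<zeta>))) \<in> borel_measurable ?T"
      by measurable
    show "AE \<zeta> in ?T. boundary_values (model_kernel \<phi> w) \<zeta> * cnj (boundary_values (\<lambda>z. \<phi> z * h z) \<zeta>)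
      = boundary_values (szego_kernel w) \<zeta> * cnj (boundary_values (\<lambda>z. \<phi> z * h z) \<zeta>)
       - cnj (\<phi> w) * (boundary_values (szego_kernel w) \<zeta> * cnj (boundary_values h \<zeta>))"
      using boundary_values_model_kernel[OF \<phi> w] boundary_values_mult[OF inner_function_hardy[OF \<phi>] h ph]
        inner_function_boundary_values[OF \<phi>]
    proof eventually_elim
      case (elim \<zeta>)
      have one: "boundary_values \<phi> \<zeta> * cnj (boundary_values \<phi> \<zeta>) = 1"
        using elim(3) complex_norm_square[of "boundary_values \<phi> \<zeta>"] by simp
      have "(1 - c * p) * k * (cp * ch) = k * (cp * ch) - c * (k * ch)" if "p * cp = 1" for c p k cp ch :: complex
      proof -
        have "(1 - c * p) * k * (cp * ch) = k * (cp * ch) - c * (k * ch) * (p * cp)" by (simp add: algebra_simps)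
        with that show ?thesis by simp
      qed
      from this[OF one] show ?case unfolding elim(1,2) complex_cnj_mult .
    qed
  qed
  also have "\<dots> = (\<integral>\<zeta>. boundary_values (szego_kernel w) \<zeta> * cnj (boundary_values (\<lambda>z. \<phi> z * h z) \<zeta>) \<partial>?T)
      - (\<integral>\<zeta>. cnj (\<phi> w) * (boundary_values (szego_kernel w) \<zeta> * cnj (boundary_values h \<zeta>)) \<partial>?T)"
    by (intro Bochner_Integration.integral_diff integrable_mult_right L2_mult_integrable boundary_values_L2 ph h k)
  also have "\<dots> = 0" using rep[OF ph] rep[OF h] by simp
  finally show "hardy_inner (model_kernel \<phi> w) (\<lambda>z. \<phi> z * h z) = 0" .
qed

section \<open>Functions of the second variable and the projection onto them\<close>

lemma has_sum_fst_0:
  fixes f :: "nat \<times> nat \<Rightarrow> 'a::{comm_monoid_add, topological_space}"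
  assumes "\<And>n. fst n \<noteq> 0 \<Longrightarrow> f n = 0"
  shows "(f has_sum s) UNIV \<longleftrightarrow> ((\<lambda>l. f (0, l)) has_sum s) UNIV"
proof -
  have "(f has_sum s) UNIV \<longleftrightarrow> (f has_sum s) (range (Pair 0))"
    by (rule has_sum_cong_neutral) (use assms in \<open>auto simp: image_iff\<close>)
  also have "\<dots> \<longleftrightarrow> ((\<lambda>l. f (0, l)) has_sum s) UNIV"
    by (subst has_sum_reindex) (auto simp: inj_on_def o_def)
  finally show ?thesis .
qed

text \<open>Replaces the one-variable description by a support condition on the two-variable
  coefficients; under it the projection is truncation to first index 0.\<close>

lemma hardy_z2D:
  assumes "h \<in> hardy_z2"
  obtains b where "hardy_coeffs h b" "\<And>n. fst n \<noteq> 0 \<Longrightarrow> b n = 0"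
proof -
  obtain g where g: "g \<in> hardy_disc" and hg: "\<forall>z\<in>bidisc. h z = g (snd z)"
    using assms unfolding hardy_z2_def by blast
  obtain c where c: "summable (\<lambda>l. (cmod (c l))\<^sup>2)" "\<forall>w\<in>ball 0 1. (\<lambda>l. c l * w ^ l) sums g w"
    using g unfolding hardy_disc_def by blast
  define b where "b n = (if fst n = 0 then c (snd n) else 0)" for n :: "nat \<times> nat"
  have "((\<lambda>l. (cmod (c l))\<^sup>2) has_sum (\<Sum>l. (cmod (c l))\<^sup>2)) UNIV"
    using c(1) by (intro norm_summable_imp_has_sum summable_sums) auto
  then have "((\<lambda>n. (cmod (b n))\<^sup>2) has_sum (\<Sum>l. (cmod (c l))\<^sup>2)) UNIV"
    by (subst has_sum_fst_0) (auto simp: b_def)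
  moreover have "((\<lambda>n. b n * monom2 n z) has_sum h z) UNIV" if z: "z \<in> bidisc" for z
  proof -
    have "cmod (snd z) < 1" using z by (simp add: bidisc_iff)
    \<comment> \<open>Convergence at the larger radius t makes the series at z_2 absolutely
      convergent, as needed to pass from \<open>sums\<close> to \<open>has_sum\<close>.\<close>
    then obtain t where t: "cmod (snd z) < t" "t < 1" using dense by blast
    then have t0: "0 \<le> t" using norm_ge_zero[of "snd z"] by linarith
    have "summable (\<lambda>l. c l * of_real t ^ l)" using bspec[OF c(2), of "of_real t"] t t0 by (auto simp: sums_iff)
    then have "summable (\<lambda>l. norm (c l * snd z ^ l))"
      by (rule powser_insidea) (use t t0 in auto)
    then have "((\<lambda>l. c l * snd z ^ l) has_sum h z) UNIV"
      using c(2) hg z by (intro norm_summable_imp_has_sum) (auto simp: bidisc_iff)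
    then show ?thesis
      by (subst has_sum_fst_0) (auto simp: b_def monom2_def)
  qed
  ultimately have "hardy_coeffs h b"
    by (auto simp: hardy_coeffs_iff bidisc_series_def summable_on_def)
  then show thesis by (rule that) (simp add: b_def)
qed

lemma hardy_z2_hardy_space:
  assumes "h \<in> hardy_z2"
  shows "h \<in> hardy_space"
proof -
  obtain b where "hardy_coeffs h b" by (rule hardy_z2D[OF assms])
  then show ?thesis unfolding hardy_space_def by blast
qed

lemma hardy_z2I:
  assumes h: "hardy_coeffs h b" and b: "\<And>n. fst n \<noteq> 0 \<Longrightarrow> b n = 0"
  shows "h \<in> hardy_z2"
proof -
  have hs: "((\<lambda>l. b (0, l) * w ^ l) has_sum h z) UNIV" if "z \<in> bidisc" "snd z = w" for z w
  proof -
    have "((\<lambda>n. b n * monom2 n z) has_sum h z) UNIV"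
      using h that by (simp add: hardy_coeffs_iff bidisc_series_def)
    then show ?thesis using that by (subst (asm) has_sum_fst_0) (auto simp: b monom2_def)
  qed
  obtain s where "((\<lambda>n. (cmod (b n))\<^sup>2) has_sum s) UNIV"
    using h by (auto simp: hardy_coeffs_iff summable_on_def)
  then have "((\<lambda>l. (cmod (b (0, l)))\<^sup>2) has_sum s) UNIV"
    by (subst (asm) has_sum_fst_0) (auto simp: b)
  then have "summable (\<lambda>l. (cmod (b (0, l)))\<^sup>2)"
    by (rule sums_summable[OF has_sum_imp_sums])
  moreover have "(\<lambda>l. b (0, l) * w ^ l) sums h (0, w)" if "w \<in> ball 0 1" for w
    using hs[of "(0, w)" w] that by (intro has_sum_imp_sums) (auto simp: bidisc_def)
  ultimately have "(\<lambda>w. h (0, w)) \<in> hardy_disc" by (auto simp: hardy_disc_def)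
  moreover have "h z = h (0, snd z)" if "z \<in> bidisc" for z
    by (rule has_sum_unique[OF hs[OF that refl] hs]) (use that in \<open>auto simp: bidisc_iff\<close>)
  ultimately show ?thesis unfolding hardy_z2_def by (intro CollectI bexI[of _ "\<lambda>w. h (0, w)"]) auto
qed

text \<open>Truncating the Fourier coefficients to first index 0 produces a witness for the
  \<open>SOME\<close> in the definition. The stated properties then hold for whichever function is
  chosen.\<close>

lemma proj_hardy_z2:
  assumes E: "E \<in> L2 torus_measure"
  shows "proj_hardy_z2 E \<in> hardy_z2"
    and "h \<in> hardy_z2 \<Longrightarrow>
      (\<integral>\<zeta>. (E \<zeta> - boundary_values (proj_hardy_z2 E) \<zeta>) * cnj (boundary_values h \<zeta>) \<partial>torus_measure) = 0"
proof -
  define e where "e n = (if fst n = 0 then Fourier E n else 0)" for n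
  have "(\<lambda>n. (cmod (e n))\<^sup>2) summable_on UNIV"
    by (rule summable_on_comparison_test[OF Fourier_square_summable[OF E]]) (auto simp: e_def)
  moreover define g where "g z = (\<Sum>\<^sub>\<infinity>n. e n * monom2 n z)" for z
  have "((\<lambda>n. e n * monom2 n z) has_sum g z) UNIV" if z: "z \<in> bidisc" for z
  proof -
    have "(\<lambda>n. cmod (Fourier E n) * cmod (cnj (monom2 n z))) summable_on UNIV"
      using square_summable_mult[OF Fourier_square_summable[OF E]] hardy_coeffs_szego_kernel[OF z]
      by (simp add: hardy_coeffs_iff)
    then have "(\<lambda>n. norm (e n * monom2 n z)) summable_on UNIV"
      by (rule summable_on_comparison_test) (auto simp: e_def norm_mult)
    then show ?thesis unfolding g_def by (rule has_sum_infsum[OF abs_summable_summable])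
  qed
  ultimately have g: "hardy_coeffs g e" by (auto simp: hardy_coeffs_iff bidisc_series_def)
  have gz: "g \<in> hardy_z2" by (rule hardy_z2I[OF g]) (simp add: e_def)
  have orth: "(\<integral>\<zeta>. (E \<zeta> - boundary_values g \<zeta>) * cnj (boundary_values h \<zeta>) \<partial>torus_measure) = 0"
    if hz: "h \<in> hardy_z2" for h
  proof -
    obtain b where b: "hardy_coeffs h b" "\<And>n. fst n \<noteq> 0 \<Longrightarrow> b n = 0" 
      by (rule hardy_z2D[OF hz]) (rule that)
    note gL = boundary_values_L2[OF hardy_z2_hardy_space[OF gz]]
    note hL = boundary_values_L2[OF hardy_z2_hardy_space[OF hz]]
    have "(\<lambda>n. Fourier E n * cnj (b n)) = (\<lambda>n. Fourier (boundary_values g) n * cnj (b n))"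
      using b(2) by (simp add: fun_eq_iff Fourier_boundary_values[OF g] e_def)
    with L2_inner_boundary_values_has_sum[OF E b(1)]
    have "((\<lambda>n. Fourier (boundary_values g) n * cnj (b n)) has_sum
        (\<integral>\<zeta>. E \<zeta> * cnj (boundary_values h \<zeta>) \<partial>torus_measure)) UNIV" by simp
    from has_sum_unique[OF this L2_inner_boundary_values_has_sum[OF gL b(1)]]
    have "(\<integral>\<zeta>. E \<zeta> * cnj (boundary_values h \<zeta>) \<partial>torus_measure)
        = (\<integral>\<zeta>. boundary_values g \<zeta> * cnj (boundary_values h \<zeta>) \<partial>torus_measure)" .
    then show ?thesis
      using L2_mult_integrable[OF E hL] L2_mult_integrable[OF gL hL] by (simp add: left_diff_distrib)
  qed
  have "\<exists>g. g \<in> hardy_z2 \<and> (\<forall>h\<in>hardy_z2.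
      L2_inner torus_measure (\<lambda>\<zeta>. E \<zeta> - boundary_values g \<zeta>) (boundary_values h) = 0)"
    unfolding L2_inner_def by (intro exI[of _ g] conjI gz ballI orth)
  then have "proj_hardy_z2 E \<in> hardy_z2 \<and> (\<forall>h\<in>hardy_z2.
      L2_inner torus_measure (\<lambda>\<zeta>. E \<zeta> - boundary_values (proj_hardy_z2 E) \<zeta>) (boundary_values h) = 0)"
    unfolding proj_hardy_z2_def by (rule someI_ex)
  then show "proj_hardy_z2 E \<in> hardy_z2" "h \<in> hardy_z2 \<Longrightarrow>
      (\<integral>\<zeta>. (E \<zeta> - boundary_values (proj_hardy_z2 E) \<zeta>) * cnj (boundary_values h \<zeta>) \<partial>torus_measure) = 0"
    unfolding L2_inner_def by simp_all
qed

lemma bidisc_series_slice0: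
  assumes "bidisc_series f a"
  shows "bidisc_series (\<lambda>z. f (0, snd z)) (\<lambda>n. if fst n = 0 then a n else 0)"
  unfolding bidisc_series_def
proof
  fix z assume "z \<in> bidisc"
  then have "((\<lambda>n. a n * monom2 n (0, snd z)) has_sum f (0, snd z)) UNIV"
    using assms by (auto simp: bidisc_series_def bidisc_iff)
  moreover have "(\<lambda>n. a n * monom2 n (0, snd z)) = (\<lambda>n. (if fst n = 0 then a n else 0) * monom2 n z)"
    by (auto simp: monom2_def fun_eq_iff)
  ultimately show "((\<lambda>n. (if fst n = 0 then a n else 0) * monom2 n z) has_sum f (0, snd z)) UNIV" by simp
qed

text \<open>On coefficients the operator lowers the first index by one, so the shifted series
  \<open>F\<close> supplies holomorphy. It agrees with the definition by division off z_1 = 0; on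
  z_1 = 0 the derivative of f(0, w) + u F(u, w) at u = 0 is F(0, w).\<close>

lemma hol2_backward_shift1:
  assumes "hol2 f"
  shows "hol2 (backward_shift1 f)" "z \<in> bidisc \<Longrightarrow> fst z * backward_shift1 f z = f z - f (0, snd z)"
proof -
  obtain a where a: "bidisc_series f a" using assms by (rule bidisc_series_exists)
  let ?S = "\<lambda>n::nat \<times> nat. (Suc (fst n), snd n)"
  have inj: "inj ?S" by (auto simp: inj_on_def prod_eq_iff)
  define F where "F z = (\<Sum>\<^sub>\<infinity>n. a (?S n) * monom2 n z)" for z
  have F: "bidisc_series F (\<lambda>n. a (?S n))"
    unfolding bidisc_series_def
  proof
    fix z assume z: "z \<in> bidisc"
    have "max 0 (max (cmod (fst z)) (cmod (snd z))) < 1" using z by (simp add: bidisc_iff)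
    then obtain r where r: "max 0 (max (cmod (fst z)) (cmod (snd z))) < r" "r < 1" using dense by blast
    then have "(\<lambda>n. cmod (a n) * r ^ deg n) summable_on UNIV"
      by (intro bidisc_series_abs_summable[OF a]) auto
    then have "(\<lambda>n. cmod (a n) * r ^ deg n) summable_on range ?S"
      by (rule summable_on_subset_banach) simp
    then have "(\<lambda>n. cmod (a (?S n)) * r ^ deg (?S n)) summable_on UNIV"
      by (subst (asm) summable_on_reindex[OF inj]) (simp add: o_def)
    \<comment> \<open>The shift raises the degree by one, and \<open>inverse r\<close> removes the
      surplus power; this is why r was also chosen positive.\<close>
    then have "(\<lambda>n. inverse r * (cmod (a (?S n)) * r ^ deg (?S n))) summable_on UNIV"
      by (rule summable_on_cmult_right)
    then have "(\<lambda>n. cmod (a (?S n)) * r ^ deg n) summable_on UNIV"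
      using r by (simp add: deg_def field_simps)
    then have "(\<lambda>n. norm (a (?S n) * monom2 n z)) summable_on UNIV"
      by (rule summable_on_comparison_test)
         (use r in \<open>auto simp: norm_mult intro!: mult_left_mono norm_monom2_le\<close>)
    then show "((\<lambda>n. a (?S n) * monom2 n z) has_sum F z) UNIV"
      unfolding F_def by (rule has_sum_infsum[OF abs_summable_summable])
  qed
  have split: "f z - f (0, snd z) = fst z * F z" if z: "z \<in> bidisc" for z
  proof -
    have "bidisc_series (\<lambda>z. f z - f (0, snd z)) (\<lambda>n. a n - (if fst n = 0 then a n else 0))"
      by (intro bidisc_series_diff bidisc_series_slice0 a)
    then have "((\<lambda>n. (a n - (if fst n = 0 then a n else 0)) * monom2 n z) has_sum f z - f (0, snd z)) UNIV"
      using z by (simp add: bidisc_series_def)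
    also have "?this \<longleftrightarrow> ((\<lambda>n. a n * monom2 n z) has_sum f z - f (0, snd z)) (range ?S)"
    proof (rule has_sum_cong_neutral)
      fix n assume "n \<in> UNIV - range ?S"
      \<comment> \<open>Subtraction truncates, so this inequality can only hold when the first index
        is 0.\<close>
      then have "n \<noteq> ?S (fst n - 1, snd n)" by blast
      then have "fst n = 0" by (cases n) auto
      then show "(a n - (if fst n = 0 then a n else 0)) * monom2 n z = 0" by simp
    qed auto
    also have "\<dots> \<longleftrightarrow> ((\<lambda>n. a (?S n) * monom2 (?S n) z) has_sum f z - f (0, snd z)) UNIV"
      by (subst has_sum_reindex[OF inj]) (simp add: o_def)
    finally have "((\<lambda>n. fst z * (a (?S n) * monom2 n z)) has_sum f z - f (0, snd z)) UNIV"
      by (simp add: monom2_def ac_simps)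
    moreover have "((\<lambda>n. fst z * (a (?S n) * monom2 n z)) has_sum fst z * F z) UNIV"
      using F z by (intro has_sum_cmult_right) (simp add: bidisc_series_def)
    ultimately show ?thesis by (rule has_sum_unique)
  qed
  have eq: "backward_shift1 f z = F z" if z: "z \<in> bidisc" for z
  proof (cases "fst z = 0")
    case False
    then show ?thesis using split[OF z] by (simp add: backward_shift1_def field_simps)
  next
    case True
    let ?w = "snd z"
    have w: "?w \<in> ball 0 1" using z by (simp add: bidisc_iff)
    then have "(\<lambda>u. F (u, ?w)) holomorphic_on ball 0 1" using hol2_of_series[OF F] by (simp add: hol2_def)
    then have "\<forall>u\<in>ball 0 1. \<exists>D. ((\<lambda>u. F (u, ?w)) has_field_derivative D) (at u)"
      by (simp add: holomorphic_on_open)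
    then obtain D where "((\<lambda>u. F (u, ?w)) has_field_derivative D) (at 0)"
      using centre_in_ball[of "0::complex" 1] zero_less_one by blast
    then have "((\<lambda>u. f (0, ?w) + u * F (u, ?w)) has_field_derivative F (0, ?w)) (at 0)"
      by (auto intro!: derivative_eq_intros)
    then have "((\<lambda>u. f (u, ?w)) has_field_derivative F (0, ?w)) (at 0)"
    proof (rule has_field_derivative_transform_within_open[of _ _ _ "ball 0 1"])
      show "f (0, ?w) + u * F (u, ?w) = f (u, ?w)" if "u \<in> ball 0 1" for u
        using split[of "(u, ?w)"] that w by (auto simp: bidisc_def algebra_simps)
    qed auto
    moreover have "F z = F (0, ?w)" using True by (cases z) simp
    ultimately show ?thesis using True by (simp add: backward_shift1_def DERIV_imp_deriv)
  qed
  show "hol2 (backward_shift1 f)" using hol2_cong[of "backward_shift1 f" F, OF eq] hol2_of_series[OF F] by simp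
  show "z \<in> bidisc \<Longrightarrow> fst z * backward_shift1 f z = f z - f (0, snd z)" using eq split by simp
qed

lemma summable_infsum_0D:
  fixes f :: "'i \<Rightarrow> real"
  assumes "f summable_on A" "infsum f A \<le> 0" "\<And>x. x \<in> A \<Longrightarrow> f x \<ge> 0" "x \<in> A"
  shows "f x = 0"
  using finite_sum_le_infsum[OF assms(1), of "{x}"] assms by fastforce

text \<open>Multiplication by \<phi> is isometric because |\<phi>| = 1 almost everywhere on the
  torus; coefficient sums are the form in which norms are compared later.\<close>

lemma inner_mult_norm_eq:
  assumes \<phi>: "inner_function \<phi>" and G: "hardy_coeffs G \<gamma>" and H: "hardy_coeffs (\<lambda>z. \<phi> z * G z) \<kappa>"
  shows "(\<Sum>\<^sub>\<infinity>n. (cmod (\<kappa> n))\<^sup>2) = (\<Sum>\<^sub>\<infinity>n. (cmod (\<gamma> n))\<^sup>2)"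
proof -
  let ?T = torus_measure
  have Gh: "G \<in> hardy_space" and Hh: "(\<lambda>z. \<phi> z * G z) \<in> hardy_space"
    using G H unfolding hardy_space_def by blast+
  have "(\<integral>\<zeta>. (cmod (boundary_values (\<lambda>z. \<phi> z * G z) \<zeta>))\<^sup>2 \<partial>?T) = (\<integral>\<zeta>. (cmod (boundary_values G \<zeta>))\<^sup>2 \<partial>?T)"
  proof (rule integral_cong_AE)
    show "AE \<zeta> in ?T. (cmod (boundary_values (\<lambda>z. \<phi> z * G z) \<zeta>))\<^sup>2 = (cmod (boundary_values G \<zeta>))\<^sup>2"
      using boundary_values_mult[OF inner_function_hardy[OF \<phi>] Gh Hh] inner_function_boundary_values[OF \<phi>]
      by eventually_elim (simp add: norm_mult)
  qed (use L2_D(2)[OF boundary_values_L2[OF Gh]] L2_D(2)[OF boundary_values_L2[OF Hh]] in auto)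
  then show ?thesis
    using infsumI[OF hardy_coeffs_norm_has_sum[OF G]] infsumI[OF hardy_coeffs_norm_has_sum[OF H]]
    by (simp add: L2_norm_sq)
qed


subsection \<open>Divisibility by the inner function\<close>

text \<open>Setting z_1 = 0 retains exactly the coefficients with first index 0, so the slice is the
  projection of \<phi> onto the functions of z_2.\<close>

lemma inner_slice0:
  assumes \<phi>: "inner_function \<phi>"
  shows "hol2 (\<lambda>z. \<phi> (0, snd z))" "z \<in> bidisc \<Longrightarrow> cmod (\<phi> (0, snd z)) \<le> 1"
    and "(\<lambda>z. \<phi> (0, snd z)) \<in> hardy_z2"
    and "hardy_coeffs (\<lambda>z. \<phi> (0, snd z)) (\<lambda>n. if fst n = 0 then taylor_coeffs \<phi> n else 0)"
proof -
  let ?b = "\<lambda>n. if fst n = 0 then taylor_coeffs \<phi> n else 0"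
  have "bidisc_series \<phi> (taylor_coeffs \<phi>)"
    using hardy_coeffs_taylor[OF inner_function_hardy[OF \<phi>]] by (simp add: hardy_coeffs_iff)
  then have s: "bidisc_series (\<lambda>z. \<phi> (0, snd z)) ?b" by (rule bidisc_series_slice0)
  then show hol: "hol2 (\<lambda>z. \<phi> (0, snd z))" by (rule hol2_of_series)
  show le: "cmod (\<phi> (0, snd z)) \<le> 1" if "z \<in> bidisc" for z
    using that by (intro inner_function_norm_le_1 \<phi>) (simp add: bidisc_iff)
  have "(\<lambda>z. \<phi> (0, snd z)) \<in> hardy_space" by (rule hardy_space_bounded[OF hol le])
  then obtain b where b: "hardy_coeffs (\<lambda>z. \<phi> (0, snd z)) b" unfolding hardy_space_def by blast
  with s have "b = ?b" by (intro bidisc_series_unique) (auto simp: hardy_coeffs_iff)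
  with b show c: "hardy_coeffs (\<lambda>z. \<phi> (0, snd z)) ?b" by simp
  show "(\<lambda>z. \<phi> (0, snd z)) \<in> hardy_z2" by (rule hardy_z2I[OF c]) simp
qed

text \<open>Testing the assumption on the reproducing kernels of \<open>K\<^sub>\<phi>\<close> shows that \<open>\<theta> \<cdot> \<phi>(0, \<cdot>)\<close> is
  orthogonal to \<open>K\<^sub>\<phi>\<close>, hence divisible by \<open>\<phi>\<close>; the quotient is the Riesz projection of
  \<open>\<theta> \<cdot> \<phi>(0, \<cdot>)\<close> times the conjugate of \<open>\<phi>\<close>.\<close>

lemma model_space_invariant_factor:
  assumes \<phi>: "inner_function \<phi>" and \<theta>: "\<theta> \<in> hardy_space" "\<And>z. z \<in> bidisc \<Longrightarrow> cmod (\<theta> z) \<le> B"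
    and inv: "\<And>f. f \<in> model_space \<phi> \<Longrightarrow>
      proj_hardy_z2 (mult_cnj_boundary \<theta> (boundary_values f)) \<in> model_space \<phi>"
  obtains g where "g \<in> hardy_space" "\<And>w. w \<in> bidisc \<Longrightarrow> \<theta> w * \<phi> (0, snd w) = \<phi> w * g w"
proof -
  let ?T = torus_measure
  define c :: "complex \<times> complex \<Rightarrow> complex" where "c = (\<lambda>z. \<phi> (0, snd z))"
  note cz = inner_slice0(3)[OF \<phi>, folded c_def] and cc = inner_slice0(4)[OF \<phi>, folded c_def]
  note ch = hardy_z2_hardy_space[OF cz] and \<phi>h = inner_function_hardy[OF \<phi>]
  have \<theta>c: "(\<lambda>z. \<theta> z * c z) \<in> hardy_space"
    by (rule hardy_space_bounded_mult[OF hardy_space_hol2[OF \<theta>(1)] \<theta>(2) ch])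
  \<comment> \<open>On the torus, multiplying by the conjugate is dividing by \<phi>; this stays in
    L2 even if \<phi> has zeros in the bidisc.\<close>
  define E where "E \<zeta> = cnj (boundary_values \<phi> \<zeta>) * boundary_values (\<lambda>z. \<theta> z * c z) \<zeta>" for \<zeta>
  note [measurable] = L2_D(1)[OF boundary_values_L2[OF \<phi>h]] L2_D(1)[OF L2_cnj[OF boundary_values_L2[OF \<phi>h]]]
    L2_D(1)[OF boundary_values_L2[OF \<theta>(1)]] L2_D(1)[OF L2_cnj[OF boundary_values_L2[OF \<theta>(1)]]]
    L2_D(1)[OF boundary_values_L2[OF ch]] L2_D(1)[OF L2_cnj[OF boundary_values_L2[OF ch]]]
    L2_D(1)[OF boundary_values_L2[OF \<theta>c]] L2_D(1)[OF L2_cnj[OF boundary_values_L2[OF \<theta>c]]]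
  have EL: "E \<in> L2 ?T"
    unfolding E_def
    by (rule L2_mult_bounded[where B = 1, OF boundary_values_L2[OF \<theta>c]])
       (use inner_function_boundary_values[OF \<phi>] in auto)
  define g where "g w = (\<integral>\<zeta>. E \<zeta> * cnj (boundary_values (szego_kernel w) \<zeta>) \<partial>?T)" for w
  have "g \<in> hardy_space"
    using hardy_coeffs_Riesz[OF EL] unfolding hardy_space_def g_def by blast
  moreover have "\<theta> w * c w = \<phi> w * g w" if w: "w \<in> bidisc" for w
  proof -
    let ?f = "model_kernel \<phi> w"
    note fm = model_kernel_in_model_space[OF \<phi> w] and fh = model_kernel_hardy[OF \<phi> w]
      and kh = szego_kernel_hardy[OF w]
    define E0 where "E0 = mult_cnj_boundary \<theta> (boundary_values ?f)"
    define p where "p = proj_hardy_z2 E0"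
    have E0L: "E0 \<in> L2 ?T"
      unfolding E0_def mult_cnj_boundary_def[abs_def]
      by (rule L2_mult_bounded[where B = B, OF boundary_values_L2[OF fh]])
         (use boundary_values_bounded[OF \<theta>] in auto)
    have pz: "p \<in> hardy_z2" unfolding p_def by (rule proj_hardy_z2(1)[OF E0L])
    note ph = hardy_z2_hardy_space[OF pz]
    obtain b where b: "hardy_coeffs p b" "\<And>n. fst n \<noteq> 0 \<Longrightarrow> b n = 0"
      by (rule hardy_z2D[OF pz]) (rule that)
    have "p \<in> model_space \<phi>" unfolding p_def E0_def by (rule inv[OF fm])
    then have "\<forall>h\<in>hardy_space. hardy_inner p (\<lambda>z. \<phi> z * h z) = 0"
      by (simp add: model_space_def)
    \<comment> \<open>The test function h = 1 gives orthogonality to \<phi> itself.\<close>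
    from bspec[OF this hardy_space_one] have "hardy_inner p (\<lambda>z. \<phi> z * 1) = 0" .
    \<comment> \<open>The coefficients of \<open>p\<close> vanish unless the first index is 0, where
      \<phi> and \<open>c\<close> have the same ones.\<close>
    then have "hardy_inner p c = 0"
      unfolding hardy_inner_def taylor_coeffs_eq[OF b(1)] taylor_coeffs_eq[OF cc]
      by (simp only: mult_1_right) (subst infsum_cong; use b(2) in auto)
    then have "(\<integral>\<zeta>. boundary_values p \<zeta> * cnj (boundary_values c \<zeta>) \<partial>?T) = 0"
      by (simp add: hardy_inner_eq_integral[OF ph ch])
    moreover have "(\<integral>\<zeta>. (E0 \<zeta> - boundary_values p \<zeta>) * cnj (boundary_values c \<zeta>) \<partial>?T) = 0"
      unfolding p_def by (rule proj_hardy_z2(2)[OF E0L cz])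
    ultimately have "(\<integral>\<zeta>. E0 \<zeta> * cnj (boundary_values c \<zeta>) \<partial>?T) = 0"
      using L2_mult_integrable[OF E0L boundary_values_L2[OF ch]]
        L2_mult_integrable[OF boundary_values_L2[OF ph] boundary_values_L2[OF ch]]
      by (simp add: left_diff_distrib)
    \<comment> \<open>Conjugation moves the bar from \<theta> and \<open>c\<close> onto the Szego
      kernel, so that the reproducing formula applies to \<theta> c.\<close>
    then have "(\<integral>\<zeta>. cnj (E0 \<zeta> * cnj (boundary_values c \<zeta>)) \<partial>?T) = 0"
      by (simp only: Bochner_Integration.integral_cnj complex_cnj_zero)
    also have "(\<integral>\<zeta>. cnj (E0 \<zeta> * cnj (boundary_values c \<zeta>)) \<partial>?T)
       = (\<integral>\<zeta>. boundary_values (\<lambda>z. \<theta> z * c z) \<zeta> * cnj (boundary_values (szego_kernel w) \<zeta>)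
            - \<phi> w * (E \<zeta> * cnj (boundary_values (szego_kernel w) \<zeta>)) \<partial>?T)"
    proof (rule integral_cong_AE)
      note [measurable] = L2_D(1)[OF E0L] L2_D(1)[OF L2_cnj[OF E0L]] L2_D(1)[OF EL]
        L2_D(1)[OF L2_cnj[OF boundary_values_L2[OF kh]]]
      show "(\<lambda>\<zeta>. cnj (E0 \<zeta> * cnj (boundary_values c \<zeta>))) \<in> borel_measurable ?T"
        unfolding complex_cnj_mult complex_cnj_cnj by measurable
      show "(\<lambda>\<zeta>. boundary_values (\<lambda>z. \<theta> z * c z) \<zeta> * cnj (boundary_values (szego_kernel w) \<zeta>)
            - \<phi> w * (E \<zeta> * cnj (boundary_values (szego_kernel w) \<zeta>))) \<in> borel_measurable ?T"
        by measurable
      show "AE \<zeta> in ?T. cnj (E0 \<zeta> * cnj (boundary_values c \<zeta>)) =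
          boundary_values (\<lambda>z. \<theta> z * c z) \<zeta> * cnj (boundary_values (szego_kernel w) \<zeta>)
            - \<phi> w * (E \<zeta> * cnj (boundary_values (szego_kernel w) \<zeta>))"
        using boundary_values_model_kernel[OF \<phi> w] boundary_values_mult[OF \<theta>(1) ch \<theta>c]
      proof eventually_elim
        case (elim \<zeta>)
        show ?case
          unfolding E0_def mult_cnj_boundary_def E_def elim by (simp add: algebra_simps)
      qed
    qed
    also have "\<dots> = (\<integral>\<zeta>. boundary_values (\<lambda>z. \<theta> z * c z) \<zeta> * cnj (boundary_values (szego_kernel w) \<zeta>) \<partial>?T)
       - (\<integral>\<zeta>. \<phi> w * (E \<zeta> * cnj (boundary_values (szego_kernel w) \<zeta>)) \<partial>?T)"
      by (intro Bochner_Integration.integral_diff integrable_mult_right L2_mult_integrable boundary_values_L2 \<theta>c kh EL)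
    also have "\<dots> = \<theta> w * c w - \<phi> w * g w"
      using Szego_reproducing[OF \<theta>c w] by (simp add: g_def)
    finally show ?thesis by simp
  qed
  ultimately show thesis by (intro that[of g]) (simp_all add: c_def)
qed

text \<open>With \<open>c = \<phi>(0, \<cdot>)\<close>, the function \<open>c - u\<close> satisfies \<open>\<phi> (c - u) = c\<^sup>2\<close>, and \<open>u\<close> is orthogonal to
  \<open>c\<close>, so \<open>\<parallel>c\<parallel>\<^sup>2 + \<parallel>u\<parallel>\<^sup>2 = \<parallel>\<phi> (c - u)\<parallel>\<^sup>2 = \<parallel>c\<^sup>2\<parallel>\<^sup>2 \<le> \<parallel>c\<parallel>\<^sup>2\<close>.\<close>

lemma inner_factor_vanishes:
  assumes \<phi>: "inner_function \<phi>" and u: "u \<in> hardy_space"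
    and u0: "\<And>z. z \<in> bidisc \<Longrightarrow> u (0, snd z) = 0"
    and eq: "\<And>z. z \<in> bidisc \<Longrightarrow> \<phi> z * u z = (\<phi> z - \<phi> (0, snd z)) * \<phi> (0, snd z)"
    and z: "z \<in> bidisc"
  shows "u z = 0"
proof -
  define c :: "complex \<times> complex \<Rightarrow> complex" where "c = (\<lambda>z. \<phi> (0, snd z))"
  define b where "b n = (if fst n = 0 then taylor_coeffs \<phi> n else 0)" for n
  have cc: "hardy_coeffs c b" using inner_slice0(4)[OF \<phi>] by (simp add: c_def b_def[abs_def])
  obtain \<upsilon> where \<upsilon>: "hardy_coeffs u \<upsilon>" using u unfolding hardy_space_def by blast
  have "bidisc_series (\<lambda>z. u (0, snd z)) (\<lambda>n. if fst n = 0 then \<upsilon> n else 0)"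
    using \<upsilon> by (intro bidisc_series_slice0) (simp add: hardy_coeffs_iff)
  moreover have "bidisc_series (\<lambda>z. u (0, snd z)) (\<lambda>n. 0)"
    using u0 by (simp add: bidisc_series_def)
  ultimately have "(\<lambda>n. if fst n = 0 then \<upsilon> n else 0) = (\<lambda>n. 0)" by (rule bidisc_series_unique)
  then have \<upsilon>0: "\<upsilon> n = 0" if "fst n = 0" for n using that by (metis (mono_tags))
  have sb: "(\<lambda>n. (cmod (b n))\<^sup>2) summable_on UNIV" and su: "(\<lambda>n. (cmod (\<upsilon> n))\<^sup>2) summable_on UNIV"
    using cc \<upsilon> by (auto simp: hardy_coeffs_iff)
  \<comment> \<open>At each index one of the two terms is 0: \<open>b\<close> lives on first index
    0, and \<open>\<upsilon>\<close> vanishes there.\<close>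
  have pyth: "(cmod (b n - \<upsilon> n))\<^sup>2 = (cmod (b n))\<^sup>2 + (cmod (\<upsilon> n))\<^sup>2" for n
    using \<upsilon>0[of n] by (cases "fst n = 0") (simp_all add: b_def)
  have G: "hardy_coeffs (\<lambda>z. c z - u z) (\<lambda>n. b n - \<upsilon> n)"
    unfolding hardy_coeffs_iff pyth
  proof
    show "bidisc_series (\<lambda>z. c z - u z) (\<lambda>n. b n - \<upsilon> n)"
      using cc \<upsilon> by (intro bidisc_series_diff) (auto simp: hardy_coeffs_iff)
  qed (rule summable_on_add[OF sb su])
  then have "(\<lambda>z. c z - u z) \<in> hardy_space" unfolding hardy_space_def by blast
  from inner_mult_hardy[OF \<phi> this] obtain \<kappa> where \<kappa>: "hardy_coeffs (\<lambda>z. \<phi> z * (c z - u z)) \<kappa>"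
    unfolding hardy_space_def by blast
  have c2: "\<phi> z * (c z - u z) = c z * c z" if "z \<in> bidisc" for z
    using eq[OF that] by (simp add: c_def algebra_simps)
  have "(\<Sum>\<^sub>\<infinity>n. (cmod (\<kappa> n))\<^sup>2) \<le> (\<Sum>\<^sub>\<infinity>n. (cmod (b n))\<^sup>2)"
  proof (rule hardy_coeffsI(2))
    show "bidisc_series (\<lambda>z. \<phi> z * (c z - u z)) \<kappa>" using \<kappa> by (simp add: hardy_coeffs_iff)
    fix r :: real assume r: "0 \<le> r" "r < 1"
    have "(\<integral>\<zeta>. (cmod (\<phi> (r *\<^sub>R \<zeta>) * (c (r *\<^sub>R \<zeta>) - u (r *\<^sub>R \<zeta>))))\<^sup>2 \<partial>torus_measure)
        \<le> (\<integral>\<zeta>. (cmod (c (r *\<^sub>R \<zeta>)))\<^sup>2 \<partial>torus_measure)"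
    proof (rule integral_mono)
      show "integrable torus_measure (\<lambda>\<zeta>. (cmod (\<phi> (r *\<^sub>R \<zeta>) * (c (r *\<^sub>R \<zeta>) - u (r *\<^sub>R \<zeta>))))\<^sup>2)"
        by (rule L2_D(2)[OF dilation_L2[OF hardy_coeffs_hol2[OF \<kappa>] r]])
      show "integrable torus_measure (\<lambda>\<zeta>. (cmod (c (r *\<^sub>R \<zeta>)))\<^sup>2)"
        by (rule L2_D(2)[OF dilation_L2[OF hardy_coeffs_hol2[OF cc] r]])
      fix \<zeta> assume "\<zeta> \<in> space torus_measure"
      then have \<zeta>: "r *\<^sub>R \<zeta> \<in> bidisc" by (intro scaleR_torus_in_bidisc r) simp
      have "cmod (c (r *\<^sub>R \<zeta>)) \<le> 1" unfolding c_def by (rule inner_slice0(2)[OF \<phi> \<zeta>])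
      then show "(cmod (\<phi> (r *\<^sub>R \<zeta>) * (c (r *\<^sub>R \<zeta>) - u (r *\<^sub>R \<zeta>))))\<^sup>2 \<le> (cmod (c (r *\<^sub>R \<zeta>)))\<^sup>2"
        unfolding c2[OF \<zeta>] by (intro power_mono) (simp_all add: norm_mult mult_left_le)
    qed
    also have "\<dots> \<le> (\<Sum>\<^sub>\<infinity>n. (cmod (b n))\<^sup>2)" by (rule hardy_dilation_norm_le[OF cc r])
    finally show "(\<integral>\<zeta>. (cmod (\<phi> (r *\<^sub>R \<zeta>) * (c (r *\<^sub>R \<zeta>) - u (r *\<^sub>R \<zeta>))))\<^sup>2 \<partial>torus_measure) \<le> \<dots>" .
  qed
  also have "(\<Sum>\<^sub>\<infinity>n. (cmod (\<kappa> n))\<^sup>2) = (\<Sum>\<^sub>\<infinity>n. (cmod (b n))\<^sup>2) + (\<Sum>\<^sub>\<infinity>n. (cmod (\<upsilon> n))\<^sup>2)"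
    unfolding inner_mult_norm_eq[OF \<phi> G \<kappa>] pyth by (rule infsum_add[OF sb su])
  finally have "(cmod (\<upsilon> n))\<^sup>2 = 0" for n
    by (intro summable_infsum_0D[OF su]) auto
  then have "\<upsilon> = (\<lambda>n. 0)" by auto
  then have "((\<lambda>n::nat \<times> nat. 0) has_sum u z) UNIV"
    using \<upsilon> z by (simp add: hardy_coeffs_iff bidisc_series_def)
  then show ?thesis by (metis has_sum_0 has_sum_unique)
qed

section \<open>Independence of the first variable, and the contradiction\<close>

theorem proposition4p7:
  fixes \<phi> :: "complex \<times> complex \<Rightarrow> complex" and \<alpha> :: complex
    and \<sigma> :: "(complex \<times> complex) measure"
    and J :: "(complex \<times> complex \<Rightarrow> complex) \<Rightarrow> complex \<times> complex \<Rightarrow> complex"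
  assumes "inner_function \<phi>"
    and "depends_on_z1 \<phi>"
    and "depends_on_z2 \<phi>"
    and "cmod \<alpha> = 1"
    and "clark_measure \<phi> \<alpha> \<sigma>"
    and "clark_embedding \<phi> \<alpha> \<sigma> J"
    and "surjective_onto_L2 \<phi> \<sigma> J"
    and "bounded (clark_theta1 \<phi> \<alpha> ` bidisc)"
    and "(\<lambda>z. 1 / (1 - cnj \<alpha> * \<phi> (0, snd z))) \<in> hardy_z2"
    and "\<exists>z2\<in>ball 0 1. \<phi> (0, z2) \<noteq> 0"
  shows "\<exists>f\<in>model_space \<phi>.
           proj_hardy_z2 (mult_cnj_boundary (clark_theta1 \<phi> \<alpha>) (boundary_values f))
             \<notin> model_space \<phi>"
proof (rule ccontr)
  assume "\<not> ?thesis"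
  then have inv: "proj_hardy_z2 (mult_cnj_boundary (clark_theta1 \<phi> \<alpha>) (boundary_values f)) \<in> model_space \<phi>"
    if "f \<in> model_space \<phi>" for f using that by blast
  note \<phi> = assms(1)
  note hol = inner_function_hol2[OF \<phi>]
  define c :: "complex \<times> complex \<Rightarrow> complex" where "c = (\<lambda>z. \<phi> (0, snd z))"
  define D where "D = (\<lambda>z. 1 - cnj \<alpha> * c z)"
  have c_hol: "hol2 c" and c_le: "\<And>z. z \<in> bidisc \<Longrightarrow> cmod (c z) \<le> 1"
    using inner_slice0(1,2)[OF \<phi>] by (simp_all add: c_def)
  have "clark_theta1 \<phi> \<alpha> = (\<lambda>z. (cnj \<alpha> * backward_shift1 \<phi> z) * (1 / (1 - cnj \<alpha> * \<phi> (0, snd z))))"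
    by (simp add: clark_theta1_def fun_eq_iff)
  \<comment> \<open>Holomorphy of the reciprocal is drawn from its membership in the Hardy space of
    z_2. This does not rule out a zero denominator, whence the case distinction on
    \<open>D z\<close> below.\<close>
  moreover have "hol2 (\<lambda>z. (cnj \<alpha> * backward_shift1 \<phi> z) * (1 / (1 - cnj \<alpha> * \<phi> (0, snd z))))"
    by (intro hol2_mult hol2_const hol2_backward_shift1 hol hardy_space_hol2 hardy_z2_hardy_space assms(9))
  ultimately have \<theta>_hol: "hol2 (clark_theta1 \<phi> \<alpha>)" by simp
  obtain B where B: "\<And>z. z \<in> bidisc \<Longrightarrow> cmod (clark_theta1 \<phi> \<alpha> z) \<le> B"
    using assms(8) by (auto simp: bounded_iff)
  obtain g where g: "g \<in> hardy_space"
    and fac: "\<And>w. w \<in> bidisc \<Longrightarrow> clark_theta1 \<phi> \<alpha> w * \<phi> (0, snd w) = \<phi> w * g w"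
    by (rule model_space_invariant_factor[OF \<phi> hardy_space_bounded[OF \<theta>_hol B] B inv]) (assumption | rule that)+
  have \<alpha>: "\<alpha> * cnj \<alpha> = 1" using assms(4) complex_norm_square[of \<alpha>] by simp
  define u where "u = (\<lambda>z. (\<alpha> * fst z * D z) * g z)"
  have "u \<in> hardy_space"
    unfolding u_def
  proof (rule hardy_space_bounded_mult[OF _ _ g])
    show "hol2 (\<lambda>z. \<alpha> * fst z * D z)"
      unfolding D_def by (intro hol2_mult hol2_diff hol2_const hol2_fst c_hol)
    fix z assume z: "z \<in> bidisc"
    have "cmod (D z) \<le> 1 + 1"
      unfolding D_def by (rule order_trans[OF norm_triangle_ineq4]) (simp add: norm_mult assms(4) c_le[OF z])
    then have "cmod (fst z) * cmod (D z) \<le> 1 * (1 + 1)"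
      using z by (intro mult_mono) (auto simp: bidisc_iff)
    then show "cmod (\<alpha> * fst z * D z) \<le> 2" by (simp add: norm_mult assms(4))
  qed
  moreover have "u (0, snd z) = 0" for z by (simp add: u_def)
  moreover have "\<phi> z * u z = (\<phi> z - \<phi> (0, snd z)) * \<phi> (0, snd z)" if z: "z \<in> bidisc" for z
  proof (cases "D z = 0")
    case False
    have "\<phi> z * u z = \<alpha> * fst z * D z * (clark_theta1 \<phi> \<alpha> z * c z)"
      using fac[OF z] by (simp add: u_def c_def ac_simps)
    also have "\<dots> = (\<alpha> * cnj \<alpha>) * (fst z * backward_shift1 \<phi> z) * c z"
      using False by (simp add: clark_theta1_def D_def c_def)
    also have "\<dots> = (\<phi> z - \<phi> (0, snd z)) * c z"
      using hol2_backward_shift1(2)[OF hol z] \<alpha> by simp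
    finally show ?thesis by (simp add: c_def)
  next
    \<comment> \<open>Here \<open>\<theta>\<close> has the junk value \<open>0\<close>, but \<open>\<bar>\<phi>(0, z\<^sub>2)\<bar> = 1\<close> and the slice is constant.\<close>
    case True
    then have "cnj \<alpha> * c z = 1" by (simp add: D_def)
    then have "cmod (cnj \<alpha> * c z) = 1" by simp
    then have one: "cmod (\<phi> (0, snd z)) = 1" by (simp add: norm_mult assms(4) c_def)
    have w: "snd z \<in> ball 0 1" using z by (simp add: bidisc_iff)
    have "(\<lambda>x. \<phi> (x, snd z)) constant_on ball 0 1"
    proof (rule maximum_modulus_principle[of _ _ "ball 0 1" 0])
      show "(\<lambda>x. \<phi> (x, snd z)) holomorphic_on ball 0 1" using hol w by (simp add: hol2_def)
      show "cmod (\<phi> (x, snd z)) \<le> cmod (\<phi> (0, snd z))" if "x \<in> ball 0 1" for x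
        unfolding one using that w by (intro inner_function_norm_le_1 \<phi>) (simp add: bidisc_def)
    qed auto
    then obtain y where y: "\<forall>x\<in>ball 0 1. \<phi> (x, snd z) = y" unfolding constant_on_def by blast
    have "\<phi> (fst z, snd z) = \<phi> (0, snd z)"
      using bspec[OF y, of "fst z"] bspec[OF y, of 0] z by (simp add: bidisc_iff)
    with True show ?thesis by (simp add: u_def)
  qed
  ultimately have "u z = 0" if "z \<in> bidisc" for z
    using inner_factor_vanishes[OF \<phi>] that by blast
  then have prod0: "(\<phi> z - \<phi> (0, snd z)) * \<phi> (0, snd z) = 0" if "z \<in> bidisc" for z
    using that \<open>\<And>z. z \<in> bidisc \<Longrightarrow> \<phi> z * u z = (\<phi> z - \<phi> (0, snd z)) * \<phi> (0, snd z)\<close>[OF that] by simp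
  have slice_hol: "(\<lambda>w. \<phi> (x, w)) holomorphic_on ball 0 1" if "x \<in> ball 0 1" for x
    using hol that by (simp add: hol2_def)
  \<comment> \<open>Where the slice is nonzero the vanishing product forces \<phi>(x, w) = \<phi>(0,
    w). This set of w is open and nonempty, so the identity theorem in w extends the equality to the
    whole disc.\<close>
  let ?V = "ball 0 1 \<inter> (\<lambda>w. \<phi> (0, w)) -` (- {0})"
  have V: "open ?V"
    by (intro continuous_open_preimage holomorphic_on_imp_continuous_on slice_hol) auto
  have "\<phi> (x, w) = \<phi> (0, w)" if x: "x \<in> ball 0 1" and w: "w \<in> ball 0 1" for x w
  proof (rule analytic_continuation_open[of ?V "ball 0 1" "\<lambda>w. \<phi> (x, w)" "\<lambda>w. \<phi> (0, w)"])
    show "?V \<noteq> {}" using assms(10) by auto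
    show "\<phi> (x, v) = \<phi> (0, v)" if "v \<in> ?V" for v
      using prod0[of "(x, v)"] that x by (auto simp: bidisc_def)
  qed (use V x w in \<open>auto intro: slice_hol\<close>)
  then have "\<not> depends_on_z1 \<phi>" unfolding depends_on_z1_def by metis
  with assms(2) show False by contradiction
qed

end
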